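(* Semi-affinoid $K$-algebras are Jacobson rings.
   Context: $R$ is a complete discrete valuation ring with fraction field $K$ and uniformizer $\pi$. An $R$-algebra is of formally finite (ff) type if it is a quotient of some $R[[S_1,\dots,S_m]]\langle T_1,\dots,T_n\rangle$, the ring of strictly convergent power series in the $T_j$ over $R[[S_1,\dots,S_m]]$ with its $(\pi,S_1,\dots,S_m)$-adic topology. A $K$-algebra is semi-affinoid if it is isomorphic to $\underline A\otimes_RK$ for an $R$-algebra $\underline A$ of ff type. A ring is Jacobson if every prime ideal is an intersection of maximal ideals. *)

theory Defs
  imports
    "HOL-Library.Multiset"
    "HOL-Library.Poly_Mapping"
    "HOL-Algebra.Algebra"
begin

definition discrete_valuation_ring :: "'r ring \<Rightarrow> bool" where
  "discrete_valuation_ring R \<longleftrightarrow>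
     principal_domain R \<and> \<not> field R \<and> (\<exists>!M. maximalideal M R)"

definition uniformizer :: "'r ring \<Rightarrow> 'r \<Rightarrow> bool" where
  "uniformizer R \<pi> \<longleftrightarrow> \<pi> \<in> carrier R \<and> maximalideal (PIdl\<^bsub>R\<^esub> \<pi>) R"

abbreviation ideal_power :: "'a ring \<Rightarrow> 'a set \<Rightarrow> nat \<Rightarrow> 'a set" where
  "ideal_power R I k \<equiv> I [^]\<^bsub>ideals_set R\<^esub> k"

definition adically_complete :: "'r ring \<Rightarrow> 'r set \<Rightarrow> bool" where
  "adically_complete R I \<longleftrightarrow>
     (\<Inter>k. ideal_power R I k) = {\<zero>\<^bsub>R\<^esub>} \<and>
     (\<forall>x :: nat \<Rightarrow> 'r. range x \<subseteq> carrier R \<longrightarrow>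
        (\<forall>k. \<exists>N. \<forall>i\<ge>N. \<forall>j\<ge>N. x i \<ominus>\<^bsub>R\<^esub> x j \<in> ideal_power R I k) \<longrightarrow>
        (\<exists>l\<in>carrier R. \<forall>k. \<exists>N. \<forall>i\<ge>N. x i \<ominus>\<^bsub>R\<^esub> l \<in> ideal_power R I k))"

definition complete_dvr :: "'r ring \<Rightarrow> bool" where
  "complete_dvr R \<longleftrightarrow>
     discrete_valuation_ring R \<and> (\<forall>M. maximalideal M R \<longrightarrow> adically_complete R M)"

text \<open>The structure map of an \<open>R\<close>-algebra \<open>A\<close> is \<open>r \<mapsto> r \<odot> \<one>\<close>.\<close>

definition fraction_field :: "'r ring \<Rightarrow> ('r, 'k) module \<Rightarrow> bool" where
  "fraction_field R K \<longleftrightarrow>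
     algebra R K \<and> field K \<and> inj_on (\<lambda>r. r \<odot>\<^bsub>K\<^esub> \<one>\<^bsub>K\<^esub>) (carrier R) \<and>
     (\<forall>x\<in>carrier K. \<exists>a\<in>carrier R. \<exists>b\<in>carrier R - {\<zero>\<^bsub>R\<^esub>}.
        x = (a \<odot>\<^bsub>K\<^esub> \<one>\<^bsub>K\<^esub>) \<otimes>\<^bsub>K\<^esub> inv\<^bsub>K\<^esub> (b \<odot>\<^bsub>K\<^esub> \<one>\<^bsub>K\<^esub>))"

definition algebra_hom ::
    "('r, 'z) ring_scheme \<Rightarrow> ('r, 'a) module \<Rightarrow> ('r, 'b) module \<Rightarrow> ('a \<Rightarrow> 'b) set" where
  "algebra_hom R A B =
     {h \<in> ring_hom A B. \<forall>r\<in>carrier R. \<forall>a\<in>carrier A. h (r \<odot>\<^bsub>A\<^esub> a) = r \<odot>\<^bsub>B\<^esub> h a}"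

definition algebra_isomorphic ::
    "('r, 'z) ring_scheme \<Rightarrow> ('r, 'a) module \<Rightarrow> ('r, 'b) module \<Rightarrow> bool" where
  "algebra_isomorphic R A B \<longleftrightarrow>
     (\<exists>h\<in>algebra_hom R A B. bij_betw h (carrier A) (carrier B))"

text \<open>A power series over \<open>B\<close> in the variables \<open>X\<^sub>i\<close>, \<open>i < n\<close>, is its coefficient function;
  the monomial \<open>\<Prod>i. X\<^sub>i ^ e\<^sub>i\<close> is encoded by the multiset containing each \<open>i\<close> with
  multiplicity \<open>e\<^sub>i\<close>.\<close>

definition power_series_ring :: "'b ring \<Rightarrow> nat \<Rightarrow> (nat multiset \<Rightarrow> 'b) ring" where
  "power_series_ring B n =
     \<lparr>carrier = {f. (\<forall>e. f e \<in> carrier B) \<and> (\<forall>e. \<not> set_mset e \<subseteq> {..<n} \<longrightarrow> f e = \<zero>\<^bsub>B\<^esub>)},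
      monoid.mult = (\<lambda>f g e. \<Oplus>\<^bsub>B\<^esub>d\<in>{d. d \<subseteq># e}. f d \<otimes>\<^bsub>B\<^esub> g (e - d)),
      one = (\<lambda>e. if e = {#} then \<one>\<^bsub>B\<^esub> else \<zero>\<^bsub>B\<^esub>),
      ring.zero = (\<lambda>e. \<zero>\<^bsub>B\<^esub>),
      add = (\<lambda>f g e. f e \<oplus>\<^bsub>B\<^esub> g e)\<rparr>"

definition ps_const :: "'b ring \<Rightarrow> 'b \<Rightarrow> nat multiset \<Rightarrow> 'b" where
  "ps_const B b = (\<lambda>e. if e = {#} then b else \<zero>\<^bsub>B\<^esub>)"

definition ps_var :: "'b ring \<Rightarrow> nat \<Rightarrow> nat multiset \<Rightarrow> 'b" where
  "ps_var B i = (\<lambda>e. if e = {#i#} then \<one>\<^bsub>B\<^esub> else \<zero>\<^bsub>B\<^esub>)"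

text \<open>Coefficients tend to \<open>0\<close> in the \<open>I\<close>-adic topology of \<open>B\<close>, along the cofinite filter on
  the set of monomials.\<close>

definition strictly_convergent :: "'b ring \<Rightarrow> 'b set \<Rightarrow> nat \<Rightarrow> (nat multiset \<Rightarrow> 'b) ring" where
  "strictly_convergent B I n =
     (power_series_ring B n)
       \<lparr>carrier := {f \<in> carrier (power_series_ring B n).
                      \<forall>k. finite {e. f e \<notin> ideal_power B I k}}\<rparr>"

definition ff_ideal :: "'r ring \<Rightarrow> 'r \<Rightarrow> nat \<Rightarrow> (nat multiset \<Rightarrow> 'r) set" where
  "ff_ideal R \<pi> m =
     Idl\<^bsub>power_series_ring R m\<^esub> (insert (ps_const R \<pi>) (ps_var R ` {..<m}))"

text \<open>The \<open>R\<close>-algebra \<open>R[[S\<^sub>1, \<dots>, S\<^sub>m]]\<langle>T\<^sub>1, \<dots>, T\<^sub>n\<rangle>\<close>; an element \<open>f\<close> has the coefficient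
  \<open>f e d\<close> at \<open>S\<^sup>d T\<^sup>e\<close>.\<close>

definition ff_model ::
    "'r ring \<Rightarrow> 'r \<Rightarrow> nat \<Rightarrow> nat \<Rightarrow> ('r, nat multiset \<Rightarrow> nat multiset \<Rightarrow> 'r) module" where
  "ff_model R \<pi> m n =
     ring.extend (strictly_convergent (power_series_ring R m) (ff_ideal R \<pi> m) n)
       (module.fields (\<lambda>r f e d. r \<otimes>\<^bsub>R\<^esub> f e d))"

definition ff_type :: "'r ring \<Rightarrow> 'r \<Rightarrow> ('r, 'a) module \<Rightarrow> bool" where
  "ff_type R \<pi> A \<longleftrightarrow>
     algebra R A \<and>
     (\<exists>m n. \<exists>h\<in>algebra_hom R (ff_model R \<pi> m n) A.
        h ` carrier (ff_model R \<pi> m n) = carrier A)"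

text \<open>The tensor product \<open>A \<otimes>\<^sub>R C\<close> of commutative \<open>R\<close>-algebras is the free abelian group on
  \<open>A \<times> C\<close>, with the product \<open>(a, c) (a', c') = (a a', c c')\<close> extended bilinearly, modulo the
  bilinear relations. The subgroup spanned by these relations is stable under multiplication by
  the generators \<open>(a, c)\<close>, so it coincides with the ideal they generate.\<close>

definition free_pair_ring :: "('r, 'a) module \<Rightarrow> ('r, 'c) module \<Rightarrow> ('a \<times> 'c \<Rightarrow>\<^sub>0 int) ring"
  where
  "free_pair_ring A C =
     \<lparr>carrier = {x. Poly_Mapping.keys x \<subseteq> carrier A \<times> carrier C},
      monoid.mult = (\<lambda>x y. frag_extend (\<lambda>(a, c). frag_extend (\<lambda>(a', c').
                frag_of (a \<otimes>\<^bsub>A\<^esub> a', c \<otimes>\<^bsub>C\<^esub> c')) y) x),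
      one = frag_of (\<one>\<^bsub>A\<^esub>, \<one>\<^bsub>C\<^esub>),
      ring.zero = 0,
      add = (+)\<rparr>"

definition tensor_relations ::
    "'r ring \<Rightarrow> ('r, 'a) module \<Rightarrow> ('r, 'c) module \<Rightarrow> ('a \<times> 'c \<Rightarrow>\<^sub>0 int) set" where
  "tensor_relations R A C =
     {frag_of (a \<oplus>\<^bsub>A\<^esub> a', c) - frag_of (a, c) - frag_of (a', c) | a a' c.
        a \<in> carrier A \<and> a' \<in> carrier A \<and> c \<in> carrier C} \<union>
     {frag_of (a, c \<oplus>\<^bsub>C\<^esub> c') - frag_of (a, c) - frag_of (a, c') | a c c'.
        a \<in> carrier A \<and> c \<in> carrier C \<and> c' \<in> carrier C} \<union>
     {frag_of (r \<odot>\<^bsub>A\<^esub> a, c) - frag_of (a, r \<odot>\<^bsub>C\<^esub> c) | r a c.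
        r \<in> carrier R \<and> a \<in> carrier A \<and> c \<in> carrier C}"

definition tensor_ideal ::
    "'r ring \<Rightarrow> ('r, 'a) module \<Rightarrow> ('r, 'c) module \<Rightarrow> ('a \<times> 'c \<Rightarrow>\<^sub>0 int) set" where
  "tensor_ideal R A C = Idl\<^bsub>free_pair_ring A C\<^esub> (tensor_relations R A C)"

definition tensor_ring ::
    "'r ring \<Rightarrow> ('r, 'a) module \<Rightarrow> ('r, 'c) module \<Rightarrow> ('a \<times> 'c \<Rightarrow>\<^sub>0 int) set ring" where
  "tensor_ring R A C = free_pair_ring A C Quot tensor_ideal R A C"

definition pure_tensor ::
    "'r ring \<Rightarrow> ('r, 'a) module \<Rightarrow> ('r, 'c) module \<Rightarrow> 'a \<Rightarrow> 'c \<Rightarrow> ('a \<times> 'c \<Rightarrow>\<^sub>0 int) set" where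
  "pure_tensor R A C a c = tensor_ideal R A C +>\<^bsub>free_pair_ring A C\<^esub> frag_of (a, c)"

text \<open>\<open>A \<otimes>\<^sub>R K\<close> as a \<open>K\<close>-algebra via \<open>k \<mapsto> 1 \<otimes> k\<close>.\<close>

definition base_change ::
    "'r ring \<Rightarrow> ('r, 'a) module \<Rightarrow> ('r, 'k) module \<Rightarrow> ('k, ('a \<times> 'k \<Rightarrow>\<^sub>0 int) set) module" where
  "base_change R A K =
     ring.extend (tensor_ring R A K)
       (module.fields (\<lambda>k x. pure_tensor R A K \<one>\<^bsub>A\<^esub> k \<otimes>\<^bsub>tensor_ring R A K\<^esub> x))"

text \<open>A definition cannot quantify over the carrier type of \<open>A\<close>. The type chosen here is that of
  the cosets in \<open>R[[S]]\<langle>T\<rangle>\<close>, hence of the carriers of its quotient rings, so every algebra of ff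
  type has an isomorphic copy over it.\<close>

definition semi_affinoid :: "'r ring \<Rightarrow> 'r \<Rightarrow> ('r, 'k) module \<Rightarrow> ('k, 'b) module \<Rightarrow> bool" where
  "semi_affinoid R \<pi> K B \<longleftrightarrow>
     algebra K B \<and>
     (\<exists>A :: ('r, (nat multiset \<Rightarrow> nat multiset \<Rightarrow> 'r) set) module.
        ff_type R \<pi> A \<and> algebra_isomorphic K (base_change R A K) B)"

text \<open>The family \<open>\<M>\<close> is never empty: \<open>\<Inter>{} = UNIV\<close> is either not contained in the carrier
  or equal to it, hence not a prime ideal.\<close>

definition jacobson_ring :: "('b, 'm) ring_scheme \<Rightarrow> bool" where
  "jacobson_ring B \<longleftrightarrow>
     cring B \<and> (\<forall>P. primeideal P B \<longrightarrow> (\<exists>\<M>. (\<forall>M\<in>\<M>. maximalideal M B) \<and> P = \<Inter>\<M>))"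

end

theory Submission
  imports
    Defs
    "HOL-Library.Multiset_Order"
    "HOL-Library.Product_Lexorder"
begin

text \<open>Let \<open>A\<close> be an \<open>R\<close>-algebra of ff type. The algebra \<open>A \<otimes>\<^sub>R K\<close> is the localisation of \<open>A\<close> at \<open>\<pi>\<close>, so
  its primes correspond to the primes of \<open>A\<close> without \<open>\<pi>\<close>. Given such a prime \<open>p\<close> and an element
  \<open>a \<notin> p\<close>, choose a prime \<open>q \<supseteq> p\<close> maximal among those that do not contain \<open>g = \<pi> a\<close>. If every prime
  strictly above \<open>q\<close> contains \<open>\<pi>\<close>, then \<open>q\<close> generates a maximal ideal of \<open>A \<otimes>\<^sub>R K\<close> above \<open>p\<close> that
  avoids \<open>a\<close>, which is the Jacobson property (\<open>jacobson_localisation\<close>).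

  By the choice of \<open>q\<close>, the nonzero primes of the domain \<open>A / q\<close> all contain \<open>g \<noteq> 0\<close>. If \<open>A\<close> is
  Noetherian, such a domain has dimension at most one by a theorem of Artin and Tate, so its nonzero
  primes are maximal; and \<open>\<pi>\<close> lies in every maximal ideal, because \<open>1 - \<pi> x\<close> is inverted by a geometric
  series. The combination of these two facts that is needed is \<open>artin_tate\<close>; it rests on Krull's
  principal ideal theorem (\<open>principal_ideal_theorem\<close>) and prime avoidance. Everything is stated in \<open>A\<close>
  relative to a prime \<open>p\<close> and, for a prime \<open>m\<close>, with ideals that are contracted from the local
  ring at \<open>m\<close>, so that neither quotient rings nor local rings have to be formed.

  It remains to show that \<open>R[[S]]\<langle>T\<rangle>\<close>, and with it its quotient \<open>A\<close>, is Noetherian (\<open>D_noetherian\<close>). This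
  is an argument with standard bases. Call \<open>a + \<bar>d\<bar>\<close> the order of \<open>\<pi>\<^sup>a S\<^sup>d T\<^sup>e\<close>. A nonzero element
  has finitely many terms of lowest order, since its coefficients tend to \<open>0\<close>; the largest of them
  for a monomial order is its leading term. By Dickson's lemma, finitely many elements of an ideal \<open>J\<close>
  have leading terms that divide those of all others. Division by them terminates within each order,
  and raises the order without end, so by completeness (\<open>generates_if_approximates\<close>) they generate \<open>J\<close>.\<close>

section \<open>Ideals of commutative rings\<close>

lemma (in cring) ideal_by_closure:
  assumes "I \<subseteq> carrier R" and "\<zero> \<in> I"
    and add: "\<And>a b. a \<in> I \<Longrightarrow> b \<in> I \<Longrightarrow> a \<oplus> b \<in> I"
    and mult: "\<And>r a. r \<in> carrier R \<Longrightarrow> a \<in> I \<Longrightarrow> r \<otimes> a \<in> I"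
  shows "ideal I R"
proof (rule idealI)
  have neg: "\<ominus> a \<in> I" if "a \<in> I" for a
  proof -
    have "\<ominus> a = (\<ominus> \<one>) \<otimes> a"
      using that assms(1) by (simp add: l_minus subsetD)
    then show ?thesis
      using mult[of "\<ominus> \<one>" a] that by simp
  qed
  show "subgroup I (add_monoid R)"
    using assms(1,2) add neg by (intro subgroup.intro) (auto simp flip: a_inv_def)
  show "ring R" by (rule ring_axioms)
  show "x \<otimes> a \<in> I" if "a \<in> I" "x \<in> carrier R" for a x
    using mult that by blast
  show "a \<otimes> x \<in> I" if "a \<in> I" "x \<in> carrier R" for a x
    using mult that assms(1) by (metis m_comm subsetD)
qed

lemma (in ring) ideal_zero_mem: "ideal I R \<Longrightarrow> \<zero> \<in> I"
  by (simp add: additive_subgroup.zero_closed ideal.axioms(1))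

lemma (in ring) ideal_add_mem: "ideal I R \<Longrightarrow> a \<in> I \<Longrightarrow> b \<in> I \<Longrightarrow> a \<oplus> b \<in> I"
  by (simp add: additive_subgroup.a_closed ideal.axioms(1))

lemma (in ring) ideal_minus_mem: "ideal I R \<Longrightarrow> a \<in> I \<Longrightarrow> b \<in> I \<Longrightarrow> a \<ominus> b \<in> I"
  by (simp add: a_minus_def additive_subgroup.a_inv_closed ideal.axioms(1) ideal_add_mem)

lemma (in ring) ideal_finsum_mem:
  assumes I: "ideal I R" and "finite A" and "\<And>x. x \<in> A \<Longrightarrow> f x \<in> I"
  shows "finsum R f A \<in> I"
  using assms(2,3)
proof (induction A)
  case empty
  then show ?case by (simp add: ideal_zero_mem[OF I])
next
  case (insert x A)
  then have "finsum R f (insert x A) = f x \<oplus> finsum R f A"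
    using ideal.Icarr[OF I] by (intro finsum_insert) auto
  then show ?case using insert ideal_add_mem[OF I] by auto
qed

lemma (in ring) ideal_subset_carrier: "ideal I R \<Longrightarrow> I \<subseteq> carrier R"
  by (simp add: additive_subgroup.a_subset ideal.axioms(1))

lemma (in cring) ideal_diff_mem_iff:
  assumes "ideal I R" and "a \<in> I" and "b \<in> carrier R"
  shows "b \<ominus> a \<in> I \<longleftrightarrow> b \<in> I"
proof
  assume "b \<ominus> a \<in> I"
  then have "(b \<ominus> a) \<oplus> a \<in> I"
    using assms ideal_add_mem by blast
  moreover have "(b \<ominus> a) \<oplus> a = b"
    using assms ideal.Icarr[OF assms(1,2)] by algebra
  ultimately show "b \<in> I" by simp
qed (use assms ideal_minus_mem in blast)

lemma primeideal_one_notin: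
  assumes "primeideal p R"
  shows "\<one>\<^bsub>R\<^esub> \<notin> p"
  using assms ideal.one_imp_carrier primeideal.I_notcarr primeideal_def by blast

lemma (in cring) primeideal_pow_mem:
  assumes "primeideal p R" and "x \<in> carrier R" and "x [^] (k::nat) \<in> p"
  shows "x \<in> p"
  using assms(3)
proof (induction k)
  case 0
  then show ?case
    using primeideal_one_notin[OF assms(1)] by simp
next
  case (Suc k)
  then show ?case
    using primeideal.I_prime[OF assms(1), of "x [^] k" x] assms(2) by auto
qed

definition adjoin_ideal :: "('a, 'm) ring_scheme \<Rightarrow> 'a set \<Rightarrow> 'a \<Rightarrow> 'a set" where
  "adjoin_ideal R I x = {i \<oplus>\<^bsub>R\<^esub> r \<otimes>\<^bsub>R\<^esub> x | i r. i \<in> I \<and> r \<in> carrier R}"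

lemma (in cring) adjoin_ideal_ideal:
  assumes I: "ideal I R" and x: "x \<in> carrier R"
  shows "ideal (adjoin_ideal R I x) R"
proof (rule ideal_by_closure)
  note c = ideal.Icarr[OF I]
  show "adjoin_ideal R I x \<subseteq> carrier R"
    using c x by (auto simp: adjoin_ideal_def)
  have "\<zero> = \<zero> \<oplus> \<zero> \<otimes> x" using x by simp
  then show "\<zero> \<in> adjoin_ideal R I x"
    using ideal_zero_mem[OF I] unfolding adjoin_ideal_def by blast
  show "a \<oplus> b \<in> adjoin_ideal R I x" if ab: "a \<in> adjoin_ideal R I x" "b \<in> adjoin_ideal R I x" for a b
  proof -
    obtain i r where a: "a = i \<oplus> r \<otimes> x" "i \<in> I" "r \<in> carrier R"
      using ab unfolding adjoin_ideal_def by blast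
    obtain j t where b: "b = j \<oplus> t \<otimes> x" "j \<in> I" "t \<in> carrier R"
      using ab unfolding adjoin_ideal_def by blast
    have "a \<oplus> b = (i \<oplus> j) \<oplus> (r \<oplus> t) \<otimes> x"
      using a b c[of i] c[of j] x by algebra
    then show ?thesis
      using a b ideal_add_mem[OF I] unfolding adjoin_ideal_def by blast
  qed
  show "s \<otimes> a \<in> adjoin_ideal R I x" if s: "s \<in> carrier R" and as: "a \<in> adjoin_ideal R I x" for s a
  proof -
    obtain i r where a: "a = i \<oplus> r \<otimes> x" "i \<in> I" "r \<in> carrier R"
      using as unfolding adjoin_ideal_def by blast
    have "s \<otimes> a = s \<otimes> i \<oplus> (s \<otimes> r) \<otimes> x"
      using a c[of i] x s by algebra
    then show ?thesis
      using a s ideal.I_l_closed[OF I] unfolding adjoin_ideal_def by blast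
  qed
qed

lemma (in cring) subset_adjoin_ideal:
  assumes "ideal I R" and "x \<in> carrier R"
  shows "I \<subseteq> adjoin_ideal R I x" and "x \<in> adjoin_ideal R I x"
proof -
  have "i = i \<oplus> \<zero> \<otimes> x" if "i \<in> I" for i
    using ideal.Icarr[OF assms(1) that] assms(2) by simp
  then show "I \<subseteq> adjoin_ideal R I x"
    unfolding adjoin_ideal_def by blast
  have "x = \<zero> \<oplus> \<one> \<otimes> x" using assms by simp
  then show "x \<in> adjoin_ideal R I x"
    using ideal_zero_mem[OF assms(1)] unfolding adjoin_ideal_def by blast
qed

lemma (in cring) adjoin_ideal_least:
  assumes "ideal J R" and "I \<subseteq> J" and "x \<in> J"
  shows "adjoin_ideal R I x \<subseteq> J"
proof
  fix e assume "e \<in> adjoin_ideal R I x"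
  then obtain i r where "e = i \<oplus> r \<otimes> x" "i \<in> J" "r \<in> carrier R"
    using assms(2) unfolding adjoin_ideal_def by auto
  then show "e \<in> J"
    using ideal_add_mem[OF assms(1)] ideal.I_l_closed[OF assms(1,3)] by simp
qed

lemma adjoin_ideal_mono:
  assumes "I \<subseteq> J"
  shows "adjoin_ideal R I x \<subseteq> adjoin_ideal R J x"
  using assms unfolding adjoin_ideal_def by blast


section \<open>Noetherian commutative rings\<close>

locale noetherian_cring = noetherian_ring + cring

lemma (in noetherian_ring) ideal_induct [consumes 1, case_names larger]:
  assumes "ideal I R"
    and step: "\<And>I. ideal I R \<Longrightarrow> (\<And>J. ideal J R \<Longrightarrow> I \<subset> J \<Longrightarrow> P J) \<Longrightarrow> P I"
  shows "P I"
proof (rule ccontr)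
  assume "\<not> P I"
  define S where "S = {I. ideal I R \<and> \<not> P I}"
  have "\<exists>M\<in>S. \<forall>I\<in>S. M \<subseteq> I \<longrightarrow> I = M"
  proof (rule subset_Zorn_nonempty)
    show "S \<noteq> {}" using assms(1) \<open>\<not> P I\<close> by (auto simp: S_def)
    show "\<Union>C \<in> S" if "C \<noteq> {}" and C: "subset.chain S C" for C
    proof -
      have "subset.chain {I. ideal I R} C"
        using C unfolding pred_on.chain_def S_def by blast
      then have "\<Union>C \<in> C"
        using ideal_chain_is_trivial that(1) by blast
      then show ?thesis
        using C unfolding pred_on.chain_def by blast
    qed
  qed
  then obtain M where "ideal M R" "\<not> P M" and max: "\<And>I. I \<in> S \<Longrightarrow> M \<subseteq> I \<Longrightarrow> I = M"
    unfolding S_def by auto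
  then show False
    using step[of M] max unfolding S_def by auto
qed

lemma (in noetherian_ring) maximal_ideal_with:
  assumes "ideal I R" and "P I"
  obtains M where "ideal M R" and "P M" and "I \<subseteq> M" and "\<And>J. ideal J R \<Longrightarrow> P J \<Longrightarrow> M \<subseteq> J \<Longrightarrow> J = M"
proof -
  have "P I \<longrightarrow> (\<exists>M. ideal M R \<and> P M \<and> I \<subseteq> M \<and> (\<forall>J. ideal J R \<longrightarrow> P J \<longrightarrow> M \<subseteq> J \<longrightarrow> J = M))"
    using assms(1)
  proof (induction I rule: ideal_induct)
    case (larger I)
    show ?case
    proof (cases "\<exists>J. ideal J R \<and> P J \<and> I \<subset> J")
      case True
      then show ?thesis using larger(2) by (meson dual_order.trans psubset_imp_subset)
    next
      case False
      then show ?thesis using larger(1) by (metis psubset_eq subset_refl)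
    qed
  qed
  then show thesis
    using assms that by blast
qed

lemma (in noetherian_cring) exists_maximalideal:
  assumes "ideal I R" and "\<one> \<notin> I"
  obtains M where "maximalideal M R" and "I \<subseteq> M"
proof -
  obtain M where M: "ideal M R" "\<one> \<notin> M" "I \<subseteq> M" "\<And>J. ideal J R \<Longrightarrow> \<one> \<notin> J \<Longrightarrow> M \<subseteq> J \<Longrightarrow> J = M"
    using maximal_ideal_with[of I "\<lambda>J. \<one> \<notin> J"] assms by blast
  have "maximalideal M R"
  proof (rule maximalidealI)
    show "carrier R \<noteq> M" using M(2) by auto
    show "J = M \<or> J = carrier R" if "ideal J R" "M \<subseteq> J" for J
      using M(4)[OF that(1) _ that(2)] ideal.one_imp_carrier[OF that(1)] by blast
  qed (rule M(1))
  then show thesis using that M(3) by blast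
qed

lemma (in cring) colon_ideal:
  assumes "ideal I R" and "a \<in> carrier R"
  shows "ideal {r \<in> carrier R. r \<otimes> a \<in> I} R"
proof (rule ideal_by_closure)
  show "r \<oplus> s \<in> {r \<in> carrier R. r \<otimes> a \<in> I}"
    if "r \<in> {r \<in> carrier R. r \<otimes> a \<in> I}" "s \<in> {r \<in> carrier R. r \<otimes> a \<in> I}" for r s
    using that assms ideal_add_mem by (auto simp: l_distr)
  show "t \<otimes> r \<in> {r \<in> carrier R. r \<otimes> a \<in> I}"
    if "t \<in> carrier R" "r \<in> {r \<in> carrier R. r \<otimes> a \<in> I}" for t r
    using that assms ideal.I_l_closed by (auto simp: m_assoc)
qed (use assms ideal_zero_mem in auto)

text \<open>This is the contraction of \<open>I\<close> from the localisation at \<open>x\<close>.\<close>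

lemma (in cring) colon_powers_ideal:
  assumes I: "ideal I R" and x: "x \<in> carrier R"
  shows "ideal {e \<in> carrier R. \<exists>c::nat. x [^] c \<otimes> e \<in> I} R"
proof -
  let ?J = "{e \<in> carrier R. \<exists>c::nat. x [^] c \<otimes> e \<in> I}"
  have sub: "I \<subseteq> ?J"
    using ideal.Icarr[OF I] by (auto intro!: exI[of _ "0::nat"])
  show "ideal ?J R"
  proof (rule ideal_by_closure)
    show "\<zero> \<in> ?J" using sub ideal_zero_mem[OF I] by blast
    show "a \<oplus> b \<in> ?J" if ab: "a \<in> ?J" "b \<in> ?J" for a b
    proof -
      obtain c d :: nat where c: "a \<in> carrier R" "x [^] c \<otimes> a \<in> I"
        and d: "b \<in> carrier R" "x [^] d \<otimes> b \<in> I"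
        using ab by blast
      have "(u \<otimes> v) \<otimes> (a \<oplus> b) = v \<otimes> (u \<otimes> a) \<oplus> u \<otimes> (v \<otimes> b)"
        if "u \<in> carrier R" "v \<in> carrier R" for u v
        using c(1) d(1) that by algebra
      then have "x [^] (c + d) \<otimes> (a \<oplus> b) = x [^] d \<otimes> (x [^] c \<otimes> a) \<oplus> x [^] c \<otimes> (x [^] d \<otimes> b)"
        using x by (simp flip: nat_pow_mult)
      also have "\<dots> \<in> I"
        using c d x ideal.I_l_closed[OF I] ideal_add_mem[OF I] by auto
      finally show ?thesis using c d by blast
    qed
    show "r \<otimes> a \<in> ?J" if r: "r \<in> carrier R" and a: "a \<in> ?J" for r a
    proof -
      obtain c :: nat where c: "a \<in> carrier R" "x [^] c \<otimes> a \<in> I"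
        using a by blast
      have "x [^] c \<otimes> (r \<otimes> a) = r \<otimes> (x [^] c \<otimes> a)"
        using c(1) r x by (simp add: m_lcomm)
      also have "\<dots> \<in> I" using ideal.I_l_closed[OF I c(2) r] .
      finally show ?thesis using c(1) r by blast
    qed
  qed auto
qed

text \<open>An ideal that is maximal among the annihilators of nonzero elements of \<open>R / b\<close> is prime:
  this is how an associated prime is found.\<close>

lemma (in noetherian_cring) exists_associated_prime:
  assumes b: "ideal b R" and "\<one> \<notin> b"
  obtains a where "a \<in> carrier R" and "a \<notin> b" and "primeideal {r \<in> carrier R. r \<otimes> a \<in> b} R"
proof -
  define ann where "ann a = {r \<in> carrier R. r \<otimes> a \<in> b}" for a
  define P where "P = (\<lambda>I. \<exists>a\<in>carrier R - b. I = ann a)"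
  have "ideal (ann \<one>) R" "P (ann \<one>)"
    using colon_ideal[OF b] assms(2) by (auto simp: ann_def P_def)
  then obtain M where M: "ideal M R" "P M" "\<And>J. ideal J R \<Longrightarrow> P J \<Longrightarrow> M \<subseteq> J \<Longrightarrow> J = M"
    by (rule maximal_ideal_with) blast
  then obtain a where a: "a \<in> carrier R" "a \<notin> b" "M = ann a"
    unfolding P_def by blast
  have "primeideal M R"
  proof (rule primeidealI)
    show "carrier R \<noteq> M"
      using a by (auto simp: ann_def set_eq_iff intro!: exI[of _ \<one>])
    show "x \<in> M \<or> y \<in> M" if xy: "x \<in> carrier R" "y \<in> carrier R" "x \<otimes> y \<in> M" for x y
    proof (rule ccontr)
      assume *: "\<not> (x \<in> M \<or> y \<in> M)"
      then have ya: "y \<otimes> a \<notin> b" "y \<otimes> a \<in> carrier R"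
        using xy a by (auto simp: ann_def)
      have "M \<subseteq> ann (y \<otimes> a)"
      proof
        fix r assume "r \<in> M"
        then have r: "r \<in> carrier R" "r \<otimes> a \<in> b"
          using a by (auto simp: ann_def)
        have "y \<otimes> (r \<otimes> a) = r \<otimes> (y \<otimes> a)"
          using r xy a by algebra
        then show "r \<in> ann (y \<otimes> a)"
          using r xy ideal.I_l_closed[OF b r(2) xy(2)] by (auto simp: ann_def)
      qed
      moreover have "ideal (ann (y \<otimes> a)) R" "P (ann (y \<otimes> a))"
        using ya colon_ideal[OF b] by (auto simp: ann_def P_def)
      ultimately have "ann (y \<otimes> a) = M"
        using M(3) by blast
      moreover have "x \<in> ann (y \<otimes> a)"
        using xy a by (auto simp: ann_def m_assoc)
      ultimately show False using * by blast
    qed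
  qed (use M(1) is_cring in auto)
  then show thesis
    using that[OF a(1,2)] a(3) unfolding ann_def by blast
qed

subsection \<open>Minimal primes and prime avoidance\<close>

text \<open>Noetherian induction: if \<open>b\<close> is neither the unit ideal nor prime, pick \<open>u v \<in> b\<close> with
  \<open>u, v \<notin> b\<close>; a prime containing \<open>b\<close> contains one of the larger ideals \<open>b + (u)\<close>, \<open>b + (v)\<close>.\<close>

lemma (in noetherian_cring) finite_primes_below:
  assumes "ideal b R"
  shows "\<exists>F. finite F \<and> (\<forall>p\<in>F. primeideal p R \<and> b \<subseteq> p) \<and>
    (\<forall>q. primeideal q R \<longrightarrow> b \<subseteq> q \<longrightarrow> (\<exists>p\<in>F. p \<subseteq> q))"
  using assms
proof (induction b rule: ideal_induct)
  case (larger b)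
  consider "b = carrier R" | "primeideal b R" |
    u v where "u \<in> carrier R" "v \<in> carrier R" "u \<otimes> v \<in> b" "u \<notin> b" "v \<notin> b"
    using larger(1) is_cring by (metis primeidealI)
  then show ?case
  proof cases
    case 1
    then show ?thesis
      using primeideal_one_notin by (intro exI[of _ "{}"]) auto
  next
    case 2
    then show ?thesis by (intro exI[of _ "{b}"]) auto
  next
    case 3
    have "b \<subset> adjoin_ideal R b u" "b \<subset> adjoin_ideal R b v"
      using subset_adjoin_ideal[OF larger(1)] 3 by blast+
    moreover note adjoin_ideal_ideal[OF larger(1) 3(1)] adjoin_ideal_ideal[OF larger(1) 3(2)]
    ultimately obtain F G where
      F: "finite F" "\<forall>p\<in>F. primeideal p R \<and> adjoin_ideal R b u \<subseteq> p"
        "\<forall>q. primeideal q R \<longrightarrow> adjoin_ideal R b u \<subseteq> q \<longrightarrow> (\<exists>p\<in>F. p \<subseteq> q)" and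
      G: "finite G" "\<forall>p\<in>G. primeideal p R \<and> adjoin_ideal R b v \<subseteq> p"
        "\<forall>q. primeideal q R \<longrightarrow> adjoin_ideal R b v \<subseteq> q \<longrightarrow> (\<exists>p\<in>G. p \<subseteq> q)"
      using larger(2)[of "adjoin_ideal R b u"] larger(2)[of "adjoin_ideal R b v"] by auto
    have "\<exists>p\<in>F \<union> G. p \<subseteq> q" if q: "primeideal q R" "b \<subseteq> q" for q
    proof -
      have "ideal q R" using q by (simp add: primeideal.axioms)
      moreover have "u \<in> q \<or> v \<in> q"
        using primeideal.I_prime[OF q(1)] q(2) 3 by blast
      ultimately have "adjoin_ideal R b u \<subseteq> q \<or> adjoin_ideal R b v \<subseteq> q"
        using adjoin_ideal_least q(2) by blast
      then show ?thesis using F(3) G(3) q(1) by blast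
    qed
    moreover have "finite (F \<union> G)" "\<forall>p\<in>F \<union> G. primeideal p R \<and> b \<subseteq> p"
      using F(1,2) G(1,2) \<open>b \<subset> adjoin_ideal R b u\<close> \<open>b \<subset> adjoin_ideal R b v\<close>
      by (simp, meson UnE psubsetE subset_trans)
    ultimately show ?thesis by blast
  qed
qed

lemma (in noetherian_cring) minimal_primes:
  assumes "ideal b R"
  obtains F where "finite F" and "\<And>p. p \<in> F \<Longrightarrow> primeideal p R" and "\<And>p. p \<in> F \<Longrightarrow> b \<subseteq> p"
    and "\<And>q. primeideal q R \<Longrightarrow> b \<subseteq> q \<Longrightarrow> \<exists>p\<in>F. p \<subseteq> q"
    and "\<And>p q. p \<in> F \<Longrightarrow> primeideal q R \<Longrightarrow> b \<subseteq> q \<Longrightarrow> q \<subseteq> p \<Longrightarrow> q = p"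
proof -
  obtain G where G: "finite G" "\<And>p. p \<in> G \<Longrightarrow> primeideal p R" "\<And>p. p \<in> G \<Longrightarrow> b \<subseteq> p"
    "\<And>q. primeideal q R \<Longrightarrow> b \<subseteq> q \<Longrightarrow> \<exists>p\<in>G. p \<subseteq> q"
    using finite_primes_below[OF assms] by auto
  define F where "F = {p \<in> G. \<forall>p'\<in>G. p' \<subseteq> p \<longrightarrow> p' = p}"
  have below: "\<exists>p\<in>F. p \<subseteq> q" if q: "primeideal q R" "b \<subseteq> q" for q
  proof -
    obtain p where p: "p \<in> G" "p \<subseteq> q" using G(4) q by blast
    obtain p' where "p' \<in> G" "p' \<subseteq> p" "\<forall>x\<in>G. x \<subseteq> p' \<longrightarrow> p' = x"
      using finite_has_minimal2[OF G(1) p(1)] by auto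
    then show ?thesis
      using p unfolding F_def by blast
  qed
  show thesis
  proof (rule that[of F])
    show "q = p" if pq: "p \<in> F" "primeideal q R" "b \<subseteq> q" "q \<subseteq> p" for p q
    proof -
      obtain p' where p': "p' \<in> F" "p' \<subseteq> q" using below[OF pq(2,3)] by blast
      then have "p' = p" using pq(1,4) by (auto simp: F_def)
      then show ?thesis using p'(2) pq(4) by blast
    qed
    show "finite F" "p \<in> F \<Longrightarrow> primeideal p R" "p \<in> F \<Longrightarrow> b \<subseteq> p" for p
      using G(1-3) by (auto simp: F_def)
    show "\<exists>p\<in>F. p \<subseteq> q" if "primeideal q R" "b \<subseteq> q" for q
      using below that by blast
  qed
qed

text \<open>By induction on \<open>F\<close>: if \<open>y\<close> avoids the primes treated so far but lies in the next prime \<open>m\<close>, add to it a product \<open>w v\<close> with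
  \<open>w \<in> J - m\<close> and \<open>v\<close> in all the earlier primes but not in \<open>m\<close>.\<close>

lemma (in cring) prime_avoidance:
  assumes "finite F" and "\<And>p. p \<in> F \<Longrightarrow> primeideal p R"
    and "\<And>p q. p \<in> F \<Longrightarrow> q \<in> F \<Longrightarrow> p \<subseteq> q \<Longrightarrow> p = q"
    and J: "ideal J R" and "\<And>p. p \<in> F \<Longrightarrow> \<not> J \<subseteq> p"
  shows "\<exists>y\<in>J. \<forall>p\<in>F. y \<notin> p"
  using assms(1,2,3,5)
proof (induction F)
  case empty
  then show ?case using ideal_zero_mem[OF J] by blast
next
  case (insert m F)
  note prime = insert.prems(1) and antichain = insert.prems(2)
  from insert obtain y where y: "y \<in> J" "\<forall>p\<in>F. y \<notin> p" by auto
  show ?case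
  proof (cases "y \<in> m")
    case False
    then show ?thesis using y by blast
  next
    case True
    have m: "primeideal m R" "ideal m R" using insert.prems(1) primeideal.axioms by blast+
    have "\<exists>v\<in>carrier R - m. \<forall>p\<in>F'. v \<in> p" if "F' \<subseteq> F" for F'
      using finite_subset[OF that insert.hyps(1)] that
    proof (induction F')
      case empty
      then show ?case using primeideal_one_notin[OF m(1)] by (intro bexI[of _ \<one>]) auto
    next
      case (insert p F')
      then obtain v where v: "v \<in> carrier R" "v \<notin> m" "\<forall>q\<in>F'. v \<in> q" by auto
      have "p \<noteq> m" using insert.prems \<open>m \<notin> F\<close> by blast
      then obtain u where u: "u \<in> p" "u \<notin> m"
        using insert.prems antichain[of p m] by blast
      have pm: "ideal p R"
        using insert.prems prime primeideal.axioms(1) by blast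
      have uc: "u \<in> carrier R" using ideal.Icarr[OF pm u(1)] .
      have "u \<otimes> v \<notin> m" using primeideal.I_prime[OF m(1) uc v(1)] u v by blast
      moreover have "u \<otimes> v \<in> p" using ideal.I_r_closed[OF pm u(1) v(1)] .
      moreover have "u \<otimes> v \<in> q" if q: "q \<in> F'" for q
      proof -
        have "ideal q R" using q insert.prems prime primeideal.axioms(1) by blast
        then show ?thesis using ideal.I_l_closed uc v(3) q by metis
      qed
      ultimately show ?case using uc v by (intro bexI[of _ "u \<otimes> v"]) auto
    qed
    then obtain v where v: "v \<in> carrier R" "v \<notin> m" "\<forall>p\<in>F. v \<in> p" by blast
    obtain w where w: "w \<in> J" "w \<notin> m" using insert.prems(3) by blast
    have c: "w \<in> carrier R" "y \<in> carrier R" using w y ideal.Icarr[OF J] by blast+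
    have wv: "w \<otimes> v \<notin> m" using primeideal.I_prime[OF m(1) c(1) v(1)] v w by blast
    have "w \<otimes> v \<oplus> y \<notin> m"
    proof
      assume "w \<otimes> v \<oplus> y \<in> m"
      then have "(w \<otimes> v \<oplus> y) \<ominus> y \<in> m" using True m(2) ideal_minus_mem by blast
      moreover have "(w \<otimes> v \<oplus> y) \<ominus> y = w \<otimes> v" using c v by algebra
      ultimately show False using wv by simp
    qed
    moreover have "w \<otimes> v \<oplus> y \<notin> p" if "p \<in> F" for p
    proof
      assume *: "w \<otimes> v \<oplus> y \<in> p"
      have p: "ideal p R" using insert.prems(1) that primeideal.axioms(1) by blast
      have "w \<otimes> v \<in> p" using v that ideal.I_l_closed[OF p] c by blast
      then have "(w \<otimes> v \<oplus> y) \<ominus> w \<otimes> v \<in> p" using * p ideal_minus_mem by blast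
      moreover have "(w \<otimes> v \<oplus> y) \<ominus> w \<otimes> v = y" using c v by algebra
      ultimately show False using y that by simp
    qed
    moreover have "w \<otimes> v \<oplus> y \<in> J"
      using ideal_add_mem[OF J ideal.I_r_closed[OF J w(1) v(1)] y(1)] .
    ultimately show ?thesis by blast
  qed
qed


section \<open>The principal ideal theorem\<close>

text \<open>For an ideal \<open>I\<close> and a prime \<open>m\<close>, this is the contraction to \<open>R\<close> of the ideal generated by \<open>I\<close>
  in the local ring at \<open>m\<close>. Ideals of the local ring are represented by the ideals \<open>I\<close> that are
  saturated, that is, equal to their own contraction.\<close>

definition (in ring) localised_contraction :: "'a set \<Rightarrow> 'a set \<Rightarrow> 'a set" where
  "localised_contraction m I = {e \<in> carrier R. \<exists>s\<in>carrier R - m. s \<otimes> e \<in> I}"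

locale localisation_at_prime = noetherian_cring +
  fixes m
  assumes m_prime: "primeideal m R"
begin

abbreviation sat :: "'a set \<Rightarrow> 'a set" where
  "sat \<equiv> localised_contraction m"

lemma m_ideal: "ideal m R"
  using m_prime by (rule primeideal.axioms)

lemma one_notin_m: "\<one> \<notin> m"
  by (rule primeideal_one_notin[OF m_prime])

lemma mult_notin_m: "s \<in> carrier R - m \<Longrightarrow> t \<in> carrier R - m \<Longrightarrow> s \<otimes> t \<in> carrier R - m"
  using primeideal.I_prime[OF m_prime] by auto

lemma satI: "e \<in> carrier R \<Longrightarrow> s \<in> carrier R - m \<Longrightarrow> s \<otimes> e \<in> I \<Longrightarrow> e \<in> sat I"
  unfolding localised_contraction_def by blast

lemma satE:
  assumes "e \<in> sat I"
  obtains s where "e \<in> carrier R" and "s \<in> carrier R - m" and "s \<otimes> e \<in> I"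
  using assms unfolding localised_contraction_def by blast

lemma sat_mono: "I \<subseteq> J \<Longrightarrow> sat I \<subseteq> sat J"
  unfolding localised_contraction_def by blast

lemma subset_sat: "I \<subseteq> carrier R \<Longrightarrow> I \<subseteq> sat I"
  using one_notin_m by (auto intro!: satI[of _ \<one>])

lemma sat_sat: "sat (sat I) = sat I"
proof
  show "sat (sat I) \<subseteq> sat I"
  proof
    fix e assume "e \<in> sat (sat I)"
    then obtain s where s: "e \<in> carrier R" "s \<in> carrier R - m" "s \<otimes> e \<in> sat I" by (rule satE)
    from s(3) obtain t where t: "t \<in> carrier R - m" "t \<otimes> (s \<otimes> e) \<in> I" by (rule satE)
    show "e \<in> sat I"
      using s t mult_notin_m[OF t(1) s(2)] by (intro satI[of _ "t \<otimes> s"]) (auto simp: m_assoc)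
  qed
  have "sat I \<subseteq> carrier R" unfolding localised_contraction_def by blast
  then show "sat I \<subseteq> sat (sat I)" by (rule subset_sat)
qed

lemma sat_ideal:
  assumes I: "ideal I R"
  shows "ideal (sat I) R"
proof (rule ideal_by_closure)
  show "sat I \<subseteq> carrier R" unfolding localised_contraction_def by blast
  show "\<zero> \<in> sat I"
    using subset_sat[OF ideal_subset_carrier[OF I]] ideal_zero_mem[OF I] by blast
  show "a \<oplus> b \<in> sat I" if ab: "a \<in> sat I" "b \<in> sat I" for a b
  proof -
    obtain s where s: "a \<in> carrier R" "s \<in> carrier R - m" "s \<otimes> a \<in> I" using ab(1) by (rule satE)
    obtain t where t: "b \<in> carrier R" "t \<in> carrier R - m" "t \<otimes> b \<in> I" using ab(2) by (rule satE)
    have "(s \<otimes> t) \<otimes> (a \<oplus> b) = t \<otimes> (s \<otimes> a) \<oplus> s \<otimes> (t \<otimes> b)"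
      using s(1,2) t(1,2) by (simp, algebra)
    also have "\<dots> \<in> I"
      using s t ideal.I_l_closed[OF I] ideal_add_mem[OF I] by auto
    finally show ?thesis
      using s t mult_notin_m by (intro satI[of _ "s \<otimes> t"]) auto
  qed
  show "r \<otimes> a \<in> sat I" if r: "r \<in> carrier R" and a: "a \<in> sat I" for r a
  proof -
    obtain s where s: "a \<in> carrier R" "s \<in> carrier R - m" "s \<otimes> a \<in> I" using a by (rule satE)
    have "s \<otimes> (r \<otimes> a) = r \<otimes> (s \<otimes> a)"
      using s(1,2) r by (simp, algebra)
    also have "\<dots> \<in> I" using s r ideal.I_l_closed[OF I] by auto
    finally show ?thesis using s r by (intro satI[of _ s]) auto
  qed
qed

lemma sat_mult_mem:
  assumes "sat I = I" and "s \<in> carrier R - m" and "e \<in> carrier R" and "s \<otimes> e \<in> I"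
  shows "e \<in> I"
  using satI[OF assms(3,2,4)] assms(1) by simp

lemma saturated_adjoin_ideal:
  assumes "ideal I R" and "x \<in> carrier R"
  shows "ideal (sat (adjoin_ideal R I x)) R" and "sat (sat (adjoin_ideal R I x)) = sat (adjoin_ideal R I x)"
    and "I \<subseteq> sat (adjoin_ideal R I x)" and "x \<in> sat (adjoin_ideal R I x)"
proof -
  have J: "ideal (adjoin_ideal R I x) R" using assms by (rule adjoin_ideal_ideal)
  then show "ideal (sat (adjoin_ideal R I x)) R" by (rule sat_ideal)
  show "I \<subseteq> sat (adjoin_ideal R I x)" "x \<in> sat (adjoin_ideal R I x)"
    using subset_adjoin_ideal[OF assms] subset_sat[OF ideal_subset_carrier[OF J]] by blast+
qed (rule sat_sat)

text \<open>Nakayama's lemma for \<open>J / N\<close> over the local ring at \<open>m\<close>: if \<open>J \<noteq> N\<close>, let \<open>L\<close> be maximal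
  among the saturated ideals between them that differ from \<open>J\<close>. Then \<open>J\<close> is generated over \<open>L\<close> by
  any single \<open>e \<in> J - L\<close>, up to saturation, and
  \<open>s e \<in> L + x J\<close> with \<open>s \<notin> m\<close> yields, after enlarging \<open>s\<close>, \<open>(s - x t) e \<in> L\<close> with \<open>s - x t\<close> outside \<open>m\<close>.\<close>

lemma nakayama:
  assumes N: "ideal N R" "sat N = N" and J: "ideal J R" "sat J = J" and "N \<subseteq> J" and x: "x \<in> m"
    and gen: "\<And>e. e \<in> J \<Longrightarrow> \<exists>s\<in>carrier R - m. \<exists>j\<in>N. \<exists>r\<in>J. s \<otimes> e = j \<oplus> r \<otimes> x"
  shows "J = N"
proof (rule ccontr)
  assume "J \<noteq> N"
  define P where "P L \<longleftrightarrow> sat L = L \<and> L \<subset> J" for L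
  have "P N" using N \<open>N \<subseteq> J\<close> \<open>J \<noteq> N\<close> by (auto simp: P_def)
  then obtain L where L: "ideal L R" "P L" "N \<subseteq> L" and
    max: "\<And>I. ideal I R \<Longrightarrow> P I \<Longrightarrow> L \<subseteq> I \<Longrightarrow> I = L"
    using maximal_ideal_with[OF N(1), of P] by metis
  then obtain e where e: "e \<in> J" "e \<notin> L" by (auto simp: P_def)
  have ec: "e \<in> carrier R" using ideal.Icarr[OF J(1) e(1)] .
  have xc: "x \<in> carrier R" using ideal.Icarr[OF m_ideal x] .
  note L' = saturated_adjoin_ideal[OF L(1) ec]
  have "sat (adjoin_ideal R L e) \<subseteq> sat J"
    using L(2) e(1) adjoin_ideal_least[OF J(1)] by (intro sat_mono) (auto simp: P_def)
  then have "sat (adjoin_ideal R L e) = J"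
    using max[OF L'(1)] L'(2-4) e(2) J(2) by (auto simp: P_def)
  moreover obtain s j r where s: "s \<in> carrier R - m" and j: "j \<in> N" and r: "r \<in> J"
    and eq: "s \<otimes> e = j \<oplus> r \<otimes> x"
    using gen[OF e(1)] by blast
  ultimately obtain t where t: "t \<in> carrier R - m" "t \<otimes> r \<in> adjoin_ideal R L e"
    using satE by metis
  then obtain l u where lu: "l \<in> L" "u \<in> carrier R" "t \<otimes> r = l \<oplus> u \<otimes> e"
    unfolding adjoin_ideal_def by blast
  have c: "l \<in> carrier R" "j \<in> carrier R" "r \<in> carrier R"
    using ideal.Icarr[OF L(1) lu(1)] ideal.Icarr[OF N(1) j] ideal.Icarr[OF J(1) r] by auto
  have "(t \<otimes> s \<ominus> u \<otimes> x) \<otimes> e = t \<otimes> (s \<otimes> e) \<ominus> (u \<otimes> e) \<otimes> x"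
    using s t(1) lu(2) xc ec by (simp, algebra)
  also have "\<dots> = t \<otimes> j \<oplus> (t \<otimes> r) \<otimes> x \<ominus> (u \<otimes> e) \<otimes> x"
    using eq s t(1) lu(2) xc ec c by (simp, algebra)
  also have "\<dots> = t \<otimes> j \<oplus> x \<otimes> l"
    using lu(2,3) t(1) xc ec c by (simp, algebra)
  also have "\<dots> \<in> L"
    using j L(3) lu(1) t(1) xc ideal.I_l_closed[OF L(1)] ideal_add_mem[OF L(1)] by auto
  finally have mem: "(t \<otimes> s \<ominus> u \<otimes> x) \<otimes> e \<in> L" .
  have ts: "t \<otimes> s \<in> carrier R - m" using mult_notin_m[OF t(1) s] .
  have "u \<otimes> x \<in> m" using ideal.I_l_closed[OF m_ideal x lu(2)] .
  then have "t \<otimes> s \<ominus> u \<otimes> x \<in> carrier R - m"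
    using ts ideal_diff_mem_iff[OF m_ideal] lu(2) xc by auto
  then have "e \<in> L"
    using sat_mult_mem[OF _ _ ec mem] L(2) by (auto simp: P_def)
  then show False using e(2) by blast
qed

text \<open>The local ring of \<open>R / b\<close> at a prime \<open>m\<close> that is minimal over \<open>b\<close> is artinian. By Noetherian
  induction on \<open>b\<close>: pick \<open>a\<close> outside \<open>b\<close> with \<open>a m \<subseteq> b\<close>. If every member of the chain contains
  \<open>a\<close>, the induction hypothesis for \<open>b + (a)\<close> applies. Otherwise, locally at \<open>m\<close>, the members of the chain
  meet \<open>b + (a)\<close> only in \<open>b\<close> from some point on, as \<open>r a \<in> C k\<close> then forces \<open>r \<in> m\<close>; so the chain is
  stationary as soon as \<open>C k + (a)\<close> is.\<close>

lemma descending_chain_stationary: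
  fixes C :: "nat \<Rightarrow> 'a set"
  assumes "ideal b R" and "sat b = b"
    and "\<And>q. primeideal q R \<Longrightarrow> b \<subseteq> q \<Longrightarrow> q \<subseteq> m \<Longrightarrow> q = m"
    and "\<And>k. ideal (C k) R" and "\<And>k. sat (C k) = C k" and "decseq C" and "\<And>k. b \<subseteq> C k"
  shows "\<exists>n. \<forall>k\<ge>n. C k = C n"
  using assms
proof (induction b arbitrary: C rule: ideal_induct)
  case (larger b)
  note satb = larger.prems(1) and min = larger.prems(2) and C = larger.prems(3-6)
  have C_sat_carrier: "C k = carrier R" if "\<one> \<in> C k" for k
    using ideal.one_imp_carrier[OF C(1) that] .
  show ?case
  proof (cases "\<one> \<in> b")
    case True
    then show ?thesis using C_sat_carrier C(4) by blast
  next
    case False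
    then obtain a where a: "a \<in> carrier R" "a \<notin> b" and q: "primeideal {r \<in> carrier R. r \<otimes> a \<in> b} R"
      by (rule exists_associated_prime[OF larger.hyps(1)])
    have "b \<subseteq> {r \<in> carrier R. r \<otimes> a \<in> b}"
      using ideal.Icarr[OF larger.hyps(1)] ideal.I_r_closed[OF larger.hyps(1)] a(1) by auto
    moreover have "{r \<in> carrier R. r \<otimes> a \<in> b} \<subseteq> m"
      using sat_mult_mem[OF satb _ a(1)] a(2) by auto
    ultimately have ann: "{r \<in> carrier R. r \<otimes> a \<in> b} = m"
      using min q by blast
    define b' where "b' = sat (adjoin_ideal R b a)"
    note b' = saturated_adjoin_ideal[OF larger.hyps(1) a(1), folded b'_def]
    have "b \<subset> b'" using b' a(2) by blast
    have IH: "\<exists>n. \<forall>k\<ge>n. D k = D n"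
      if "\<And>k. ideal (D k) R" "\<And>k. sat (D k) = D k" "decseq D" "\<And>k. b' \<subseteq> D k" for D :: "nat \<Rightarrow> 'a set"
    proof (rule larger.IH[OF b'(1) \<open>b \<subset> b'\<close> b'(2)])
      show "q = m" if "primeideal q R" "b' \<subseteq> q" "q \<subseteq> m" for q
        using min[OF that(1) _ that(3)] that(2) \<open>b \<subset> b'\<close> by blast
    qed (rule that)+
    show ?thesis
    proof (cases "\<forall>k. a \<in> C k")
      case True
      have "b' \<subseteq> C k" for k
        using sat_mono[OF adjoin_ideal_least[OF C(1) C(4)]] True C(2) unfolding b'_def by metis
      then show ?thesis using IH C(1-3) by blast
    next
      case False
      then obtain k0 where k0: "a \<notin> C k0" by blast
      define D where "D k = sat (adjoin_ideal R (C k) a)" for k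
      note D = saturated_adjoin_ideal[OF C(1) a(1), folded D_def]
      have "\<exists>n. \<forall>k\<ge>n. D k = D n"
      proof (rule IH)
        show "decseq D"
          using C(3) unfolding D_def decseq_def by (intro allI impI sat_mono adjoin_ideal_mono) auto
        show "b' \<subseteq> D k" for k
          unfolding b'_def D_def using C(4) by (intro sat_mono adjoin_ideal_mono)
      qed (rule D)+
      then obtain n where n: "\<And>k. k \<ge> n \<Longrightarrow> D k = D n" by blast
      define n' where "n' = max n k0"
      have "C n' \<subseteq> C k" if k: "k \<ge> n'" for k
      proof
        fix e assume e: "e \<in> C n'"
        have "D n' = D k" using n[of k] n[of n'] k unfolding n'_def by auto
        then have "e \<in> sat (adjoin_ideal R (C k) a)"
          using e D(3)[of n'] unfolding D_def by blast
        then obtain s where s: "e \<in> carrier R" "s \<in> carrier R - m" "s \<otimes> e \<in> adjoin_ideal R (C k) a"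
          by (rule satE)
        then obtain i r where ir: "i \<in> C k" "r \<in> carrier R" "s \<otimes> e = i \<oplus> r \<otimes> a"
          unfolding adjoin_ideal_def by blast
        have ic: "i \<in> C n'" using ir(1) C(3) k unfolding decseq_def by blast
        have "r \<otimes> a = s \<otimes> e \<ominus> i"
          using ir ideal.Icarr[OF C(1) ir(1)] a(1) by (simp, algebra)
        also have "\<dots> \<in> C n'"
          using ideal_minus_mem[OF C(1) _ ic] ideal.I_l_closed[OF C(1) e] s(2) by blast
        finally have ra: "r \<otimes> a \<in> C n'" .
        have "a \<notin> C n'" using k0 C(3) unfolding decseq_def n'_def by (meson max.cobounded2 subsetD)
        then have "r \<in> m" using sat_mult_mem[OF C(2) _ a(1) ra] ir(2) by blast
        then have "r \<otimes> a \<in> C k" using ann C(4) by blast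
        then have "s \<otimes> e \<in> C k" using ir ideal_add_mem[OF C(1)] by simp
        then show "e \<in> C k" using sat_mult_mem[OF C(2) s(2,1)] by blast
      qed
      moreover have "C k \<subseteq> C n'" if "k \<ge> n'" for k
        using C(3) that unfolding decseq_def by blast
      ultimately show ?thesis by blast
    qed
  qed
qed

text \<open>Krull's principal ideal theorem, in the form that \<open>x\<close> is nilpotent modulo every nonzero \<open>y\<close> in
  the local ring of the domain \<open>R / p\<close> at a prime \<open>m\<close> minimal over \<open>x\<close>. The ideals \<open>J k\<close>
  below are the contractions of \<open>(y\<^sup>k)\<close> after inverting \<open>x\<close>, so \<open>x\<close> is not a zero divisor modulo
  \<open>J k\<close>; hence \<open>J k \<subseteq> J (k + 1) + (x)\<close>, which holds for some \<open>k\<close> by the descending chain condition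
  modulo \<open>x\<close>, improves to \<open>J k \<subseteq> J (k + 1) + x J k\<close>, and Nakayama gives \<open>y\<^sup>k \<in> J (k + 1)\<close>.\<close>

lemma principal_ideal_theorem:
  assumes p: "primeideal p R" and "p \<subseteq> m" and x: "x \<in> m"
    and min: "\<And>q. primeideal q R \<Longrightarrow> p \<subseteq> q \<Longrightarrow> x \<in> q \<Longrightarrow> q \<subseteq> m \<Longrightarrow> q = m"
    and y: "y \<in> carrier R" "y \<notin> p"
  shows "\<exists>s\<in>carrier R - m. \<exists>n::nat. s \<otimes> x [^] n \<in> adjoin_ideal R p y"
proof -
  have pI: "ideal p R" using p by (rule primeideal.axioms)
  have xc: "x \<in> carrier R" using ideal.Icarr[OF m_ideal x] .
  define Y where "Y k = adjoin_ideal R p (y [^] k)" for k :: nat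
  define J where "J k = {e \<in> carrier R. \<exists>c::nat. x [^] c \<otimes> e \<in> sat (Y k)}" for k
  have Y: "ideal (Y k) R" for k
    unfolding Y_def using pI y(1) by (intro adjoin_ideal_ideal) auto
  have SY: "ideal (sat (Y k)) R" for k using sat_ideal[OF Y] .
  have Y_subset_J: "Y k \<subseteq> J k" for k
  proof
    fix e assume e: "e \<in> Y k"
    then have "e \<in> sat (Y k)" using subset_sat[OF ideal_subset_carrier[OF Y]] by blast
    moreover have "e \<in> carrier R" using ideal.Icarr[OF Y e] .
    ultimately show "e \<in> J k" unfolding J_def by (auto intro!: exI[of _ "0::nat"])
  qed
  have JI: "ideal (J k) R" for k
    unfolding J_def using SY xc by (rule colon_powers_ideal)
  have J_sat: "sat (J k) = J k" for k
  proof
    show "sat (J k) \<subseteq> J k"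
    proof
      fix e assume "e \<in> sat (J k)"
      then obtain s where s: "e \<in> carrier R" "s \<in> carrier R - m" "s \<otimes> e \<in> J k" by (rule satE)
      then obtain c :: nat where c: "x [^] c \<otimes> (s \<otimes> e) \<in> sat (Y k)" unfolding J_def by blast
      have "x [^] c \<otimes> (s \<otimes> e) = s \<otimes> (x [^] c \<otimes> e)" using s(1,2) xc by (simp add: m_lcomm)
      then have "x [^] c \<otimes> e \<in> sat (Y k)"
        using sat_mult_mem[OF sat_sat s(2)] s(1) xc c by simp
      then show "e \<in> J k" using s(1) unfolding J_def by blast
    qed
    show "J k \<subseteq> sat (J k)" using subset_sat[OF ideal_subset_carrier[OF JI]] .
  qed
  have J_cancel: "e \<in> J k" if e: "e \<in> carrier R" "e \<otimes> x \<in> J k" for e k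
  proof -
    obtain c :: nat where c: "x [^] c \<otimes> (e \<otimes> x) \<in> sat (Y k)" using e unfolding J_def by blast
    have "x [^] c \<otimes> (e \<otimes> x) = x [^] Suc c \<otimes> e" using e(1) xc by (simp add: m_ac)
    then have "x [^] Suc c \<otimes> e \<in> sat (Y k)" using c by simp
    then show ?thesis using e(1) unfolding J_def by blast
  qed
  have Y_Suc: "Y (Suc k) \<subseteq> Y k" for k
  proof (unfold Y_def, rule adjoin_ideal_least)
    show "ideal (adjoin_ideal R p (y [^] k)) R" using Y unfolding Y_def .
    show "p \<subseteq> adjoin_ideal R p (y [^] k)" "y [^] Suc k \<in> adjoin_ideal R p (y [^] k)"
      using subset_adjoin_ideal[OF pI, of "y [^] k"] y(1) ideal.I_r_closed[OF Y, of "y [^] k" k y]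
      unfolding Y_def by auto
  qed
  then have J_Suc: "J (Suc k) \<subseteq> J k" for k
    using sat_mono[OF Y_Suc] unfolding J_def by blast
  define C where "C k = sat (adjoin_ideal R (J k) x)" for k
  note C = saturated_adjoin_ideal[OF JI xc, folded C_def]
  define b where "b = sat (adjoin_ideal R p x)"
  note b = saturated_adjoin_ideal[OF pI xc, folded b_def]
  have "\<exists>n. \<forall>k\<ge>n. C k = C n"
  proof (rule descending_chain_stationary)
    show "q = m" if "primeideal q R" "b \<subseteq> q" "q \<subseteq> m" for q
      using min[OF that(1) _ _ that(3)] b(3,4) that(2) by blast
    show "decseq C"
      unfolding decseq_Suc_iff C_def using J_Suc by (intro allI sat_mono adjoin_ideal_mono)
    show "b \<subseteq> C k" for k
      unfolding b_def C_def
      using subset_adjoin_ideal(1)[OF pI, of "y [^] k"] y(1) Y_subset_J[of k]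
      by (intro sat_mono adjoin_ideal_mono) (auto simp: Y_def)
  qed (rule b C)+
  then obtain k where k: "C k = C (Suc k)" by (metis le_SucI order_refl)
  have "J k = J (Suc k)"
  proof (rule nakayama[OF JI J_sat JI J_sat J_Suc x])
    fix e assume e: "e \<in> J k"
    then have "e \<in> sat (adjoin_ideal R (J (Suc k)) x)" using C(3)[of k] k unfolding C_def by blast
    then obtain s where s: "e \<in> carrier R" "s \<in> carrier R - m" "s \<otimes> e \<in> adjoin_ideal R (J (Suc k)) x"
      by (rule satE)
    then obtain j r where jr: "j \<in> J (Suc k)" "r \<in> carrier R" "s \<otimes> e = j \<oplus> r \<otimes> x"
      unfolding adjoin_ideal_def by blast
    have "r \<otimes> x = s \<otimes> e \<ominus> j"
      using jr ideal.Icarr[OF JI jr(1)] xc by (simp, algebra)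
    also have "\<dots> \<in> J k"
      using ideal_minus_mem[OF JI _ subsetD[OF J_Suc jr(1)]] ideal.I_l_closed[OF JI e] s(2) by blast
    finally have "r \<in> J k" using J_cancel jr(2) by blast
    then show "\<exists>s\<in>carrier R - m. \<exists>j\<in>J (Suc k). \<exists>r\<in>J k. s \<otimes> e = j \<oplus> r \<otimes> x"
      using s(2) jr by blast
  qed
  moreover have "y [^] k \<in> J k"
    using subset_adjoin_ideal(2)[OF pI, of "y [^] k"] y(1) Y_subset_J[of k] unfolding Y_def by auto
  ultimately obtain c :: nat where "x [^] c \<otimes> y [^] k \<in> sat (Y (Suc k))"
    unfolding J_def by blast
  then obtain s where s: "s \<in> carrier R - m" "s \<otimes> (x [^] c \<otimes> y [^] k) \<in> Y (Suc k)"
    by (rule satE)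
  then obtain i r where ir: "i \<in> p" "r \<in> carrier R" "s \<otimes> (x [^] c \<otimes> y [^] k) = i \<oplus> r \<otimes> y [^] Suc k"
    unfolding Y_def adjoin_ideal_def by blast
  have ic: "i \<in> carrier R" using ideal.Icarr[OF pI ir(1)] .
  have "u \<otimes> (s \<otimes> v \<ominus> r \<otimes> y) = s \<otimes> (v \<otimes> u) \<ominus> r \<otimes> (u \<otimes> y)"
    if "u \<in> carrier R" "v \<in> carrier R" for u v
    using that s(1) ir(2) y(1) by (simp, algebra)
  then have "y [^] k \<otimes> (s \<otimes> x [^] c \<ominus> r \<otimes> y) = s \<otimes> (x [^] c \<otimes> y [^] k) \<ominus> r \<otimes> y [^] Suc k"
    using y(1) xc by simp
  also have "\<dots> = i"
  proof -
    have "(i \<oplus> w) \<ominus> w = i" if "w \<in> carrier R" for w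
      using that ic by algebra
    then show ?thesis using ir(2,3) y(1) by simp
  qed
  finally have "y [^] k \<otimes> (s \<otimes> x [^] c \<ominus> r \<otimes> y) \<in> p" using ir(1) by simp
  then have "s \<otimes> x [^] c \<ominus> r \<otimes> y \<in> p"
    using primeideal.I_prime[OF p, of "y [^] k" "s \<otimes> x [^] c \<ominus> r \<otimes> y"] primeideal_pow_mem[OF p y(1)]
      y s(1) ir(2) xc by auto
  moreover have "s \<otimes> x [^] c = (s \<otimes> x [^] c \<ominus> r \<otimes> y) \<oplus> r \<otimes> y"
  proof -
    have "u = (u \<ominus> w) \<oplus> w" if "u \<in> carrier R" "w \<in> carrier R" for u w
      using that by algebra
    then show ?thesis using s(1) ir(2) y(1) xc by simp
  qed
  ultimately have "s \<otimes> x [^] c \<in> adjoin_ideal R p y"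
    using ir(2) unfolding adjoin_ideal_def by blast
  then show ?thesis using s(1) by blast
qed

end

text \<open>A minimal prime over a principal ideal of the domain \<open>R / p\<close> has height at most one: for \<open>y \<in> q\<close>
  outside \<open>p\<close>, the principal ideal theorem gives \<open>s z\<^sup>n \<in> p + (y) \<subseteq> q\<close> with \<open>s \<notin> m\<close>, hence \<open>z \<in> q\<close>.\<close>

lemma (in noetherian_cring) height_one:
  assumes p: "primeideal p R" and q: "primeideal q R" "p \<subset> q" and m: "primeideal m R" "q \<subset> m"
    and z: "z \<in> m"
    and min: "\<And>q. primeideal q R \<Longrightarrow> p \<subseteq> q \<Longrightarrow> z \<in> q \<Longrightarrow> q \<subseteq> m \<Longrightarrow> q = m"
  shows False
proof -
  interpret localisation_at_prime R m
    using noetherian_cring_axioms m(1)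
    by (simp add: localisation_at_prime_def localisation_at_prime_axioms_def)
  have "z \<notin> q" using min[OF q(1)] q(2) m(2) by blast
  obtain y where y: "y \<in> q" "y \<notin> p" using q(2) by blast
  have qI: "ideal q R" using q(1) by (rule primeideal.axioms)
  have zc: "z \<in> carrier R" using ideal.Icarr[OF m_ideal z] .
  obtain s and n :: nat where s: "s \<in> carrier R - m" "s \<otimes> z [^] n \<in> adjoin_ideal R p y"
    using principal_ideal_theorem[OF p _ z min ideal.Icarr[OF qI y(1)] y(2)] q(2) m(2) by auto
  then have "s \<otimes> z [^] n \<in> q"
    using adjoin_ideal_least[OF qI _ y(1)] q(2) by blast
  then have "s \<in> q \<or> z [^] n \<in> q"
    using primeideal.I_prime[OF q(1)] s(1) zc by auto
  then show False
    using s(1) m(2) \<open>z \<notin> q\<close> primeideal_pow_mem[OF q(1) zc] by blast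
qed

text \<open>A variant of the theorem of Artin and Tate that a Noetherian domain whose nonzero primes have a
  nonzero element \<open>g\<close> in common is of dimension at most one. Let \<open>J\<close> consist of the elements that some
  power of \<open>\<pi>\<close> multiplies into \<open>p + (g)\<close>; a prime above \<open>p\<close> without \<open>\<pi>\<close> contains \<open>J\<close>. By the principal
  ideal theorem, the minimal primes over \<open>p + (\<pi>)\<close> do not contain \<open>J\<close>, so some \<open>y \<in> J\<close> avoids them
  all. Every prime above \<open>p\<close> containing \<open>\<pi> + y\<close> contains \<open>g\<close>, hence \<open>\<pi>\<close> and \<open>y\<close>, hence one of those
  minimal primes strictly; this contradicts the principal ideal theorem for \<open>\<pi> + y\<close>. That \<open>\<pi>\<close> lies
  in the Jacobson radical makes \<open>\<pi> + y\<close> a nonunit.\<close>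

theorem (in noetherian_cring) artin_tate:
  assumes p: "primeideal p R" and \<pi>: "\<pi> \<in> carrier R" "\<pi> \<notin> p"
    and radical: "\<And>M. maximalideal M R \<Longrightarrow> \<pi> \<in> M"
    and g: "g \<in> carrier R" "g \<notin> p" and g_mem: "\<And>q. primeideal q R \<Longrightarrow> p \<subset> q \<Longrightarrow> g \<in> q"
    and q: "primeideal q R" "p \<subset> q"
  shows "\<pi> \<in> q"
proof (rule ccontr)
  assume \<pi>q: "\<pi> \<notin> q"
  have pI: "ideal p R" and qI: "ideal q R" using p q(1) by (auto simp: primeideal.axioms)
  define G where "G = adjoin_ideal R p g"
  have G: "ideal G R" "p \<subseteq> G" "g \<in> G"
    unfolding G_def using adjoin_ideal_ideal[OF pI g(1)] subset_adjoin_ideal[OF pI g(1)] by auto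
  have G_least: "G \<subseteq> q'" if "primeideal q' R" "p \<subset> q'" for q'
    unfolding G_def using adjoin_ideal_least[OF primeideal.axioms(1) _ g_mem] that by auto
  define J where "J = {e \<in> carrier R. \<exists>c::nat. \<pi> [^] c \<otimes> e \<in> G}"
  have J: "ideal J R"
    unfolding J_def using G(1) \<pi>(1) by (rule colon_powers_ideal)
  have J_least: "J \<subseteq> q'" if q': "primeideal q' R" "p \<subset> q'" "\<pi> \<notin> q'" for q'
  proof
    fix e assume "e \<in> J"
    then obtain c :: nat where c: "e \<in> carrier R" "\<pi> [^] c \<otimes> e \<in> q'"
      using G_least[OF q'(1,2)] unfolding J_def by blast
    then show "e \<in> q'"
      using primeideal.I_prime[OF q'(1) _ c(1,2)] primeideal_pow_mem[OF q'(1) \<pi>(1)] q'(3) \<pi>(1) by auto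
  qed
  obtain F where F: "finite F" "\<And>m. m \<in> F \<Longrightarrow> primeideal m R" "\<And>m. m \<in> F \<Longrightarrow> adjoin_ideal R p \<pi> \<subseteq> m"
    "\<And>q. primeideal q R \<Longrightarrow> adjoin_ideal R p \<pi> \<subseteq> q \<Longrightarrow> \<exists>m\<in>F. m \<subseteq> q"
    "\<And>m q. m \<in> F \<Longrightarrow> primeideal q R \<Longrightarrow> adjoin_ideal R p \<pi> \<subseteq> q \<Longrightarrow> q \<subseteq> m \<Longrightarrow> q = m"
    by (rule minimal_primes[OF adjoin_ideal_ideal[OF pI \<pi>(1)]]) blast
  have adjoin_\<pi>: "adjoin_ideal R p \<pi> \<subseteq> m \<longleftrightarrow> p \<subseteq> m \<and> \<pi> \<in> m" if "primeideal m R" for m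
    using adjoin_ideal_least[of m p \<pi>] subset_adjoin_ideal[OF pI \<pi>(1)] primeideal.axioms(1)[OF that]
    by blast
  have F_above: "p \<subset> m" "\<pi> \<in> m" if "m \<in> F" for m
    using adjoin_\<pi>[OF F(2)[OF that]] F(3)[OF that] \<pi>(2) by auto
  have "\<not> J \<subseteq> m" if m: "m \<in> F" for m
  proof
    assume "J \<subseteq> m"
    interpret m: localisation_at_prime R m
      using noetherian_cring_axioms F(2)[OF m]
      by (simp add: localisation_at_prime_def localisation_at_prime_axioms_def)
    have "\<exists>s\<in>carrier R - m. \<exists>n::nat. s \<otimes> \<pi> [^] n \<in> G"
      unfolding G_def
    proof (rule m.principal_ideal_theorem[OF p _ F_above(2)[OF m] _ g])
      show "p \<subseteq> m" using F_above(1)[OF m] by blast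
      show "q' = m" if "primeideal q' R" "p \<subseteq> q'" "\<pi> \<in> q'" "q' \<subseteq> m" for q'
        using F(5)[OF m that(1) _ that(4)] adjoin_\<pi>[OF that(1)] that(2,3) by blast
    qed
    then obtain s n where s: "s \<in> carrier R - m" "s \<otimes> \<pi> [^] (n::nat) \<in> G" by blast
    then have "s \<in> J" using \<pi>(1) by (auto simp: J_def m_comm intro!: exI[of _ n])
    then show False using \<open>J \<subseteq> m\<close> s(1) by blast
  qed
  then obtain y where y: "y \<in> J" "\<And>m. m \<in> F \<Longrightarrow> y \<notin> m"
    using prime_avoidance[OF F(1,2) _ J] F(3,5) F(2) by metis
  have yc: "y \<in> carrier R" using ideal.Icarr[OF J y(1)] .
  define z where "z = \<pi> \<oplus> y"
  have zc: "z \<in> carrier R" using \<pi>(1) yc by (simp add: z_def)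
  have z_mem: "z \<in> I \<longleftrightarrow> y \<in> I" if I: "ideal I R" "\<pi> \<in> I" for I
  proof -
    have "y = z \<ominus> \<pi>" using \<pi>(1) yc unfolding z_def by algebra
    then show ?thesis using ideal_diff_mem_iff[OF I zc] by simp
  qed
  obtain M where M: "maximalideal M R" "q \<subseteq> M"
    using exists_maximalideal[OF qI primeideal_one_notin[OF q(1)]] .
  have Mp: "primeideal M R" "ideal M R" using maximalideal_prime[OF M(1)] primeideal.axioms(1) by auto
  have \<pi>M: "\<pi> \<in> M" using radical[OF M(1)] .
  have "J \<subseteq> M" using J_least[OF q \<pi>q] M(2) by blast
  then have zM: "z \<in> M" using y(1) z_mem[OF Mp(2) \<pi>M] by blast
  have "adjoin_ideal R p z \<subseteq> M"
    using adjoin_ideal_least[OF Mp(2) _ zM] q(2) M(2) by blast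
  moreover obtain E where E: "\<And>m. m \<in> E \<Longrightarrow> primeideal m R" "\<And>m. m \<in> E \<Longrightarrow> adjoin_ideal R p z \<subseteq> m"
    "\<And>q. primeideal q R \<Longrightarrow> adjoin_ideal R p z \<subseteq> q \<Longrightarrow> \<exists>m\<in>E. m \<subseteq> q"
    "\<And>m q. m \<in> E \<Longrightarrow> primeideal q R \<Longrightarrow> adjoin_ideal R p z \<subseteq> q \<Longrightarrow> q \<subseteq> m \<Longrightarrow> q = m"
    by (rule minimal_primes[OF adjoin_ideal_ideal[OF pI zc]]) blast
  ultimately obtain m where m: "m \<in> E" "m \<subseteq> M" using Mp(1) by blast
  have mp: "primeideal m R" "ideal m R" using E(1)[OF m(1)] primeideal.axioms(1) by auto
  have pm: "p \<subseteq> m" and zm: "z \<in> m"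
    using E(2)[OF m(1)] subset_adjoin_ideal[OF pI zc] by auto
  obtain m\<^sub>0 where "m\<^sub>0 \<in> F"
    using F(4)[OF Mp(1)] adjoin_\<pi>[OF Mp(1)] \<pi>M q(2) M(2) by blast
  then have "z \<notin> p"
    using F_above y(2) z_mem[of m\<^sub>0] F(2) primeideal.axioms(1) by blast
  then have "p \<subset> m" using pm zm by blast
  have \<pi>m: "\<pi> \<in> m"
  proof (rule ccontr)
    assume "\<pi> \<notin> m"
    then have "y \<in> m" using J_least[OF mp(1) \<open>p \<subset> m\<close>] y(1) by blast
    moreover have "\<pi> = z \<ominus> y" using \<pi>(1) yc unfolding z_def by algebra
    ultimately show False using ideal_minus_mem[OF mp(2) zm] \<open>\<pi> \<notin> m\<close> by simp
  qed
  then obtain m' where m': "m' \<in> F" "m' \<subseteq> m"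
    using F(4)[OF mp(1)] adjoin_\<pi>[OF mp(1)] pm by blast
  have "z \<notin> m'"
    using z_mem[of m'] F_above(2)[OF m'(1)] y(2)[OF m'(1)] F(2)[OF m'(1)] primeideal.axioms(1) by blast
  show False
  proof (rule height_one[OF p F(2)[OF m'(1)] F_above(1)[OF m'(1)] mp(1) _ zm])
    show "m' \<subset> m" using m'(2) zm \<open>z \<notin> m'\<close> by blast
    show "q' = m" if "primeideal q' R" "p \<subseteq> q'" "z \<in> q'" "q' \<subseteq> m" for q'
      using E(4)[OF m(1) that(1) _ that(4)] adjoin_ideal_least[OF primeideal.axioms(1)[OF that(1)] that(2,3)]
      by blast
  qed
qed

section \<open>Rings of power series\<close>

lemma finite_multisets_le_size:
  assumes "finite A"
  shows "finite {e. set_mset e \<subseteq> A \<and> size e \<le> k}"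
proof -
  have "{e. set_mset e \<subseteq> A \<and> size e \<le> k} = (\<Union>j\<le>k. multisets_of_size A j)"
    by (auto simp: multisets_of_size_def)
  then show ?thesis using finite_multisets_of_size[OF assms] by simp
qed

lemma finite_submultisets: "finite {d. d \<subseteq># e}"
  by (rule finite_subset[OF _ finite_multisets_le_size[of "set_mset e" "size e"]])
    (auto simp: size_mset_mono dest: set_mset_mono)

lemma diff_diff_submultiset: "d \<subseteq># e \<Longrightarrow> e - (e - d) = d"
  by (simp add: multiset_eq_iff subseteq_mset_def)

lemma (in abelian_monoid) finsum_Sigma:
  assumes "finite A" and "\<And>x. x \<in> A \<Longrightarrow> finite (B x)"
    and "\<And>x y. x \<in> A \<Longrightarrow> y \<in> B x \<Longrightarrow> f x y \<in> carrier G"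
  shows "(\<Oplus>x\<in>A. \<Oplus>y\<in>B x. f x y) = (\<Oplus>z\<in>Sigma A B. f (fst z) (snd z))"
  using assms
proof (induction A)
  case empty
  then show ?case by simp
next
  case (insert a A)
  have "Sigma (insert a A) B = Pair a ` B a \<union> Sigma A B" by auto
  moreover have "(\<Oplus>z\<in>Pair a ` B a. f (fst z) (snd z)) = (\<Oplus>y\<in>B a. f a y)"
    using insert.prems by (subst finsum_reindex) (auto simp: inj_on_def)
  moreover have "(\<Oplus>z\<in>Pair a ` B a \<union> Sigma A B. f (fst z) (snd z)) =
      (\<Oplus>z\<in>Pair a ` B a. f (fst z) (snd z)) \<oplus> (\<Oplus>z\<in>Sigma A B. f (fst z) (snd z))"
    using insert by (intro finsum_Un_disjoint) auto
  moreover have "(\<lambda>x. \<Oplus>y\<in>B x. f x y) \<in> A \<rightarrow> carrier G" "(\<Oplus>y\<in>B a. f a y) \<in> carrier G"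
    using insert.prems by (auto intro!: finsum_closed)
  ultimately show ?case
    using insert by (simp add: finsum_insert)
qed

lemma (in abelian_monoid) finsum_nonzero_singleton:
  assumes "finite A" and "i \<in> A" and "f i \<in> carrier G" and "\<And>j. j \<in> A \<Longrightarrow> j \<noteq> i \<Longrightarrow> f j = \<zero>"
  shows "finsum G f A = f i"
proof -
  have "finsum G f (insert i (A - {i})) = f i \<oplus> finsum G f (A - {i})"
    using assms by (intro finsum_insert) auto
  moreover have "finsum G f (A - {i}) = \<zero>"
    using assms(4) by (intro add.finprod_one_eqI) auto
  ultimately show ?thesis
    using assms by (simp add: insert_absorb)
qed

definition monomial_series :: "('b, 'm) ring_scheme \<Rightarrow> nat multiset \<Rightarrow> 'b \<Rightarrow> nat multiset \<Rightarrow> 'b" where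
  "monomial_series B e\<^sub>0 b = (\<lambda>e. if e = e\<^sub>0 then b else \<zero>\<^bsub>B\<^esub>)"

lemma ps_const_eq: "ps_const B b = monomial_series B {#} b"
  by (simp add: ps_const_def monomial_series_def)

lemma ps_var_eq: "ps_var B i = monomial_series B {#i#} \<one>\<^bsub>B\<^esub>"
  by (simp add: ps_var_def monomial_series_def)

locale power_series_over = cring B for B :: "'b ring" (structure) +
  fixes n :: nat
begin

abbreviation PS :: "(nat multiset \<Rightarrow> 'b) ring" where
  "PS \<equiv> power_series_ring B n"

lemma PS_memI:
  assumes "\<And>e. f e \<in> carrier B" and "\<And>e. \<not> set_mset e \<subseteq> {..<n} \<Longrightarrow> f e = \<zero>"
  shows "f \<in> carrier PS"
  using assms by (simp add: power_series_ring_def)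

lemma PS_coeff_closed: "f \<in> carrier PS \<Longrightarrow> f e \<in> carrier B"
  by (simp add: power_series_ring_def)

lemma PS_coeff_outside: "f \<in> carrier PS \<Longrightarrow> \<not> set_mset e \<subseteq> {..<n} \<Longrightarrow> f e = \<zero>"
  by (simp add: power_series_ring_def)

lemma PS_zero: "\<zero>\<^bsub>PS\<^esub> = (\<lambda>e. \<zero>)"
  and PS_one: "\<one>\<^bsub>PS\<^esub> = monomial_series B {#} \<one>"
  and PS_add: "f \<oplus>\<^bsub>PS\<^esub> g = (\<lambda>e. f e \<oplus> g e)"
  and PS_mult: "f \<otimes>\<^bsub>PS\<^esub> g = (\<lambda>e. \<Oplus>d\<in>{d. d \<subseteq># e}. f d \<otimes> g (e - d))"
  by (simp_all add: power_series_ring_def monomial_series_def)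

declare PS_coeff_closed [simp]

lemma monomial_series_closed:
  assumes "b \<in> carrier B" and "set_mset e\<^sub>0 \<subseteq> {..<n}"
  shows "monomial_series B e\<^sub>0 b \<in> carrier PS"
  using assms by (intro PS_memI) (auto simp: monomial_series_def)

lemma PS_mult_closed:
  assumes f: "f \<in> carrier PS" and g: "g \<in> carrier PS"
  shows "f \<otimes>\<^bsub>PS\<^esub> g \<in> carrier PS"
proof (rule PS_memI)
  show "(f \<otimes>\<^bsub>PS\<^esub> g) e \<in> carrier B" for e
    unfolding PS_mult using f g by (intro finsum_closed) auto
  show "(f \<otimes>\<^bsub>PS\<^esub> g) e = \<zero>" if e: "\<not> set_mset e \<subseteq> {..<n}" for e
    unfolding PS_mult
  proof (rule add.finprod_one_eqI)
    fix d assume "d \<in> {d. d \<subseteq># e}"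
    then have "e = d + (e - d)" by simp
    then have "set_mset e = set_mset d \<union> set_mset (e - d)" by (metis set_mset_union)
    then have "\<not> set_mset d \<subseteq> {..<n} \<or> \<not> set_mset (e - d) \<subseteq> {..<n}" using e by auto
    then have "f d = \<zero> \<or> g (e - d) = \<zero>"
      using PS_coeff_outside[OF f, of d] PS_coeff_outside[OF g, of "e - d"] by blast
    then show "f d \<otimes> g (e - d) = \<zero>"
      using f g by auto
  qed
qed

lemma PS_mult_comm:
  assumes f: "f \<in> carrier PS" and g: "g \<in> carrier PS"
  shows "f \<otimes>\<^bsub>PS\<^esub> g = g \<otimes>\<^bsub>PS\<^esub> f"
proof
  fix e :: "nat multiset"
  have *: "{d. d \<subseteq># e} = (\<lambda>d. e - d) ` {d. d \<subseteq># e}"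
  proof (intro equalityI subsetI)
    fix d assume "d \<in> {d. d \<subseteq># e}"
    then show "d \<in> (\<lambda>d. e - d) ` {d. d \<subseteq># e}"
      by (intro image_eqI[where x = "e - d"]) (auto simp: diff_diff_submultiset)
  qed auto
  have "(f \<otimes>\<^bsub>PS\<^esub> g) e = (\<Oplus>d\<in>(\<lambda>d. e - d) ` {d. d \<subseteq># e}. f d \<otimes> g (e - d))"
    unfolding PS_mult using * by simp
  also have "\<dots> = (\<Oplus>d\<in>{d. d \<subseteq># e}. f (e - d) \<otimes> g (e - (e - d)))"
  proof (rule finsum_reindex)
    show "inj_on (\<lambda>d. e - d) {d. d \<subseteq># e}"
      by (rule inj_on_inverseI[of _ "\<lambda>d. e - d"]) (simp add: diff_diff_submultiset)
  qed (use f g in auto)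
  also have "\<dots> = (\<Oplus>d\<in>{d. d \<subseteq># e}. g d \<otimes> f (e - d))"
    using f g by (intro finsum_cong') (auto simp: m_comm diff_diff_submultiset)
  finally show "(f \<otimes>\<^bsub>PS\<^esub> g) e = (g \<otimes>\<^bsub>PS\<^esub> f) e"
    unfolding PS_mult .
qed

text \<open>Both bracketings sum \<open>f a \<otimes> g b \<otimes> h c\<close> over all decompositions \<open>e = a + b + c\<close>.\<close>

lemma PS_mult_assoc:
  assumes f: "f \<in> carrier PS" and g: "g \<in> carrier PS" and h: "h \<in> carrier PS"
  shows "(f \<otimes>\<^bsub>PS\<^esub> g) \<otimes>\<^bsub>PS\<^esub> h = f \<otimes>\<^bsub>PS\<^esub> (g \<otimes>\<^bsub>PS\<^esub> h)"
proof
  fix e :: "nat multiset"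
  define S where "S = Sigma {d. d \<subseteq># e} (\<lambda>d. {a. a \<subseteq># d})"
  define T where "T = Sigma {a. a \<subseteq># e} (\<lambda>a. {b. b \<subseteq># e - a})"
  define F where "F d a = f a \<otimes> g (d - a) \<otimes> h (e - d)" for d a
  have FC: "F d a \<in> carrier B" for d a using f g h by (simp add: F_def)
  have "((f \<otimes>\<^bsub>PS\<^esub> g) \<otimes>\<^bsub>PS\<^esub> h) e = (\<Oplus>d\<in>{d. d \<subseteq># e}. \<Oplus>a\<in>{a. a \<subseteq># d}. F d a)"
    unfolding PS_mult F_def using f g h
    by (intro finsum_cong') (auto intro!: finsum_ldistr finsum_closed finite_submultisets)
  also have "\<dots> = (\<Oplus>z\<in>S. F (fst z) (snd z))"
    unfolding S_def using FC by (intro finsum_Sigma) (auto simp: finite_submultisets)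
  also have "S = (\<lambda>z. (fst z + snd z, fst z)) ` T"
  proof (intro equalityI subsetI)
    fix z assume "z \<in> S"
    then have z: "snd z \<subseteq># fst z" "fst z \<subseteq># e" by (auto simp: S_def)
    then have "fst z - snd z \<subseteq># e - snd z" "snd z \<subseteq># e"
      by (auto simp: subseteq_mset_def diff_le_mono intro: order_trans)
    then show "z \<in> (\<lambda>z. (fst z + snd z, fst z)) ` T"
      using z(1) by (intro image_eqI[where x = "(snd z, fst z - snd z)"]) (auto simp: T_def)
  next
    fix z assume "z \<in> (\<lambda>z. (fst z + snd z, fst z)) ` T"
    then show "z \<in> S"
      by (auto simp: S_def T_def subset_mset.le_diff_conv2 add.commute)
  qed
  also have "(\<Oplus>z\<in>\<dots>. F (fst z) (snd z)) = (\<Oplus>z\<in>T. F (fst z + snd z) (fst z))"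
    using FC by (subst finsum_reindex) (auto simp: inj_on_def)
  also have "\<dots> = (\<Oplus>a\<in>{a. a \<subseteq># e}. \<Oplus>b\<in>{b. b \<subseteq># e - a}. F (a + b) a)"
    unfolding T_def using FC by (intro finsum_Sigma[symmetric]) (auto simp: finite_submultisets)
  also have "\<dots> = (f \<otimes>\<^bsub>PS\<^esub> (g \<otimes>\<^bsub>PS\<^esub> h)) e"
    unfolding PS_mult F_def
  proof (intro finsum_cong')
    show "(\<lambda>a. f a \<otimes> (\<Oplus>d\<in>{d. d \<subseteq># e - a}. g d \<otimes> h (e - a - d))) \<in> {a. a \<subseteq># e} \<rightarrow> carrier B"
      using f g h by (auto intro!: finsum_closed)
    fix a
    have "f a \<otimes> (\<Oplus>d\<in>{d. d \<subseteq># e - a}. g d \<otimes> h (e - a - d)) =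
        (\<Oplus>d\<in>{d. d \<subseteq># e - a}. f a \<otimes> (g d \<otimes> h (e - a - d)))"
      using f g h by (intro finsum_rdistr) (auto simp: finite_submultisets)
    also have "\<dots> = (\<Oplus>b\<in>{b. b \<subseteq># e - a}. f a \<otimes> g (a + b - a) \<otimes> h (e - (a + b)))"
      using f g h by (intro finsum_cong') (auto simp: m_assoc)
    finally show "(\<Oplus>b\<in>{b. b \<subseteq># e - a}. f a \<otimes> g (a + b - a) \<otimes> h (e - (a + b))) =
      f a \<otimes> (\<Oplus>d\<in>{d. d \<subseteq># e - a}. g d \<otimes> h (e - a - d))" ..
  qed simp
  finally show "((f \<otimes>\<^bsub>PS\<^esub> g) \<otimes>\<^bsub>PS\<^esub> h) e = (f \<otimes>\<^bsub>PS\<^esub> (g \<otimes>\<^bsub>PS\<^esub> h)) e" .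
qed

lemma monomial_series_mult_coeff:
  assumes b: "b \<in> carrier B" and g: "g \<in> carrier PS"
  shows "(monomial_series B e\<^sub>0 b \<otimes>\<^bsub>PS\<^esub> g) e = (if e\<^sub>0 \<subseteq># e then b \<otimes> g (e - e\<^sub>0) else \<zero>)"
proof (cases "e\<^sub>0 \<subseteq># e")
  case True
  have "(\<Oplus>d\<in>{d. d \<subseteq># e}. monomial_series B e\<^sub>0 b d \<otimes> g (e - d)) = monomial_series B e\<^sub>0 b e\<^sub>0 \<otimes> g (e - e\<^sub>0)"
    using True b g by (intro finsum_nonzero_singleton) (auto simp: monomial_series_def finite_submultisets)
  then show ?thesis using True by (simp add: PS_mult monomial_series_def)
next
  case False
  then show ?thesis
    unfolding PS_mult using g by (auto simp: monomial_series_def intro!: add.finprod_one_eqI)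
qed

lemma PS_cring: "cring PS"
proof (rule cringI)
  show "abelian_group PS"
  proof (rule abelian_groupI)
    fix f assume f: "f \<in> carrier PS"
    have "(\<lambda>e. \<ominus> f e) \<in> carrier PS"
      using f PS_coeff_outside[OF f] by (intro PS_memI) auto
    moreover have "(\<lambda>e. \<ominus> f e) \<oplus>\<^bsub>PS\<^esub> f = \<zero>\<^bsub>PS\<^esub>"
      using f by (auto simp: PS_add PS_zero l_neg)
    ultimately show "\<exists>g\<in>carrier PS. g \<oplus>\<^bsub>PS\<^esub> f = \<zero>\<^bsub>PS\<^esub>" by blast
  next
    fix f g assume "f \<in> carrier PS" "g \<in> carrier PS"
    then show "f \<oplus>\<^bsub>PS\<^esub> g \<in> carrier PS"
      by (intro PS_memI) (auto simp: PS_add PS_coeff_outside)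
  qed (auto simp: PS_add PS_zero fun_eq_iff a_ac intro!: PS_memI)
  show "Group.comm_monoid PS"
  proof (rule comm_monoidI)
    show "\<one>\<^bsub>PS\<^esub> \<otimes>\<^bsub>PS\<^esub> f = f" if "f \<in> carrier PS" for f
      using that by (auto simp: PS_one monomial_series_mult_coeff)
    show "(f \<otimes>\<^bsub>PS\<^esub> g) \<otimes>\<^bsub>PS\<^esub> h = f \<otimes>\<^bsub>PS\<^esub> (g \<otimes>\<^bsub>PS\<^esub> h)"
      if "f \<in> carrier PS" "g \<in> carrier PS" "h \<in> carrier PS" for f g h
      using that by (rule PS_mult_assoc)
    show "f \<otimes>\<^bsub>PS\<^esub> g = g \<otimes>\<^bsub>PS\<^esub> f" if "f \<in> carrier PS" "g \<in> carrier PS" for f g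
      using that by (rule PS_mult_comm)
  qed (simp_all add: PS_mult_closed PS_one monomial_series_closed)
  fix f g h assume fgh: "f \<in> carrier PS" "g \<in> carrier PS" "h \<in> carrier PS"
  show "(f \<oplus>\<^bsub>PS\<^esub> g) \<otimes>\<^bsub>PS\<^esub> h = f \<otimes>\<^bsub>PS\<^esub> h \<oplus>\<^bsub>PS\<^esub> g \<otimes>\<^bsub>PS\<^esub> h"
  proof
    fix e :: "nat multiset"
    have "(\<Oplus>d\<in>{d. d \<subseteq># e}. (f d \<oplus> g d) \<otimes> h (e - d)) =
        (\<Oplus>d\<in>{d. d \<subseteq># e}. f d \<otimes> h (e - d) \<oplus> g d \<otimes> h (e - d))"
      using fgh by (intro finsum_cong') (auto simp: l_distr)
    also have "\<dots> = (\<Oplus>d\<in>{d. d \<subseteq># e}. f d \<otimes> h (e - d)) \<oplus> (\<Oplus>d\<in>{d. d \<subseteq># e}. g d \<otimes> h (e - d))"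
      using fgh by (intro finsum_addf) auto
    finally show "((f \<oplus>\<^bsub>PS\<^esub> g) \<otimes>\<^bsub>PS\<^esub> h) e = (f \<otimes>\<^bsub>PS\<^esub> h \<oplus>\<^bsub>PS\<^esub> g \<otimes>\<^bsub>PS\<^esub> h) e"
      by (simp add: PS_add PS_mult)
  qed
qed

lemma PS_neg:
  assumes f: "f \<in> carrier PS"
  shows "\<ominus>\<^bsub>PS\<^esub> f = (\<lambda>e. \<ominus> f e)"
proof -
  interpret PS: cring PS by (rule PS_cring)
  have "(\<lambda>e. \<ominus> f e) \<in> carrier PS"
    using f PS_coeff_outside[OF f] by (intro PS_memI) auto
  moreover have "(\<lambda>e. \<ominus> f e) \<oplus>\<^bsub>PS\<^esub> f = \<zero>\<^bsub>PS\<^esub>"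
    using f by (auto simp: PS_add PS_zero l_neg)
  ultimately show ?thesis using PS.minus_equality f by blast
qed

end

section \<open>Complete filtered rings\<close>

lemma (in ring) combination_add:
  assumes "G \<subseteq> carrier R" and "q \<in> G \<rightarrow> carrier R" and "r \<in> G \<rightarrow> carrier R"
  shows "(\<Oplus>g\<in>G. (q g \<oplus> r g) \<otimes> g) = (\<Oplus>g\<in>G. q g \<otimes> g) \<oplus> (\<Oplus>g\<in>G. r g \<otimes> g)"
proof -
  have "(\<Oplus>g\<in>G. (q g \<oplus> r g) \<otimes> g) = (\<Oplus>g\<in>G. q g \<otimes> g \<oplus> r g \<otimes> g)"
    using assms by (intro finsum_cong') (auto simp: l_distr Pi_iff subset_iff)
  also have "\<dots> = (\<Oplus>g\<in>G. q g \<otimes> g) \<oplus> (\<Oplus>g\<in>G. r g \<otimes> g)"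
    using assms by (intro finsum_addf) auto
  finally show ?thesis .
qed

text \<open>Completeness is required for sequences whose \<open>k\<close>-th step lies in \<open>F k\<close>; every Cauchy sequence has
  such a subsequence. The limit then has a known distance from every member of the sequence.\<close>

locale complete_filtered_ring = cring +
  fixes F :: "nat \<Rightarrow> 'a set"
  assumes F_ideal: "ideal (F k) R"
    and F_0: "F 0 = carrier R"
    and F_decseq: "decseq F"
    and F_mult: "a \<in> F i \<Longrightarrow> b \<in> F j \<Longrightarrow> a \<otimes> b \<in> F (i + j)"
    and F_separated: "(\<And>k. a \<in> F k) \<Longrightarrow> a = \<zero>"
    and F_complete: "(\<And>k. s k \<in> carrier R) \<Longrightarrow> (\<And>k. s (Suc k) \<ominus> s k \<in> F k) \<Longrightarrow>
      \<exists>l\<in>carrier R. \<forall>k. l \<ominus> s k \<in> F k"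
begin

lemma F_closed: "a \<in> F k \<Longrightarrow> a \<in> carrier R"
  using ideal.Icarr[OF F_ideal] by blast

lemma F_antimono: "i \<le> j \<Longrightarrow> a \<in> F j \<Longrightarrow> a \<in> F i"
  using F_decseq unfolding decseq_def by blast

text \<open>The geometric series converges.\<close>

lemma one_minus_unit:
  assumes x: "x \<in> F 1"
  shows "\<one> \<ominus> x \<in> Units R"
proof -
  have xc: "x \<in> carrier R" using F_closed[OF x] .
  define s where "s k = (\<Oplus>i\<in>{..<k}. x [^] i)" for k :: nat
  have sc: "s k \<in> carrier R" for k using xc unfolding s_def by (intro finsum_closed) auto
  have s_Suc: "s (Suc k) = s k \<oplus> x [^] k" for k
    using xc sc[of k] unfolding s_def by (simp add: lessThan_Suc Pi_def a_comm)
  have pow: "x [^] k \<in> F k" for k :: nat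
  proof (induction k)
    case 0
    then show ?case by (simp add: F_0)
  next
    case (Suc k)
    then show ?case using F_mult[OF Suc x] by simp
  qed
  have geometric: "(\<one> \<ominus> x) \<otimes> s k = \<one> \<ominus> x [^] k" for k
  proof (induction k)
    case 0
    then show ?case using xc by (simp add: s_def r_neg a_minus_def)
  next
    case (Suc k)
    have "(\<one> \<ominus> x) \<otimes> s (Suc k) = (\<one> \<ominus> x) \<otimes> s k \<oplus> (\<one> \<ominus> x) \<otimes> x [^] k"
      using sc[of k] xc unfolding s_Suc by (simp add: r_distr)
    also have "\<dots> = (\<one> \<ominus> x [^] k) \<oplus> (\<one> \<ominus> x) \<otimes> x [^] k" by (simp add: Suc)
    also have "\<dots> = \<one> \<ominus> x [^] Suc k"
    proof -
      have "(\<one> \<ominus> u) \<oplus> (\<one> \<ominus> x) \<otimes> u = \<one> \<ominus> u \<otimes> x" if "u \<in> carrier R" for u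
        using that xc by algebra
      then show ?thesis using xc by simp
    qed
    finally show ?case .
  qed
  have "s (Suc k) \<ominus> s k \<in> F k" for k
  proof -
    have "(u \<oplus> v) \<ominus> u = v" if "u \<in> carrier R" "v \<in> carrier R" for u v using that by algebra
    then show ?thesis using pow[of k] sc[of k] xc by (simp add: s_Suc)
  qed
  then obtain l where l: "l \<in> carrier R" "\<And>k. l \<ominus> s k \<in> F k"
    using F_complete[of s] sc by blast
  have "(\<one> \<ominus> x) \<otimes> l \<ominus> \<one> \<in> F k" for k
  proof -
    have "(\<one> \<ominus> x) \<otimes> l \<ominus> \<one> = (\<one> \<ominus> x) \<otimes> (l \<ominus> s k) \<oplus> ((\<one> \<ominus> x) \<otimes> s k \<ominus> \<one>)"
      using l(1) sc[of k] xc by algebra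
    also have "(\<one> \<ominus> x) \<otimes> s k \<ominus> \<one> = \<zero> \<ominus> x [^] k"
    proof -
      have "(\<one> \<ominus> u) \<ominus> \<one> = \<zero> \<ominus> u" if "u \<in> carrier R" for u using that by algebra
      then show ?thesis using xc by (simp add: geometric)
    qed
    also have "(\<one> \<ominus> x) \<otimes> (l \<ominus> s k) \<oplus> (\<zero> \<ominus> x [^] k) \<in> F k"
      using ideal.I_l_closed[OF F_ideal l(2)] xc ideal_minus_mem[OF F_ideal ideal_zero_mem[OF F_ideal] pow]
      by (intro ideal_add_mem[OF F_ideal]) auto
    finally show ?thesis .
  qed
  then have "(\<one> \<ominus> x) \<otimes> l \<ominus> \<one> = \<zero>" by (rule F_separated)
  then have "(\<one> \<ominus> x) \<otimes> l = \<one>" using l(1) xc by (simp add: r_right_minus_eq)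
  then show ?thesis
    using l(1) xc by (auto simp: Units_def m_comm intro!: bexI[of _ l])
qed

text \<open>A finite subset \<open>G\<close> generates \<open>J\<close> if every element of \<open>J\<close> is, up to higher order, a combination
  of \<open>G\<close> whose coefficients lose only a bounded amount \<open>k\<^sub>0\<close> of order: correcting the error repeatedly
  gives coefficient sequences that converge.\<close>

lemma generates_if_approximates:
  assumes J: "ideal J R" and G: "finite G" "G \<subseteq> J"
    and approx: "\<And>k f. f \<in> J \<Longrightarrow> f \<in> F k \<Longrightarrow>
      \<exists>q\<in>G \<rightarrow> F (k - k\<^sub>0). f \<ominus> (\<Oplus>g\<in>G. q g \<otimes> g) \<in> F (Suc k)"
  shows "J = Idl G"
proof
  have Gc: "G \<subseteq> carrier R" using G(2) ideal_subset_carrier[OF J] by blast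
  have comb_closed: "(\<Oplus>g\<in>G. q g \<otimes> g) \<in> carrier R" if "q \<in> G \<rightarrow> carrier R" for q
    using that Gc by (intro finsum_closed) auto
  note comb_mem = ideal_finsum_mem[OF _ G(1)]
  have comb_add: "(\<Oplus>g\<in>G. (q g \<oplus> r g) \<otimes> g) = (\<Oplus>g\<in>G. q g \<otimes> g) \<oplus> (\<Oplus>g\<in>G. r g \<otimes> g)"
    if "q \<in> G \<rightarrow> carrier R" "r \<in> G \<rightarrow> carrier R" for q r
    using combination_add[OF Gc that] .
  have minus_add: "a \<ominus> (b \<oplus> c) = a \<ominus> b \<ominus> c"
    if "a \<in> carrier R" "b \<in> carrier R" "c \<in> carrier R" for a b c
    using that by algebra
  show "Idl G \<subseteq> J" using genideal_minimal[OF J G(2)] .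
  show "J \<subseteq> Idl G"
  proof
    fix f assume f: "f \<in> J"
    have fc: "f \<in> carrier R" using ideal.Icarr[OF J f] .
    \<comment> \<open>\<open>s\<close> holds the coefficients after \<open>k\<close> corrections; \<open>Q\<close> bounds the size of the next correction.\<close>
    define P where "P k s \<longleftrightarrow> s \<in> G \<rightarrow> carrier R \<and> f \<ominus> (\<Oplus>g\<in>G. s g \<otimes> g) \<in> F k" for k s
    define Q where "Q k s s' \<longleftrightarrow> (\<forall>g\<in>G. s' g \<ominus> s g \<in> F (k - k\<^sub>0))" for k and s s' :: "'a \<Rightarrow> 'a"
    have "\<exists>s. \<forall>k. P k (s k) \<and> Q k (s k) (s (Suc k))"
    proof (rule dependent_nat_choice)
      have "f \<ominus> (\<Oplus>g\<in>G. \<zero> \<otimes> g) \<in> F 0" using fc comb_closed[of "\<lambda>_. \<zero>"] by (simp add: F_0)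
      then show "\<exists>s. P 0 s" unfolding P_def by (intro exI[of _ "\<lambda>_. \<zero>"]) auto
    next
      fix s k assume s: "P k s"
      define f' where "f' = f \<ominus> (\<Oplus>g\<in>G. s g \<otimes> g)"
      have sG: "s \<in> G \<rightarrow> carrier R" and f'F: "f' \<in> F k" using s unfolding P_def f'_def by auto
      have "(\<Oplus>g\<in>G. s g \<otimes> g) \<in> J"
        using sG G(2) ideal.I_l_closed[OF J] by (intro comb_mem[OF J]) auto
      then have "f' \<in> J" unfolding f'_def using ideal_minus_mem[OF J f] by blast
      then obtain q where q: "q \<in> G \<rightarrow> F (k - k\<^sub>0)" "f' \<ominus> (\<Oplus>g\<in>G. q g \<otimes> g) \<in> F (Suc k)"
        using approx f'F by blast
      have qG: "q \<in> G \<rightarrow> carrier R" using q(1) F_closed by auto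
      have "f \<ominus> (\<Oplus>g\<in>G. (s g \<oplus> q g) \<otimes> g) = f' \<ominus> (\<Oplus>g\<in>G. q g \<otimes> g)"
        unfolding comb_add[OF sG qG] f'_def
        using minus_add[OF fc comb_closed[OF sG] comb_closed[OF qG]] .
      then have "P (Suc k) (\<lambda>g. s g \<oplus> q g)" unfolding P_def using sG qG q(2) by auto
      moreover have "Q k s (\<lambda>g. s g \<oplus> q g)" unfolding Q_def
      proof
        fix g assume g: "g \<in> G"
        have "(s g \<oplus> q g) \<ominus> s g = q g" using g sG qG
          by (metis PiE a_comm a_minus_def add.inv_solve_right add.m_closed)
        then show "(s g \<oplus> q g) \<ominus> s g \<in> F (k - k\<^sub>0)" using q(1) g by auto
      qed
      ultimately show "\<exists>s'. P (Suc k) s' \<and> Q k s s'" by blast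
    qed
    then obtain s where s: "\<And>k. P k (s k)" "\<And>k. Q k (s k) (s (Suc k))" by blast
    have sG: "s k \<in> G \<rightarrow> carrier R" for k using s(1) unfolding P_def by blast
    have "\<exists>l\<in>carrier R. \<forall>k. l \<ominus> s (k + k\<^sub>0) g \<in> F k" if g: "g \<in> G" for g
    proof (rule F_complete)
      show "s (k + k\<^sub>0) g \<in> carrier R" for k using sG g by blast
      show "s (Suc k + k\<^sub>0) g \<ominus> s (k + k\<^sub>0) g \<in> F k" for k
        using s(2)[of "k + k\<^sub>0"] g unfolding Q_def by simp
    qed
    then obtain l where l: "\<And>g. g \<in> G \<Longrightarrow> l g \<in> carrier R" "\<And>g k. g \<in> G \<Longrightarrow> l g \<ominus> s (k + k\<^sub>0) g \<in> F k"
      by metis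
    have lG: "l \<in> G \<rightarrow> carrier R" using l(1) by blast
    have "f \<ominus> (\<Oplus>g\<in>G. l g \<otimes> g) \<in> F k" for k
    proof -
      \<comment> \<open>The shift by \<open>k\<^sub>0\<close> makes up for the order that the coefficients lose against the errors.\<close>
      define t where "t = s (k + k\<^sub>0)"
      have t: "t \<in> G \<rightarrow> carrier R" "f \<ominus> (\<Oplus>g\<in>G. t g \<otimes> g) \<in> F k" "\<And>g. g \<in> G \<Longrightarrow> l g \<ominus> t g \<in> F k"
        using s(1)[of "k + k\<^sub>0"] l(2) F_antimono[of k "k + k\<^sub>0"] unfolding P_def t_def by auto
      have d: "(\<lambda>g. l g \<ominus> t g) \<in> G \<rightarrow> carrier R" using t(1) lG by auto
      have "(\<Oplus>g\<in>G. l g \<otimes> g) = (\<Oplus>g\<in>G. (t g \<oplus> (l g \<ominus> t g)) \<otimes> g)"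
      proof (rule finsum_cong')
        fix g assume "g \<in> G"
        then have "l g \<in> carrier R" "t g \<in> carrier R" using lG t(1) by auto
        then have "t g \<oplus> (l g \<ominus> t g) = l g" by algebra
        then show "l g \<otimes> g = (t g \<oplus> (l g \<ominus> t g)) \<otimes> g" by simp
      qed (use lG t(1) Gc in \<open>auto simp: Pi_iff subset_iff\<close>)
      also have "\<dots> = (\<Oplus>g\<in>G. t g \<otimes> g) \<oplus> (\<Oplus>g\<in>G. (l g \<ominus> t g) \<otimes> g)"
        by (rule comb_add[OF t(1) d])
      finally have "f \<ominus> (\<Oplus>g\<in>G. l g \<otimes> g) = (f \<ominus> (\<Oplus>g\<in>G. t g \<otimes> g)) \<ominus> (\<Oplus>g\<in>G. (l g \<ominus> t g) \<otimes> g)"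
        using minus_add[OF fc comb_closed[OF t(1)] comb_closed[OF d]] by simp
      also have "\<dots> \<in> F k"
      proof (rule ideal_minus_mem[OF F_ideal t(2)])
        show "(\<Oplus>g\<in>G. (l g \<ominus> t g) \<otimes> g) \<in> F k"
          using t(3) Gc ideal.I_r_closed[OF F_ideal] by (intro comb_mem[OF F_ideal]) auto
      qed
      finally show ?thesis .
    qed
    then have "f \<ominus> (\<Oplus>g\<in>G. l g \<otimes> g) = \<zero>" by (rule F_separated)
    then have "f = (\<Oplus>g\<in>G. l g \<otimes> g)" using fc comb_closed[OF lG] by (simp add: r_right_minus_eq)
    also have "\<dots> \<in> Idl G"
      using lG genideal_self[OF Gc] ideal.I_l_closed[OF genideal_ideal[OF Gc]]
      by (intro comb_mem[OF genideal_ideal[OF Gc]]) auto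
    finally show "f \<in> Idl G" .
  qed
qed

end

section \<open>Dickson's lemma\<close>

lemma nat_incseq_subseq: "\<exists>r :: nat \<Rightarrow> nat. strict_mono r \<and> incseq (\<lambda>i. s (r i) :: nat)"
proof -
  obtain r where r: "strict_mono r" "monoseq (\<lambda>n. s (r n))" using seq_monosub by blast
  show ?thesis
  proof (cases "incseq (\<lambda>i. s (r i))")
    case True
    then show ?thesis using r(1) by blast
  next
    case False
    then have dec: "decseq (\<lambda>i. s (r i))" using r(2) by (simp add: monoseq_iff)
    obtain N where N: "\<And>i. s (r N) \<le> s (r i)"
      using exists_least_iff[of "\<lambda>x. \<exists>i. s (r i) = x"] by (metis not_le_imp_less)
    have "s (r (N + i)) = s (r N)" for i
      using N[of "N + i"] dec unfolding decseq_def by (simp add: dual_order.antisym)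
    then have "incseq (\<lambda>i. s (r (N + i)))" by (simp add: incseq_def)
    moreover have "strict_mono (\<lambda>i. r (N + i))" using r(1) by (simp add: strict_mono_def)
    ultimately show ?thesis by blast
  qed
qed

lemma multiset_increasing_subseq:
  fixes s :: "nat \<Rightarrow> nat multiset"
  assumes "\<And>i. set_mset (s i) \<subseteq> {..<n}"
  shows "\<exists>r :: nat \<Rightarrow> nat. strict_mono r \<and> (\<forall>i j. i \<le> j \<longrightarrow> s (r i) \<subseteq># s (r j))"
proof -
  have "\<exists>r :: nat \<Rightarrow> nat. strict_mono r \<and> (\<forall>x<n'. \<forall>i j. i \<le> j \<longrightarrow> count (s (r i)) x \<le> count (s (r j)) x)" for n'
  proof (induction n')
    case 0
    then show ?case by (auto intro!: exI[of _ "\<lambda>i. i"] simp: strict_mono_def)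
  next
    case (Suc n')
    then obtain r where r: "strict_mono (r :: nat \<Rightarrow> nat)"
      "\<forall>x<n'. \<forall>i j. i \<le> j \<longrightarrow> count (s (r i)) x \<le> count (s (r j)) x" by blast
    obtain r' :: "nat \<Rightarrow> nat" where r': "strict_mono r'" "incseq (\<lambda>i. count (s (r (r' i))) n')"
      using nat_incseq_subseq[of "\<lambda>i. count (s (r i)) n'"] by blast
    have "r' i \<le> r' j" if "i \<le> j" for i j using strict_mono_less_eq[OF r'(1)] that by blast
    then have "\<forall>x<Suc n'. \<forall>i j. i \<le> j \<longrightarrow> count (s (r (r' i))) x \<le> count (s (r (r' j))) x"
      using r(2) r'(2) unfolding incseq_def by (auto simp: less_Suc_eq)
    moreover have "strict_mono (\<lambda>i. r (r' i))" using r(1) r'(1) by (simp add: strict_mono_def)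
    ultimately show ?case by blast
  qed
  then obtain r :: "nat \<Rightarrow> nat" where r: "strict_mono r"
    "\<forall>x<n. \<forall>i j. i \<le> j \<longrightarrow> count (s (r i)) x \<le> count (s (r j)) x" by blast
  have "s (r i) \<subseteq># s (r j)" if "i \<le> j" for i j
  proof (rule mset_subset_eqI)
    fix x
    show "count (s (r i)) x \<le> count (s (r j)) x"
    proof (cases "x < n")
      case True
      then show ?thesis using r(2) that by blast
    next
      case False
      then have "x \<notin># s (r i)" using assms by auto
      then show ?thesis by (simp add: not_in_iff)
    qed
  qed
  then show ?thesis using r(1) by blast
qed

text \<open>A triple \<open>(a, d, e)\<close> stands for \<open>\<pi>\<^sup>a S\<^sup>d T\<^sup>e\<close>, so that this relation is divisibility.\<close>

definition exponent_le :: "nat \<times> nat multiset \<times> nat multiset \<Rightarrow> nat \<times> nat multiset \<times> nat multiset \<Rightarrow> bool" where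
  "exponent_le x y \<longleftrightarrow> fst x \<le> fst y \<and> fst (snd x) \<subseteq># fst (snd y) \<and> snd (snd x) \<subseteq># snd (snd y)"

text \<open>Otherwise there is an infinite sequence in which no member divides a later one; but monotone
  subsequences can be extracted for one exponent after the other.\<close>

lemma dickson:
  fixes L :: "(nat \<times> nat multiset \<times> nat multiset) set"
  assumes L: "\<And>a d e. (a, d, e) \<in> L \<Longrightarrow> set_mset d \<subseteq> {..<m} \<and> set_mset e \<subseteq> {..<n}"
  shows "\<exists>H. finite H \<and> H \<subseteq> L \<and> (\<forall>x\<in>L. \<exists>y\<in>H. exponent_le y x)"
proof (rule ccontr)
  assume no: "\<not> ?thesis"
  have step: "\<exists>x\<in>L. \<forall>y\<in>H. \<not> exponent_le y x" if H: "finite H" "H \<subseteq> L" for H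
  proof (rule ccontr)
    assume "\<not> ?thesis"
    then have "\<forall>x\<in>L. \<exists>y\<in>H. exponent_le y x" by simp
    then have "finite H \<and> H \<subseteq> L \<and> (\<forall>x\<in>L. \<exists>y\<in>H. exponent_le y x)" using H by simp
    then have "\<exists>H. finite H \<and> H \<subseteq> L \<and> (\<forall>x\<in>L. \<exists>y\<in>H. exponent_le y x)" by (rule exI)
    then show False by (rule notE[OF no])
  qed
  have "\<exists>f. \<forall>k. (finite (f k) \<and> f k \<subseteq> L) \<and>
      (\<exists>x\<in>L. f (Suc k) = insert x (f k) \<and> (\<forall>y\<in>f k. \<not> exponent_le y x))"
  proof (rule dependent_nat_choice)
    show "\<exists>H. finite H \<and> H \<subseteq> L" by blast
    show "\<exists>H'. (finite H' \<and> H' \<subseteq> L) \<and> (\<exists>x\<in>L. H' = insert x H \<and> (\<forall>y\<in>H. \<not> exponent_le y x))"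
      if H: "finite H \<and> H \<subseteq> L" for H and k :: nat
    proof -
      obtain x where "x \<in> L" "\<forall>y\<in>H. \<not> exponent_le y x" using step H by blast
      then show ?thesis using H by (intro exI[of _ "insert x H"]) auto
    qed
  qed
  then obtain f where f: "\<And>k. \<exists>x\<in>L. f (Suc k) = insert x (f k) \<and> (\<forall>y\<in>f k. \<not> exponent_le y x)" by blast
  then obtain s where s: "\<And>k. s k \<in> L" "\<And>k. f (Suc k) = insert (s k) (f k)"
    "\<And>k y. y \<in> f k \<Longrightarrow> \<not> exponent_le y (s k)" by metis
  have "incseq f" using s(2) by (auto intro!: incseq_SucI)
  then have "s i \<in> f j" if "i < j" for i j
    using s(2)[of i] that unfolding incseq_def by (metis Suc_leI insertI1 subsetD)
  then have bad: "\<not> exponent_le (s i) (s j)" if "i < j" for i j using s(3) that by blast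
  obtain r1 :: "nat \<Rightarrow> nat" where r1: "strict_mono r1" "incseq (\<lambda>i. fst (s (r1 i)))"
    using nat_incseq_subseq[of "\<lambda>i. fst (s i)"] by blast
  have "set_mset (fst (snd (s (r1 i)))) \<subseteq> {..<m}" for i using L s(1) by (metis prod.collapse)
  then obtain r2 :: "nat \<Rightarrow> nat" where r2: "strict_mono r2"
      "\<And>i j. i \<le> j \<Longrightarrow> fst (snd (s (r1 (r2 i)))) \<subseteq># fst (snd (s (r1 (r2 j))))"
    using multiset_increasing_subseq[of "\<lambda>i. fst (snd (s (r1 i)))"] by blast
  have "set_mset (snd (snd (s (r1 (r2 i))))) \<subseteq> {..<n}" for i using L s(1) by (metis prod.collapse)
  then obtain r3 :: "nat \<Rightarrow> nat" where r3: "strict_mono r3"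
      "\<And>i j. i \<le> j \<Longrightarrow> snd (snd (s (r1 (r2 (r3 i))))) \<subseteq># snd (snd (s (r1 (r2 (r3 j)))))"
    using multiset_increasing_subseq[of "\<lambda>i. snd (snd (s (r1 (r2 i))))"] by blast
  have lt: "r3 0 < r3 1" "r2 (r3 0) < r2 (r3 1)" "r1 (r2 (r3 0)) < r1 (r2 (r3 1))"
    using r1(1) r2(1) r3(1) by (simp_all add: strict_mono_def)
  have "exponent_le (s (r1 (r2 (r3 0)))) (s (r1 (r2 (r3 1))))"
    unfolding exponent_le_def using r1(2) r2(2)[of "r3 0" "r3 1"] r3(2)[of 0 1] lt
    unfolding incseq_def by auto
  then show False using bad lt(3) by blast
qed

section \<open>Powers of ideals\<close>

lemma ideal_power_0: "ideal_power R I 0 = carrier R"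
  by (simp add: nat_pow_def ideals_set_def)

lemma ideal_power_Suc: "ideal_power R I (Suc k) = ideal_prod R (ideal_power R I k) I"
  by (simp add: nat_pow_def ideals_set_def)

lemma ideal_prod_subset:
  assumes "\<And>a b. a \<in> I \<Longrightarrow> b \<in> J \<Longrightarrow> a \<otimes>\<^bsub>R\<^esub> b \<in> K" and "\<And>a b. a \<in> K \<Longrightarrow> b \<in> K \<Longrightarrow> a \<oplus>\<^bsub>R\<^esub> b \<in> K"
  shows "ideal_prod R I J \<subseteq> K"
proof
  fix x assume "x \<in> ideal_prod R I J"
  then show "x \<in> K" by induction (use assms in auto)
qed

section \<open>Complete discrete valuation rings\<close>

locale complete_dvr_with_uniformizer =
  fixes R :: "'r ring" (structure) and \<pi> :: 'r
  assumes complete_dvr: "complete_dvr R" and uniformizer: "uniformizer R \<pi>"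

sublocale complete_dvr_with_uniformizer \<subseteq> principal_domain R
  using complete_dvr by (simp add: complete_dvr_def discrete_valuation_ring_def)

context complete_dvr_with_uniformizer
begin

lemma \<pi>_closed [simp]: "\<pi> \<in> carrier R"
  using uniformizer by (simp add: uniformizer_def)

lemma \<pi>_maximal: "maximalideal (PIdl \<pi>) R"
  using uniformizer by (simp add: uniformizer_def)

lemma maximalideal_eq: "maximalideal M R \<Longrightarrow> M = PIdl \<pi>"
  using complete_dvr \<pi>_maximal unfolding complete_dvr_def discrete_valuation_ring_def by blast

definition V :: "nat \<Rightarrow> 'r set" where
  "V k = {\<pi> [^] k \<otimes> s | s. s \<in> carrier R}"

lemma VI: "s \<in> carrier R \<Longrightarrow> \<pi> [^] k \<otimes> s \<in> V k"
  unfolding V_def by blast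

lemma VE:
  assumes "r \<in> V k"
  obtains s where "s \<in> carrier R" and "r = \<pi> [^] k \<otimes> s"
  using assms unfolding V_def by blast

lemma V_closed: "r \<in> V k \<Longrightarrow> r \<in> carrier R"
  by (auto elim!: VE)

lemma V_0: "V 0 = carrier R"
  unfolding V_def by (auto intro!: exI[of _ "_ :: 'r"])

lemma V_ideal: "ideal (V k) R"
proof (rule ideal_by_closure)
  show "V k \<subseteq> carrier R" using V_closed by blast
  show "\<zero> \<in> V k" using VI[of \<zero> k] by simp
  show "a \<oplus> b \<in> V k" if "a \<in> V k" "b \<in> V k" for a b
  proof -
    obtain s t where "s \<in> carrier R" "a = \<pi> [^] k \<otimes> s" "t \<in> carrier R" "b = \<pi> [^] k \<otimes> t"
      using \<open>a \<in> V k\<close> \<open>b \<in> V k\<close> by (metis VE)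
    then show ?thesis using VI[of "s \<oplus> t" k] by (simp add: r_distr)
  qed
  show "r \<otimes> a \<in> V k" if r: "r \<in> carrier R" and a: "a \<in> V k" for r a
  proof -
    obtain s where "s \<in> carrier R" "a = \<pi> [^] k \<otimes> s" using a by (rule VE)
    then show ?thesis using VI[of "r \<otimes> s" k] r by (simp add: m_lcomm)
  qed
qed

lemmas V_zero = ideal_zero_mem[OF V_ideal]
  and V_add = ideal_add_mem[OF V_ideal]
  and V_minus = ideal_minus_mem[OF V_ideal]

lemma V_mult:
  assumes "a \<in> V i" and "b \<in> V j"
  shows "a \<otimes> b \<in> V (i + j)"
proof -
  obtain s where s: "s \<in> carrier R" "a = \<pi> [^] i \<otimes> s" using assms(1) by (rule VE)
  obtain t where t: "t \<in> carrier R" "b = \<pi> [^] j \<otimes> t" using assms(2) by (rule VE)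
  have "a \<otimes> b = \<pi> [^] (i + j) \<otimes> (s \<otimes> t)"
    using s t by (simp add: m_ac flip: nat_pow_mult)
  then show ?thesis using VI[of "s \<otimes> t"] s t by simp
qed

lemma V_antimono:
  assumes "i \<le> j" and "r \<in> V j"
  shows "r \<in> V i"
proof -
  obtain s where s: "s \<in> carrier R" "r = \<pi> [^] j \<otimes> s" using assms(2) by (rule VE)
  have "r = \<pi> [^] i \<otimes> (\<pi> [^] (j - i) \<otimes> s)"
    using s assms(1) by (simp add: nat_pow_mult flip: m_assoc)
  then show ?thesis using VI[of "\<pi> [^] (j - i) \<otimes> s" i] s by simp
qed

lemma PIdl_\<pi>: "PIdl \<pi> = V 1"
proof -
  have "(\<exists>s. r = s \<otimes> \<pi> \<and> s \<in> carrier R) \<longleftrightarrow> (\<exists>s. r = \<pi> \<otimes> s \<and> s \<in> carrier R)" for r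
    using m_comm[OF _ \<pi>_closed] by metis
  then show ?thesis by (simp add: cgenideal_def V_def)
qed

lemma ideal_power_PIdl_\<pi>: "ideal_power R (PIdl \<pi>) k = V k"
proof (induction k)
  case 0
  show ?case by (simp only: ideal_power_0 V_0)
next
  case (Suc k)
  have "V (Suc k) \<subseteq> ideal_prod R (V k) (V 1)"
  proof
    fix r assume "r \<in> V (Suc k)"
    then obtain s where s: "s \<in> carrier R" "r = \<pi> [^] Suc k \<otimes> s" by (rule VE)
    then have "r = (\<pi> [^] k \<otimes> \<one>) \<otimes> (\<pi> [^] (1::nat) \<otimes> s)" by (simp add: m_assoc)
    then show "r \<in> ideal_prod R (V k) (V 1)"
      using ideal_prod.prod[OF VI[OF one_closed] VI[OF s(1)]] by metis
  qed
  moreover have "ideal_prod R (V k) (V 1) \<subseteq> V (Suc k)"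
    using V_mult[of _ k _ 1] V_add by (intro ideal_prod_subset) auto
  moreover have "ideal_power R (PIdl \<pi>) (Suc k) = ideal_prod R (V k) (V 1)"
    by (subst ideal_power_Suc, subst Suc, subst PIdl_\<pi>) (rule refl)
  ultimately show ?case by blast
qed

lemma \<pi>_adically_complete: "adically_complete R (PIdl \<pi>)"
  using complete_dvr \<pi>_maximal unfolding complete_dvr_def by blast

lemma V_separated: "(\<And>k. r \<in> V k) \<Longrightarrow> r = \<zero>"
  using \<pi>_adically_complete unfolding adically_complete_def ideal_power_PIdl_\<pi> by auto

text \<open>The offset \<open>c\<close> is for the coefficients of \<open>S\<^sup>d\<close> in power series: those of a series of order \<open>i\<close>
  are only divisible by \<open>\<pi>\<^bsup>i - c\<^esup>\<close> with \<open>c = \<bar>d\<bar>\<close>.\<close>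

lemma V_complete:
  assumes x: "\<And>i. x i \<in> carrier R" and cauchy: "\<And>i. x (Suc i) \<ominus> x i \<in> V (i - c)"
  shows "\<exists>l\<in>carrier R. \<forall>i. l \<ominus> x i \<in> V (i - c)"
proof -
  have diff: "x j \<ominus> x i \<in> V (i - c)" if "i \<le> j" for i j
    using that
  proof (induction j rule: dec_induct)
    case base
    have "x i \<ominus> x i = \<zero>" using x[of i] by (simp add: a_minus_def r_neg)
    then show ?case using V_zero by simp
  next
    case (step j)
    have "x (Suc j) \<ominus> x i = (x (Suc j) \<ominus> x j) \<oplus> (x j \<ominus> x i)"
      using x[of i] x[of j] x[of "Suc j"] by algebra
    then show ?case
      using V_add[OF V_antimono[OF _ cauchy[of j]] step.IH] step.hyps by (simp add: diff_le_mono)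
  qed
  have neg: "a \<ominus> b \<in> V k" if "b \<ominus> a \<in> V k" "a \<in> carrier R" "b \<in> carrier R" for a b k
  proof -
    have "a \<ominus> b = \<zero> \<ominus> (b \<ominus> a)" using that(2,3) by algebra
    then show ?thesis using V_minus[OF V_zero that(1)] by simp
  qed
  have "x i \<ominus> x j \<in> V k" if "i \<ge> k + c" "j \<ge> k + c" for i j k
  proof (cases "i \<le> j")
    case True
    then show ?thesis using neg[OF diff[OF True] x x] V_antimono[of k "i - c"] that by auto
  next
    case False
    then show ?thesis using diff[of j i] V_antimono[of k "j - c"] that by auto
  qed
  then have "\<forall>k. \<exists>N. \<forall>i\<ge>N. \<forall>j\<ge>N. x i \<ominus> x j \<in> V k" by metis
  then obtain l where l: "l \<in> carrier R" "\<And>k. \<exists>N. \<forall>i\<ge>N. x i \<ominus> l \<in> V k"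
    using \<pi>_adically_complete x unfolding adically_complete_def ideal_power_PIdl_\<pi> by (metis image_subsetI)
  have "l \<ominus> x i \<in> V (i - c)" for i
  proof -
    obtain N where N: "\<And>j. j \<ge> N \<Longrightarrow> x j \<ominus> l \<in> V (i - c)" using l(2) by metis
    define j where "j = max N i"
    have "l \<ominus> x i = (x j \<ominus> x i) \<ominus> (x j \<ominus> l)"
      using x[of i] x[of j] l(1) by algebra
    then show ?thesis
      using V_minus[OF diff[of i j] N[of j]] by (simp add: j_def)
  qed
  then show ?thesis using l(1) by blast
qed

lemma unit_if_notin_V_1:
  assumes s: "s \<in> carrier R" and "s \<notin> V 1"
  shows "s \<in> Units R"
proof (rule ccontr)
  assume "s \<notin> Units R"
  interpret noetherian_cring R
    by (simp add: noetherian_cring_def noetherian_ring_axioms is_cring)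
  have "\<one> \<notin> PIdl s"
  proof
    assume "\<one> \<in> PIdl s"
    then obtain t where "t \<in> carrier R" "\<one> = t \<otimes> s" unfolding cgenideal_def by blast
    then show False using \<open>s \<notin> Units R\<close> s by (auto simp: Units_def m_comm)
  qed
  then obtain M where "maximalideal M R" "PIdl s \<subseteq> M"
    using exists_maximalideal[OF cgenideal_ideal[OF s]] by blast
  then have "s \<in> PIdl \<pi>" using maximalideal_eq cgenideal_self[OF s] by blast
  then show False using assms(2) by (simp add: PIdl_\<pi>)
qed

lemma unit_if_exact_order:
  assumes "r \<in> V k" and "r \<notin> V (Suc k)"
  obtains u where "u \<in> Units R" and "r = \<pi> [^] k \<otimes> u"
proof -
  obtain s where s: "s \<in> carrier R" "r = \<pi> [^] k \<otimes> s" using assms(1) by (rule VE)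
  have "s \<notin> V 1"
    using V_mult[OF VI[OF one_closed, of k], of s 1] s assms(2) by auto
  then show thesis using that unit_if_notin_V_1 s by blast
qed

end

section \<open>The rings \<open>R[[S]]\<langle>T\<rangle>\<close>\<close>

locale ff_model_over = complete_dvr_with_uniformizer +
  fixes m n :: nat

sublocale ff_model_over \<subseteq> S: power_series_over R m
  by (simp add: power_series_over_def is_cring)

sublocale ff_model_over \<subseteq> T: power_series_over "power_series_ring R m" n
  by (simp add: power_series_over_def S.PS_cring)

context ff_model_over
begin

text \<open>The \<open>k\<close>-th power of the ideal \<open>(\<pi>, S\<^sub>1, \<dots>, S\<^sub>m)\<close>, described by coefficients.\<close>

definition W :: "nat \<Rightarrow> (nat multiset \<Rightarrow> 'a) set" where
  "W k = {f \<in> carrier S.PS. \<forall>d. f d \<in> V (k - size d)}"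

lemma W_closed: "f \<in> W k \<Longrightarrow> f \<in> carrier S.PS"
  and W_coeff: "f \<in> W k \<Longrightarrow> f d \<in> V (k - size d)"
  by (auto simp: W_def)

lemma W_mult:
  assumes f: "f \<in> W i" and g: "g \<in> W j"
  shows "f \<otimes>\<^bsub>S.PS\<^esub> g \<in> W (i + j)"
proof -
  have "(f \<otimes>\<^bsub>S.PS\<^esub> g) e \<in> V (i + j - size e)" for e
    unfolding S.PS_mult
  proof (rule ideal_finsum_mem[OF V_ideal finite_submultisets])
    fix d assume "d \<in> {d. d \<subseteq># e}"
    then have "size e = size d + size (e - d)" by (simp add: size_Diff_submset size_mset_mono)
    then have "i + j - size e \<le> (i - size d) + (j - size (e - d))" by linarith
    then show "f d \<otimes> g (e - d) \<in> V (i + j - size e)"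
      using V_antimono V_mult[OF W_coeff[OF f] W_coeff[OF g]] by blast
  qed
  then show ?thesis using f g by (auto simp: W_def S.PS_mult_closed)
qed

lemma W_0: "W 0 = carrier S.PS"
  by (auto simp: W_def V_0)

lemma W_ideal: "ideal (W k) S.PS"
proof (rule T.ideal_by_closure)
  show "\<zero>\<^bsub>S.PS\<^esub> \<in> W k" using T.zero_closed by (auto simp: W_def S.PS_zero V_zero)
  show "f \<oplus>\<^bsub>S.PS\<^esub> g \<in> W k" if "f \<in> W k" "g \<in> W k" for f g
    using that T.a_closed by (auto simp: W_def S.PS_add V_add)
  show "r \<otimes>\<^bsub>S.PS\<^esub> f \<in> W k" if "r \<in> carrier S.PS" "f \<in> W k" for r f
    using W_mult[of r 0 f k] that by (simp add: W_0)
qed (auto simp: W_def)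

lemmas W_zero = T.ideal_zero_mem[OF W_ideal]
  and W_add = T.ideal_add_mem[OF W_ideal]
  and W_lmult = ideal.I_l_closed[OF W_ideal]
  and W_rmult = ideal.I_r_closed[OF W_ideal]

lemma W_antimono: "i \<le> j \<Longrightarrow> f \<in> W j \<Longrightarrow> f \<in> W i"
  unfolding W_def using V_antimono[OF diff_le_mono] by blast

abbreviation ff :: "(nat multiset \<Rightarrow> 'a) set" where
  "ff \<equiv> ff_ideal R \<pi> m"

lemma ff_generators:
  shows "insert (ps_const R \<pi>) (ps_var R ` {..<m}) \<subseteq> carrier S.PS"
  unfolding ps_const_eq ps_var_eq by (auto intro!: S.monomial_series_closed)

lemma ff_ideal: "ideal ff S.PS"
  unfolding ff_ideal_def by (rule T.genideal_ideal[OF ff_generators])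

lemma ff_mem: "ps_const R \<pi> \<in> ff" "i < m \<Longrightarrow> ps_var R i \<in> ff"
  unfolding ff_ideal_def using T.genideal_self[OF ff_generators] by auto

lemma ff_subset_W_1: "ff \<subseteq> W 1"
  unfolding ff_ideal_def
proof (rule T.genideal_minimal[OF W_ideal])
  have "\<pi> \<in> V 1" using VI[of \<one> 1] by simp
  then show "insert (ps_const R \<pi>) (ps_var R ` {..<m}) \<subseteq> W 1"
    using ff_generators by (auto simp: W_def ps_const_def ps_var_def V_zero V_0)
qed

text \<open>An element of \<open>W (k + 1)\<close> is a constant divisible by \<open>\<pi>\<close> plus, for every variable \<open>S\<^sub>i\<close>, the sum of
  the monomials whose least variable is \<open>S\<^sub>i\<close>; dividing these by \<open>S\<^sub>i\<close> gives an element of \<open>W k\<close>.\<close>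

lemma W_Suc_subset: "W (Suc k) \<subseteq> ideal_prod S.PS (W k) ff"
proof
  fix f assume f: "f \<in> W (Suc k)"
  have fc: "f \<in> carrier S.PS" using W_closed[OF f] .
  have "g \<in> ideal_prod S.PS (W k) ff"
    if "i \<le> m" "g \<in> W (Suc k)" "\<And>d. g d \<noteq> \<zero> \<Longrightarrow> d \<noteq> {#} \<Longrightarrow> Min (set_mset d) < i" for i g
    using that
  proof (induction i arbitrary: g)
    case 0
    have gc: "g \<in> carrier S.PS" using W_closed[OF "0.prems"(2)] .
    obtain s where s: "s \<in> carrier R" "g {#} = \<pi> [^] Suc k \<otimes> s"
      using W_coeff[OF "0.prems"(2), of "{#}"] by (auto elim: VE)
    define h where "h = monomial_series R {#} (\<pi> [^] k \<otimes> s)"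
    have h: "h \<in> W k"
      using s S.monomial_series_closed[of "\<pi> [^] k \<otimes> s" "{#}"] VI[OF s(1), of k]
      by (auto simp: W_def h_def monomial_series_def V_zero)
    have pc: "ps_const R \<pi> \<in> carrier S.PS" using ff_generators by blast
    have "g = ps_const R \<pi> \<otimes>\<^bsub>S.PS\<^esub> h"
    proof
      fix d
      have "g d = (if d = {#} then \<pi> [^] Suc k \<otimes> s else \<zero>)"
        using "0.prems"(3)[of d] s by auto
      also have "\<dots> = \<pi> \<otimes> h d"
        using s by (simp add: h_def monomial_series_def m_ac)
      also have "\<dots> = (ps_const R \<pi> \<otimes>\<^bsub>S.PS\<^esub> h) d"
        unfolding ps_const_eq using S.monomial_series_mult_coeff[of \<pi> h "{#}" d] W_closed[OF h] by simp
      finally show "g d = (ps_const R \<pi> \<otimes>\<^bsub>S.PS\<^esub> h) d" .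
    qed
    also have "\<dots> = h \<otimes>\<^bsub>S.PS\<^esub> ps_const R \<pi>"
      using S.PS_mult_comm[OF pc W_closed[OF h]] .
    finally show ?case using ideal_prod.prod[OF h ff_mem(1)] by simp
  next
    case (Suc i)
    have gc: "g \<in> carrier S.PS" using W_closed[OF Suc.prems(2)] .
    have gV: "g d \<in> V (Suc k - size d)" for d using W_coeff[OF Suc.prems(2)] .
    define g1 where "g1 d = (if d = {#} \<or> Min (set_mset d) < i then g d else \<zero>)" for d
    define h where "h d = (if Min (set_mset (add_mset i d)) = i then g (add_mset i d) else \<zero>)" for d
    have g1c: "g1 \<in> carrier S.PS"
      using S.PS_coeff_closed[OF gc] S.PS_coeff_outside[OF gc] by (intro S.PS_memI) (auto simp: g1_def)
    have g1: "g1 \<in> W (Suc k)" using g1c gV by (auto simp: W_def g1_def V_zero)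
    have hc: "h \<in> carrier S.PS"
      using S.PS_coeff_closed[OF gc] S.PS_coeff_outside[OF gc, of "add_mset i _"]
      by (intro S.PS_memI) (auto simp: h_def)
    have h: "h \<in> W k" using hc gV[of "add_mset i _"] by (auto simp: W_def h_def V_zero)
    have vc: "ps_var R i \<in> carrier S.PS" using ff_generators Suc.prems(1) by auto
    have "g = g1 \<oplus>\<^bsub>S.PS\<^esub> (ps_var R i \<otimes>\<^bsub>S.PS\<^esub> h)"
    proof
      fix d
      have v: "(ps_var R i \<otimes>\<^bsub>S.PS\<^esub> h) d = (if i \<in># d then h (d - {#i#}) else \<zero>)"
        unfolding ps_var_eq using S.monomial_series_mult_coeff[of \<one> h "{#i#}" d] hc by simp
      consider "d = {#} \<or> Min (set_mset d) < i" | "d \<noteq> {#}" "Min (set_mset d) = i"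
        | "d \<noteq> {#}" "Min (set_mset d) > i" by linarith
      then show "g d = (g1 \<oplus>\<^bsub>S.PS\<^esub> (ps_var R i \<otimes>\<^bsub>S.PS\<^esub> h)) d"
      proof cases
        case 1
        then have "(ps_var R i \<otimes>\<^bsub>S.PS\<^esub> h) d = \<zero>" unfolding v h_def by (auto simp: insert_DiffM)
        then show ?thesis using 1 gc by (simp add: S.PS_add g1_def)
      next
        case 2
        then have "i \<in># d" using Min_in[of "set_mset d"] by auto
        then have "(ps_var R i \<otimes>\<^bsub>S.PS\<^esub> h) d = g d" unfolding v h_def using 2 by (auto simp: insert_DiffM)
        then show ?thesis using 2 gc by (simp add: S.PS_add g1_def)
      next
        case 3
        then have "i \<notin># d" using Min_le[of "set_mset d" i] by auto
        moreover have "g d = \<zero>" using Suc.prems(3)[of d] 3 by auto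
        ultimately show ?thesis using 3 gc by (simp add: S.PS_add g1_def v)
      qed
    qed
    moreover have "g1 \<in> ideal_prod S.PS (W k) ff"
    proof (rule Suc.IH[OF _ g1])
      show "Min (set_mset d) < i" if "g1 d \<noteq> \<zero>" "d \<noteq> {#}" for d
        using that by (auto simp: g1_def split: if_splits)
    qed (use Suc.prems(1) in simp)
    moreover have "ps_var R i \<otimes>\<^bsub>S.PS\<^esub> h \<in> ideal_prod S.PS (W k) ff"
      using ideal_prod.prod[OF h ff_mem(2), of i S.PS] Suc.prems(1) S.PS_mult_comm[OF vc hc] by simp
    ultimately show ?case using ideal_prod.sum by metis
  qed
  moreover have "Min (set_mset d) < m" if "f d \<noteq> \<zero>" "d \<noteq> {#}" for d
  proof -
    have "set_mset d \<subseteq> {..<m}" using S.PS_coeff_outside[OF fc, of d] that(1) by blast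
    moreover have "Min (set_mset d) \<in> set_mset d" using that(2) by (intro Min_in) auto
    ultimately show ?thesis by blast
  qed
  ultimately show "f \<in> ideal_prod S.PS (W k) ff" using f by blast
qed

text \<open>This turns convergence of coefficients to \<open>0\<close> into a condition on divisibility by powers of \<open>\<pi>\<close>.\<close>

lemma ideal_power_ff: "ideal_power S.PS ff k = W k"
proof (induction k)
  case 0
  show ?case by (simp only: ideal_power_0 W_0)
next
  case (Suc k)
  have "ideal_prod S.PS (W k) ff \<subseteq> W (Suc k)"
    using W_mult[of _ k _ 1] ff_subset_W_1 W_add by (intro ideal_prod_subset) auto
  moreover have "ideal_power S.PS ff (Suc k) = ideal_prod S.PS (W k) ff"
    by (subst ideal_power_Suc, subst Suc) (rule refl)
  ultimately show ?case using W_Suc_subset by blast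
qed

abbreviation D :: "(nat multiset \<Rightarrow> nat multiset \<Rightarrow> 'a) ring" where
  "D \<equiv> strictly_convergent S.PS ff n"

lemma D_carrier: "carrier D = {f \<in> carrier T.PS. \<forall>k. finite {e. f e \<notin> W k}}"
  by (simp add: strictly_convergent_def ideal_power_ff)

lemma D_ops: "monoid.mult D = monoid.mult T.PS" "ring.add D = ring.add T.PS" "one D = one T.PS" "ring.zero D = ring.zero T.PS"
  by (simp_all add: strictly_convergent_def)

lemma D_PS: "f \<in> carrier D \<Longrightarrow> f \<in> carrier T.PS"
  by (simp add: D_carrier)

lemma D_finite: "f \<in> carrier D \<Longrightarrow> finite {e. f e \<notin> W k}"
  by (simp add: D_carrier)

lemma D_coeff_closed: "f \<in> carrier D \<Longrightarrow> f e d \<in> carrier R"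
  using D_PS T.PS_coeff_closed S.PS_coeff_closed by blast

lemma D_monomial:
  assumes "b \<in> carrier S.PS" and "set_mset e\<^sub>0 \<subseteq> {..<n}"
  shows "monomial_series S.PS e\<^sub>0 b \<in> carrier D"
proof -
  have "finite {e. monomial_series S.PS e\<^sub>0 b e \<notin> W k}" for k
    by (rule finite_subset[of _ "{e\<^sub>0}"]) (auto simp: monomial_series_def W_zero)
  then show ?thesis
    using T.monomial_series_closed[OF assms] by (simp add: D_carrier)
qed

lemma D_cring: "cring D"
proof -
  interpret TP: cring T.PS by (rule T.PS_cring)
  have "subring (carrier D) T.PS"
  proof (rule TP.subringI)
    show "carrier D \<subseteq> carrier T.PS" using D_PS by blast
    show "\<one>\<^bsub>T.PS\<^esub> \<in> carrier D" using D_monomial[of "\<one>\<^bsub>S.PS\<^esub>" "{#}"] by (simp add: T.PS_one)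
    show "\<ominus>\<^bsub>T.PS\<^esub> f \<in> carrier D" if f: "f \<in> carrier D" for f
    proof -
      have "{e. (\<ominus>\<^bsub>T.PS\<^esub> f) e \<notin> W k} \<subseteq> {e. f e \<notin> W k}" for k
        using additive_subgroup.a_inv_closed[OF ideal.axioms(1)[OF W_ideal]]
        by (auto simp: T.PS_neg[OF D_PS[OF f]])
      then have "finite {e. (\<ominus>\<^bsub>T.PS\<^esub> f) e \<notin> W k}" for k
        using finite_subset[OF _ D_finite[OF f]] by blast
      then show ?thesis
        using TP.a_inv_closed[OF D_PS[OF f]] by (simp add: D_carrier)
    qed
    fix f g assume f: "f \<in> carrier D" and g: "g \<in> carrier D"
    have "{e. (f \<oplus>\<^bsub>T.PS\<^esub> g) e \<notin> W k} \<subseteq> {e. f e \<notin> W k} \<union> {e. g e \<notin> W k}" for k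
      using W_add by (auto simp: T.PS_add)
    then have "finite {e. (f \<oplus>\<^bsub>T.PS\<^esub> g) e \<notin> W k}" for k
      using finite_subset D_finite[OF f] D_finite[OF g] by (meson finite_UnI)
    then show "f \<oplus>\<^bsub>T.PS\<^esub> g \<in> carrier D"
      using TP.a_closed[OF D_PS[OF f] D_PS[OF g]] by (simp add: D_carrier)
    \<comment> \<open>A coefficient of the product outside \<open>W k\<close> needs a decomposition \<open>e = a + b\<close> for which
      neither \<open>f a\<close> nor \<open>g b\<close> lies in \<open>W k\<close>.\<close>
    have "finite {e. (f \<otimes>\<^bsub>T.PS\<^esub> g) e \<notin> W k}" for k
    proof (rule finite_subset)
      show "finite ((\<lambda>(a, b). a + b) ` ({e. f e \<notin> W k} \<times> {e. g e \<notin> W k}))"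
        using D_finite[OF f] D_finite[OF g] by blast
      show "{e. (f \<otimes>\<^bsub>T.PS\<^esub> g) e \<notin> W k} \<subseteq> (\<lambda>(a, b). a + b) ` ({e. f e \<notin> W k} \<times> {e. g e \<notin> W k})"
      proof (rule subsetI, rule ccontr)
        fix e
        assume e: "e \<in> {e. (f \<otimes>\<^bsub>T.PS\<^esub> g) e \<notin> W k}"
          and not: "e \<notin> (\<lambda>(a, b). a + b) ` ({e. f e \<notin> W k} \<times> {e. g e \<notin> W k})"
        have fg: "f d \<in> carrier S.PS" "g d \<in> carrier S.PS" for d
          using T.PS_coeff_closed D_PS f g by auto
        have terms: "f d \<otimes>\<^bsub>S.PS\<^esub> g (e - d) \<in> W k" if "d \<subseteq># e" for d
        proof -
          have "d + (e - d) = e" using that by simp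
          then have "f d \<in> W k \<or> g (e - d) \<in> W k" using not by force
          then show ?thesis using W_lmult W_rmult fg by blast
        qed
        have "(\<Oplus>\<^bsub>S.PS\<^esub>d\<in>{d. d \<subseteq># e}. f d \<otimes>\<^bsub>S.PS\<^esub> g (e - d)) \<in> W k"
          using terms by (intro T.ideal_finsum_mem[OF W_ideal finite_submultisets]) auto
        then show False using e unfolding T.PS_mult by blast
      qed
    qed
    then show "f \<otimes>\<^bsub>T.PS\<^esub> g \<in> carrier D"
      using T.PS_mult_closed[OF D_PS[OF f] D_PS[OF g]] by (simp add: D_carrier)
  qed
  then have "cring (T.PS\<lparr>carrier := carrier D\<rparr>)"
    using TP.subcringI' TP.subcring_iff D_PS by blast
  moreover have "T.PS\<lparr>carrier := carrier D\<rparr> = D"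
    by (simp add: strictly_convergent_def)
  ultimately show ?thesis by simp
qed

end

sublocale ff_model_over \<subseteq> D: cring "strictly_convergent (power_series_ring R m) (ff_ideal R \<pi> m) n"
  by (rule D_cring)

context ff_model_over
begin

lemma D_minus:
  assumes f: "f \<in> carrier D" and g: "g \<in> carrier D"
  shows "f \<ominus>\<^bsub>D\<^esub> g = (\<lambda>e d. f e d \<ominus> g e d)"
proof -
  define h where "h = f \<ominus>\<^bsub>D\<^esub> g"
  have h: "h \<in> carrier D" using f g by (simp add: h_def)
  have "f = h \<oplus>\<^bsub>D\<^esub> g" using f g unfolding h_def by (metis D.add.inv_solve_right a_minus_def D.minus_closed)
  then have "f e d = h e d \<oplus> g e d" for e d by (simp add: D_ops T.PS_add S.PS_add)
  then have "h e d = f e d \<ominus> g e d" for e d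
    using D_coeff_closed[OF h] D_coeff_closed[OF g]
    by (simp add: a_minus_def add.inv_solve_right)
  then show ?thesis unfolding h_def by blast
qed

definition F :: "nat \<Rightarrow> (nat multiset \<Rightarrow> nat multiset \<Rightarrow> 'a) set" where
  "F k = {f \<in> carrier D. \<forall>e. f e \<in> W k}"

lemma F_D: "f \<in> F k \<Longrightarrow> f \<in> carrier D"
  and F_coeff: "f \<in> F k \<Longrightarrow> f e \<in> W k"
  by (auto simp: F_def)

lemma W_memI: "g \<in> carrier S.PS \<Longrightarrow> (\<And>d. g d \<in> V (k - size d)) \<Longrightarrow> g \<in> W k"
  by (simp add: W_def)

lemma F_memI:
  assumes "f \<in> carrier D" and "\<And>e d. f e d \<in> V (k - size d)"
  shows "f \<in> F k"
  using assms T.PS_coeff_closed[OF D_PS[OF assms(1)]] by (auto simp: F_def intro: W_memI)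

lemma F_V: "f \<in> F k \<Longrightarrow> f e d \<in> V (k - size d)"
  using F_coeff W_coeff by blast

lemma F_mult:
  assumes f: "f \<in> F i" and g: "g \<in> F j"
  shows "f \<otimes>\<^bsub>D\<^esub> g \<in> F (i + j)"
proof -
  have "(f \<otimes>\<^bsub>D\<^esub> g) e \<in> W (i + j)" for e
    unfolding D_ops T.PS_mult
    using W_mult[OF F_coeff[OF f] F_coeff[OF g]]
    by (rule T.ideal_finsum_mem[OF W_ideal finite_submultisets])
  then show ?thesis using D.m_closed[OF F_D[OF f] F_D[OF g]] by (simp add: F_def)
qed

lemma F_0: "F 0 = carrier D"
  using T.PS_coeff_closed D_PS by (auto simp: F_def W_0)

lemma F_ideal: "ideal (F k) D"
proof (rule D.ideal_by_closure)
  show "F k \<subseteq> carrier D" using F_D by blast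
  show "\<zero>\<^bsub>D\<^esub> \<in> F k"
    using D.zero_closed by (auto simp: F_def D_ops T.PS_zero W_zero)
  show "f \<oplus>\<^bsub>D\<^esub> g \<in> F k" if "f \<in> F k" "g \<in> F k" for f g
    using that D.a_closed by (auto simp: F_def D_ops T.PS_add W_add)
  show "r \<otimes>\<^bsub>D\<^esub> f \<in> F k" if "r \<in> carrier D" "f \<in> F k" for r f
    using F_mult[of r 0 f k] that by (simp add: F_0)
qed

text \<open>Limits are taken coefficientwise in \<open>R\<close>. That the coefficients \<open>l e\<close> tend to \<open>0\<close> follows since
  \<open>l\<close> agrees with \<open>s k\<close> up to order \<open>k\<close>.\<close>

lemma F_complete:
  assumes s: "\<And>k. s k \<in> carrier D" and step: "\<And>k. s (Suc k) \<ominus>\<^bsub>D\<^esub> s k \<in> F k"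
  shows "\<exists>l\<in>carrier D. \<forall>k. l \<ominus>\<^bsub>D\<^esub> s k \<in> F k"
proof -
  have sR: "s k e d \<in> carrier R" for k e d using D_coeff_closed[OF s] .
  have "\<exists>l\<in>carrier R. (\<forall>k. l \<ominus> s k e d \<in> V (k - size d)) \<and>
      (\<not> (set_mset e \<subseteq> {..<n} \<and> set_mset d \<subseteq> {..<m}) \<longrightarrow> l = \<zero>)" for e d
  proof (cases "set_mset e \<subseteq> {..<n} \<and> set_mset d \<subseteq> {..<m}")
    case True
    have "s (Suc k) e d \<ominus> s k e d \<in> V (k - size d)" for k
      using F_V[OF step[of k], of e d] by (simp add: D_minus[OF s s])
    then show ?thesis
      using V_complete[of "\<lambda>k. s k e d" "size d"] sR True by auto
  next
    case False
    have "s k e d = \<zero>" for k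
    proof (cases "set_mset e \<subseteq> {..<n}")
      case True
      then show ?thesis
        using False S.PS_coeff_outside[OF T.PS_coeff_closed[OF D_PS[OF s]]] by blast
    next
      case False
      then show ?thesis using T.PS_coeff_outside[OF D_PS[OF s]] by (simp add: S.PS_zero)
    qed
    then show ?thesis using V_zero by (intro bexI[of _ \<zero>]) (auto simp: a_minus_def)
  qed
  then obtain l where l: "\<And>e d. l e d \<in> carrier R" "\<And>k e d. l e d \<ominus> s k e d \<in> V (k - size d)"
    "\<And>e d. \<not> (set_mset e \<subseteq> {..<n} \<and> set_mset d \<subseteq> {..<m}) \<Longrightarrow> l e d = \<zero>"
    by metis
  have lS: "l e \<in> carrier S.PS" for e
    using l(1,3) by (intro S.PS_memI) auto
  have lT: "l \<in> carrier T.PS"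
  proof (rule T.PS_memI)
    show "l e = \<zero>\<^bsub>S.PS\<^esub>" if "\<not> set_mset e \<subseteq> {..<n}" for e
      using l(3)[of e] that by (auto simp: S.PS_zero)
  qed (rule lS)
  have sub: "{e. l e \<notin> W k} \<subseteq> {e. s k e \<notin> W k}" for k
  proof (rule subsetI, rule ccontr)
    fix e assume e: "e \<in> {e. l e \<notin> W k}" "e \<notin> {e. s k e \<notin> W k}"
    have "l e d \<in> V (k - size d)" for d
    proof -
      have "l e d = (l e d \<ominus> s k e d) \<oplus> s k e d" using l(1)[of e d] sR[of k e d] by algebra
      moreover have "s k e d \<in> V (k - size d)" using W_coeff e(2) by blast
      ultimately show ?thesis using V_add[OF l(2)[of e d k]] by metis
    qed
    then show False using e(1) W_memI[OF lS] by blast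
  qed
  have "finite {e. l e \<notin> W k}" for k
    by (rule finite_subset[OF sub D_finite[OF s]])
  then have "l \<in> carrier D"
    using lT by (simp add: D_carrier)
  moreover have "l \<ominus>\<^bsub>D\<^esub> s k \<in> F k" for k
  proof (rule F_memI)
    show "l \<ominus>\<^bsub>D\<^esub> s k \<in> carrier D" using \<open>l \<in> carrier D\<close> s by simp
    show "(l \<ominus>\<^bsub>D\<^esub> s k) e d \<in> V (k - size d)" for e d
      using l(2) by (simp add: D_minus[OF \<open>l \<in> carrier D\<close> s])
  qed
  ultimately show ?thesis by blast
qed

lemma D_complete_filtered: "complete_filtered_ring D F"
proof (intro complete_filtered_ring.intro complete_filtered_ring_axioms.intro)
  show "cring D" by (rule D_cring)
  show "decseq F"
    using W_antimono by (auto simp: decseq_def F_def)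
  show "a = \<zero>\<^bsub>D\<^esub>" if "\<And>k. a \<in> F k" for a
  proof (intro ext)
    fix e d
    have "a e d \<in> V k" for k
      using F_V[OF that[of "k + size d"], of e d] by simp
    then show "a e d = \<zero>\<^bsub>D\<^esub> e d" using V_separated by (simp add: D_ops T.PS_zero S.PS_zero)
  qed
qed (rule F_ideal F_0 F_mult F_complete; assumption)+

end

sublocale ff_model_over \<subseteq>
  D: complete_filtered_ring "strictly_convergent (power_series_ring R m) (ff_ideal R \<pi> m) n" F
  by (rule D_complete_filtered)

subsection \<open>Standard bases\<close>

context ff_model_over
begin

text \<open>For \<open>f\<close> of order at least \<open>k\<close>, these are the exponents of the terms of order exactly \<open>k\<close>; the
  exponent of \<open>\<pi>\<close> in such a term is \<open>k - \<bar>d\<bar>\<close>. For \<open>\<bar>d\<bar> > k\<close> the subtraction yields \<open>0\<close> and the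
  condition fails, as it should.\<close>

definition order_support ::
    "nat \<Rightarrow> (nat multiset \<Rightarrow> nat multiset \<Rightarrow> 'a) \<Rightarrow> (nat multiset \<times> nat multiset) set" where
  "order_support k f = {(e, d). f e d \<notin> V (Suc k - size d)}"

lemma order_support_size:
  assumes "f \<in> carrier D" and "(e, d) \<in> order_support k f"
  shows "size d \<le> k"
proof (rule ccontr)
  assume "\<not> size d \<le> k"
  then show False
    using assms(2) D_coeff_closed[OF assms(1)] by (simp add: order_support_def V_0)
qed

lemma order_support_variables:
  assumes "f \<in> carrier D" and "(e, d) \<in> order_support k f"
  shows "set_mset e \<subseteq> {..<n}" and "set_mset d \<subseteq> {..<m}"
proof -
  have "f e d \<noteq> \<zero>" using assms(2) V_zero by (auto simp: order_support_def)
  then show "set_mset e \<subseteq> {..<n}" "set_mset d \<subseteq> {..<m}"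
    using T.PS_coeff_outside[OF D_PS[OF assms(1)]] S.PS_coeff_outside[OF T.PS_coeff_closed[OF D_PS[OF assms(1)]]]
    by (metis S.PS_zero)+
qed

lemma order_support_finite:
  assumes f: "f \<in> carrier D"
  shows "finite (order_support k f)"
proof (rule finite_subset)
  show "finite ({e. f e \<notin> W (Suc k)} \<times> {d. set_mset d \<subseteq> {..<m} \<and> size d \<le> k})"
    using D_finite[OF f] finite_multisets_le_size by blast
  show "order_support k f \<subseteq> {e. f e \<notin> W (Suc k)} \<times> {d. set_mset d \<subseteq> {..<m} \<and> size d \<le> k}"
    using order_support_size[OF f] order_support_variables(2)[OF f] W_coeff
    by (fastforce simp: order_support_def)
qed

lemma F_Suc_if_order_support_empty:
  assumes "f \<in> carrier D" and "order_support k f = {}"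
  shows "f \<in> F (Suc k)"
  using assms by (intro F_memI) (auto simp: order_support_def)

text \<open>The order on exponents is lexicographic, with the multiset order on both components. It is a
  well-order compatible with addition, that is, a monomial order.\<close>

definition leads :: "nat \<Rightarrow> (nat multiset \<Rightarrow> nat multiset \<Rightarrow> 'a) \<Rightarrow> nat multiset \<times> nat multiset \<Rightarrow> bool" where
  "leads k f x \<longleftrightarrow> f \<in> F k \<and> x \<in> order_support k f \<and> (\<forall>y\<in>order_support k f. y \<le> x)"

definition series_term :: "'a \<Rightarrow> nat multiset \<Rightarrow> nat multiset \<Rightarrow> nat multiset \<Rightarrow> nat multiset \<Rightarrow> 'a" where
  "series_term c e\<^sub>0 d\<^sub>0 = monomial_series S.PS e\<^sub>0 (monomial_series R d\<^sub>0 c)"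

lemma series_term_closed:
  assumes "c \<in> carrier R" and "set_mset e\<^sub>0 \<subseteq> {..<n}" and "set_mset d\<^sub>0 \<subseteq> {..<m}"
  shows "series_term c e\<^sub>0 d\<^sub>0 \<in> carrier D"
  unfolding series_term_def using assms by (intro D_monomial S.monomial_series_closed)

lemma series_term_mult_coeff:
  assumes c: "c \<in> carrier R" and d: "set_mset d\<^sub>0 \<subseteq> {..<m}" and g: "g \<in> carrier D"
  shows "(series_term c e\<^sub>0 d\<^sub>0 \<otimes>\<^bsub>D\<^esub> g) e d =
    (if e\<^sub>0 \<subseteq># e \<and> d\<^sub>0 \<subseteq># d then c \<otimes> g (e - e\<^sub>0) (d - d\<^sub>0) else \<zero>)"
proof -
  have "(series_term c e\<^sub>0 d\<^sub>0 \<otimes>\<^bsub>D\<^esub> g) e =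
      (if e\<^sub>0 \<subseteq># e then monomial_series R d\<^sub>0 c \<otimes>\<^bsub>S.PS\<^esub> g (e - e\<^sub>0) else \<zero>\<^bsub>S.PS\<^esub>)"
    unfolding D_ops series_term_def
    using T.monomial_series_mult_coeff[OF S.monomial_series_closed[OF c d] D_PS[OF g]] .
  then show ?thesis
    using S.monomial_series_mult_coeff[OF c T.PS_coeff_closed[OF D_PS[OF g]]]
    by (auto simp: S.PS_zero)
qed

text \<open>The coefficient of \<open>g\<close> at its leading exponent is a power of \<open>\<pi>\<close> times a unit \<open>t\<close>, so a suitable
  multiple \<open>c\<close> of \<open>\<pi>\<^sup>a S\<^bsup>d - d'\<^esup> T\<^bsup>e - e'\<^esup>\<close> cancels the leading term of \<open>f\<close> exactly. All other
  terms of order \<open>k\<close> in \<open>c g\<close> are smaller, because multiplication by \<open>c\<close> shifts exponents.\<close>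

lemma cancel_leading_term:
  assumes f: "leads k f (e, d)" and g: "leads j g (e', d')"
    and dvd: "e' \<subseteq># e" "d' \<subseteq># d" "j - size d' \<le> k - size d"
  shows "\<exists>c\<in>F (k - j). f \<ominus>\<^bsub>D\<^esub> c \<otimes>\<^bsub>D\<^esub> g \<in> F k \<and> (\<forall>y\<in>order_support k (f \<ominus>\<^bsub>D\<^esub> c \<otimes>\<^bsub>D\<^esub> g). y < (e, d))"
proof -
  have fF: "f \<in> F k" and fs: "(e, d) \<in> order_support k f" and fmax: "\<And>y. y \<in> order_support k f \<Longrightarrow> y \<le> (e, d)"
    and gF: "g \<in> F j" and gs: "(e', d') \<in> order_support j g" and gmax: "\<And>y. y \<in> order_support j g \<Longrightarrow> y \<le> (e', d')"
    using f g by (auto simp: leads_def)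
  note fD = F_D[OF fF] and gD = F_D[OF gF]
  have dk: "size d \<le> k" "size d' \<le> j" using order_support_size fs gs fD gD by auto
  define a where "a = (k - size d) - (j - size d')"
  obtain s where s: "s \<in> carrier R" "f e d = \<pi> [^] (k - size d) \<otimes> s"
    using F_V[OF fF] by (rule VE)
  have "g e' d' \<notin> V (Suc (j - size d'))"
    using gs dk by (simp add: order_support_def Suc_diff_le)
  then obtain t where t: "t \<in> Units R" "g e' d' = \<pi> [^] (j - size d') \<otimes> t"
    using unit_if_exact_order[OF F_V[OF gF]] by blast
  define u where "u = \<pi> [^] a \<otimes> (s \<otimes> inv t)"
  have u: "u \<in> V a" "u \<in> carrier R" using s t by (auto simp: u_def intro!: VI)
  have sz: "size (d - d') = size d - size d'" "size d' \<le> size d"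
    using dvd(2) by (simp_all add: size_Diff_submset size_mset_mono)
  define c where "c = series_term u (e - e') (d - d')"
  have vars: "set_mset (e - e') \<subseteq> {..<n}" "set_mset (d - d') \<subseteq> {..<m}"
    using order_support_variables[OF fD fs] by (auto dest: in_diffD)
  have cD: "c \<in> carrier D" unfolding c_def by (rule series_term_closed[OF u(2) vars])
  have "k - j - size (d - d') \<le> a" using sz dk dvd(3) unfolding a_def by linarith
  then have cF: "c \<in> F (k - j)"
    using u V_antimono[OF _ u(1)] cD unfolding c_def series_term_def monomial_series_def
    by (intro F_memI) (auto simp: V_zero S.PS_zero)
  note coeff = series_term_mult_coeff[OF u(2) vars(2) gD, of "e - e'", folded c_def]
  have cgD: "c \<otimes>\<^bsub>D\<^esub> g \<in> carrier D" using cD gD by simp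
  have cgF: "c \<otimes>\<^bsub>D\<^esub> g \<in> F k"
    by (rule D.F_antimono[OF _ F_mult[OF cF gF]]) simp
  have fcg: "(f \<ominus>\<^bsub>D\<^esub> c \<otimes>\<^bsub>D\<^esub> g) e'' d'' = f e'' d'' \<ominus> (c \<otimes>\<^bsub>D\<^esub> g) e'' d''" for e'' d''
    by (simp add: D_minus[OF fD cgD])
  have "y < (e, d)" if y: "y \<in> order_support k (f \<ominus>\<^bsub>D\<^esub> c \<otimes>\<^bsub>D\<^esub> g)" for y
  proof -
    obtain e'' d'' where yy: "y = (e'', d'')" by (cases y)
    have nV: "f e'' d'' \<ominus> (c \<otimes>\<^bsub>D\<^esub> g) e'' d'' \<notin> V (Suc k - size d'')"
      using y yy fcg by (simp add: order_support_def)
    have "(c \<otimes>\<^bsub>D\<^esub> g) e d = u \<otimes> g e' d'"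
      using dvd by (simp add: coeff diff_diff_submultiset)
    also have "\<dots> = (\<pi> [^] a \<otimes> \<pi> [^] (j - size d')) \<otimes> (s \<otimes> (inv t \<otimes> t))"
    proof -
      have "(p \<otimes> (s \<otimes> v)) \<otimes> (p' \<otimes> w) = (p \<otimes> p') \<otimes> (s \<otimes> (v \<otimes> w))"
        if "p \<in> carrier R" "p' \<in> carrier R" "v \<in> carrier R" "w \<in> carrier R" for p p' v w
        using that s(1) by (simp add: m_ac)
      from this[of "\<pi> [^] a" "\<pi> [^] (j - size d')" "inv t" t] show ?thesis
        using t Units_closed[OF t(1)] by (simp add: u_def)
    qed
    also have "\<dots> = f e d"
    proof -
      have "a + (j - size d') = k - size d" using dvd(3) by (simp add: a_def)
      then show ?thesis using s t by (simp add: nat_pow_mult)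
    qed
    finally have "y \<noteq> (e, d)"
      using nV yy V_zero D_coeff_closed[OF fD] by (auto simp: a_minus_def r_neg)
    moreover have "y \<le> (e, d)"
    proof (cases "y \<in> order_support k f")
      case True
      then show ?thesis using fmax by blast
    next
      case False
      then have "(c \<otimes>\<^bsub>D\<^esub> g) e'' d'' \<notin> V (Suc k - size d'')"
        using nV V_minus yy by (auto simp: order_support_def)
      then have sub: "e - e' \<subseteq># e''" "d - d' \<subseteq># d''"
        and nV': "u \<otimes> g (e'' - (e - e')) (d'' - (d - d')) \<notin> V (Suc k - size d'')"
        using V_zero by (auto simp: coeff split: if_splits)
      have "size (d'' - (d - d')) = size d'' - size (d - d')" "size (d - d') \<le> size d''"
        using sub(2) by (simp_all add: size_Diff_submset size_mset_mono)
      then have "Suc k - size d'' \<le> a + (Suc j - size (d'' - (d - d')))"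
        using sz dk dvd(3) unfolding a_def by linarith
      then have "g (e'' - (e - e')) (d'' - (d - d')) \<notin> V (Suc j - size (d'' - (d - d')))"
        using nV' V_antimono V_mult[OF u(1)] by blast
      then have "(e'' - (e - e'), d'' - (d - d')) \<le> (e', d')"
        by (intro gmax) (simp add: order_support_def)
      then have "((e'' - (e - e')) + (e - e'), (d'' - (d - d')) + (d - d')) \<le> (e' + (e - e'), d' + (d - d'))"
        by (auto simp: less_eq_prod_def)
      then show ?thesis using sub dvd yy by simp
    qed
    ultimately show ?thesis by simp
  qed
  moreover have "f \<ominus>\<^bsub>D\<^esub> c \<otimes>\<^bsub>D\<^esub> g \<in> F k"
    using D.ideal_minus_mem[OF F_ideal fF cgF] .
  ultimately show ?thesis using cF by blast
qed

text \<open>Cancelling leading terms of order \<open>k\<close> makes the leading exponent decrease, so by well-founded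
  induction no term of order \<open>k\<close> is left in the end.\<close>

lemma approximation_by_standard_basis:
  assumes J: "ideal J D" and G: "finite G" "G \<subseteq> J" and "f \<in> J" and "f \<in> F k"
    and basis: "\<And>k f e d. f \<in> J \<Longrightarrow> leads k f (e, d) \<Longrightarrow>
      \<exists>g\<in>G. \<exists>j\<le>k\<^sub>0. \<exists>e' d'. leads j g (e', d') \<and> e' \<subseteq># e \<and> d' \<subseteq># d \<and> j - size d' \<le> k - size d"
  shows "\<exists>q\<in>G \<rightarrow> F (k - k\<^sub>0). f \<ominus>\<^bsub>D\<^esub> (\<Oplus>\<^bsub>D\<^esub>g\<in>G. q g \<otimes>\<^bsub>D\<^esub> g) \<in> F (Suc k)"
proof -
  have Gc: "G \<subseteq> carrier D" using G(2) D.ideal_subset_carrier[OF J] by blast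
  have comb_closed: "(\<Oplus>\<^bsub>D\<^esub>g\<in>G. q g \<otimes>\<^bsub>D\<^esub> g) \<in> carrier D" if "q \<in> G \<rightarrow> carrier D" for q
    using that Gc by (intro D.finsum_closed) auto
  have done_if_empty: "\<exists>q\<in>G \<rightarrow> F (k - k\<^sub>0). f \<ominus>\<^bsub>D\<^esub> (\<Oplus>\<^bsub>D\<^esub>g\<in>G. q g \<otimes>\<^bsub>D\<^esub> g) \<in> F (Suc k)"
    if fD: "f \<in> carrier D" and "order_support k f = {}" for f
  proof -
    have "(\<Oplus>\<^bsub>D\<^esub>g\<in>G. \<zero>\<^bsub>D\<^esub> \<otimes>\<^bsub>D\<^esub> g) = \<zero>\<^bsub>D\<^esub>"
      using Gc by (intro D.add.finprod_one_eqI) auto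
    then have "f \<ominus>\<^bsub>D\<^esub> (\<Oplus>\<^bsub>D\<^esub>g\<in>G. \<zero>\<^bsub>D\<^esub> \<otimes>\<^bsub>D\<^esub> g) = f"
      using fD by (simp add: a_minus_def)
    then show ?thesis
      using F_Suc_if_order_support_empty[OF that] D.ideal_zero_mem[OF F_ideal]
      by (intro bexI[of _ "\<lambda>_. \<zero>\<^bsub>D\<^esub>"]) auto
  qed
  have "\<exists>q\<in>G \<rightarrow> F (k - k\<^sub>0). f \<ominus>\<^bsub>D\<^esub> (\<Oplus>\<^bsub>D\<^esub>g\<in>G. q g \<otimes>\<^bsub>D\<^esub> g) \<in> F (Suc k)"
    if "f \<in> J" "f \<in> F k" "\<forall>y\<in>order_support k f. y \<le> x" for f x
    using that
  proof (induction x arbitrary: f rule: less_induct)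
    case (less x)
    have fD: "f \<in> carrier D" using F_D[OF less.prems(2)] .
    show ?case
    proof (cases "order_support k f = {}")
      case True
      then show ?thesis using done_if_empty[OF fD] by blast
    next
      case False
      define z where "z = Max (order_support k f)"
      obtain e d where ed: "z = (e, d)" by (cases z)
      have z: "z \<in> order_support k f" "\<forall>y\<in>order_support k f. y \<le> z"
        using False order_support_finite[OF fD] by (auto simp: z_def)
      then have lf: "leads k f (e, d)" using less.prems(2) ed by (simp add: leads_def)
      obtain g j e' d' where g: "g \<in> G" "j \<le> k\<^sub>0" "leads j g (e', d')" "e' \<subseteq># e" "d' \<subseteq># d"
        "j - size d' \<le> k - size d"
        using basis[OF less.prems(1) lf] by blast
      then obtain c where c: "c \<in> F (k - j)" "f \<ominus>\<^bsub>D\<^esub> c \<otimes>\<^bsub>D\<^esub> g \<in> F k"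
        "\<forall>y\<in>order_support k (f \<ominus>\<^bsub>D\<^esub> c \<otimes>\<^bsub>D\<^esub> g). y < (e, d)"
        using cancel_leading_term[OF lf g(3-6)] by blast
      define f' where "f' = f \<ominus>\<^bsub>D\<^esub> c \<otimes>\<^bsub>D\<^esub> g"
      have cD: "c \<in> carrier D" and gD: "g \<in> carrier D" using F_D[OF c(1)] Gc g(1) by auto
      have f'J: "f' \<in> J"
        unfolding f'_def using D.ideal_minus_mem[OF J less.prems(1)] ideal.I_l_closed[OF J _ cD] G(2) g(1) by blast
      have f'D: "f' \<in> carrier D" using D.ideal_subset_carrier[OF J] f'J by blast
      have "\<exists>q\<in>G \<rightarrow> F (k - k\<^sub>0). f' \<ominus>\<^bsub>D\<^esub> (\<Oplus>\<^bsub>D\<^esub>g\<in>G. q g \<otimes>\<^bsub>D\<^esub> g) \<in> F (Suc k)"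
      proof (cases "order_support k f' = {}")
        case True
        then show ?thesis using done_if_empty[OF f'D] by blast
      next
        case False
        define x' where "x' = Max (order_support k f')"
        have x': "x' \<in> order_support k f'" "\<forall>y\<in>order_support k f'. y \<le> x'"
          using False order_support_finite[OF f'D] by (auto simp: x'_def)
        have "x' < x" using x'(1) c(3) z(1) ed less.prems(3) unfolding f'_def by (meson order.strict_trans2)
        then show ?thesis using less.IH f'J c(2) x'(2) unfolding f'_def by blast
      qed
      then obtain q where q: "q \<in> G \<rightarrow> F (k - k\<^sub>0)" "f' \<ominus>\<^bsub>D\<^esub> (\<Oplus>\<^bsub>D\<^esub>g\<in>G. q g \<otimes>\<^bsub>D\<^esub> g) \<in> F (Suc k)"
        by blast
      define r where "r h = (if h = g then c else \<zero>\<^bsub>D\<^esub>)" for h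
      have cF: "c \<in> F (k - k\<^sub>0)" using D.F_antimono[OF _ c(1)] g(2) by simp
      have qD: "q \<in> G \<rightarrow> carrier D" using q(1) F_D by blast
      have rD: "r \<in> G \<rightarrow> carrier D" using cD by (auto simp: r_def)
      have "(\<Oplus>\<^bsub>D\<^esub>h\<in>G. r h \<otimes>\<^bsub>D\<^esub> h) = r g \<otimes>\<^bsub>D\<^esub> g"
        using G(1) g(1) cD Gc by (intro D.finsum_nonzero_singleton) (auto simp: r_def)
      then have rg: "(\<Oplus>\<^bsub>D\<^esub>h\<in>G. r h \<otimes>\<^bsub>D\<^esub> h) = c \<otimes>\<^bsub>D\<^esub> g" by (simp add: r_def)
      have minus_add: "a \<ominus>\<^bsub>D\<^esub> (b \<oplus>\<^bsub>D\<^esub> c) = a \<ominus>\<^bsub>D\<^esub> c \<ominus>\<^bsub>D\<^esub> b"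
        if "a \<in> carrier D" "b \<in> carrier D" "c \<in> carrier D" for a b c
        using that by (simp add: a_minus_def D.minus_add D.a_ac)
      have "f \<ominus>\<^bsub>D\<^esub> (\<Oplus>\<^bsub>D\<^esub>h\<in>G. (q h \<oplus>\<^bsub>D\<^esub> r h) \<otimes>\<^bsub>D\<^esub> h) = f' \<ominus>\<^bsub>D\<^esub> (\<Oplus>\<^bsub>D\<^esub>g\<in>G. q g \<otimes>\<^bsub>D\<^esub> g)"
        unfolding D.combination_add[OF Gc qD rD] rg f'_def
        using minus_add[OF fD comb_closed[OF qD]] cD gD by simp
      moreover have "(\<lambda>h. q h \<oplus>\<^bsub>D\<^esub> r h) \<in> G \<rightarrow> F (k - k\<^sub>0)"
        using q(1) cF by (auto simp: r_def intro!: D.ideal_add_mem[OF F_ideal] D.ideal_zero_mem[OF F_ideal])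
      ultimately show ?thesis using q(2) by (intro bexI[of _ "\<lambda>h. q h \<oplus>\<^bsub>D\<^esub> r h"]) auto
    qed
  qed
  moreover have "\<exists>x. \<forall>y\<in>order_support k f. y \<le> x"
    using order_support_finite[OF F_D[OF assms(5)]] by (meson Max_ge)
  ultimately show ?thesis using assms(4,5) by blast
qed

text \<open>The elements \<open>\<gamma> y\<close>, of order \<open>\<kappa> y\<close>, have as leading terms the minimal ones provided by Dickson's
  lemma. As they are finitely many, their orders have a bound \<open>k\<^sub>0\<close>.\<close>

theorem D_noetherian: "noetherian_ring D"
proof (rule D.noetherian_ringI)
  fix J assume J: "ideal J D"
  define L where "L = {(k - size d, d, e) | k d e. \<exists>f\<in>J. leads k f (e, d)}"
  have "set_mset d \<subseteq> {..<m} \<and> set_mset e \<subseteq> {..<n}" if "(a, d, e) \<in> L" for a d e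
    using that order_support_variables F_D by (auto simp: L_def leads_def) blast+
  then obtain H where H: "finite H" "H \<subseteq> L" "\<forall>x\<in>L. \<exists>y\<in>H. exponent_le y x"
    using dickson[of L m n] by blast
  have "\<exists>k f. f \<in> J \<and> fst y = k - size (fst (snd y)) \<and> leads k f (snd (snd y), fst (snd y))"
    if yH: "y \<in> H" for y
  proof -
    have "y \<in> L" using yH H(2) by blast
    then obtain k d e f where "y = (k - size d, d, e)" "f \<in> J" "leads k f (e, d)"
      unfolding L_def by blast
    then show ?thesis by auto
  qed
  then obtain \<kappa> \<gamma> where \<gamma>: "\<And>y. y \<in> H \<Longrightarrow> \<gamma> y \<in> J \<and> fst y = \<kappa> y - size (fst (snd y)) \<and>
      leads (\<kappa> y) (\<gamma> y) (snd (snd y), fst (snd y))"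
    by metis
  define k\<^sub>0 where "k\<^sub>0 = Max (insert 0 (\<kappa> ` H))"
  have k0: "\<kappa> y \<le> k\<^sub>0" if "y \<in> H" for y
    unfolding k\<^sub>0_def using that H(1) by (intro Max_ge) auto
  have G: "finite (\<gamma> ` H)" "\<gamma> ` H \<subseteq> J" using H(1) \<gamma> by auto
  have "J = Idl\<^bsub>D\<^esub> (\<gamma> ` H)"
  proof (rule D.generates_if_approximates[OF J G])
    show "\<exists>q\<in>\<gamma> ` H \<rightarrow> F (k - k\<^sub>0). f \<ominus>\<^bsub>D\<^esub> (\<Oplus>\<^bsub>D\<^esub>g\<in>\<gamma> ` H. q g \<otimes>\<^bsub>D\<^esub> g) \<in> F (Suc k)"
      if "f \<in> J" "f \<in> F k" for f k
    proof (rule approximation_by_standard_basis[OF J G that])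
      fix k f e d assume f: "f \<in> J" "leads k f (e, d)"
      then have "(k - size d, d, e) \<in> L" by (auto simp: L_def)
      then obtain y where y: "y \<in> H" "exponent_le y (k - size d, d, e)" using H(3) by blast
      then show "\<exists>g\<in>\<gamma> ` H. \<exists>j\<le>k\<^sub>0. \<exists>e' d'. leads j g (e', d') \<and> e' \<subseteq># e \<and> d' \<subseteq># d \<and> j - size d' \<le> k - size d"
        using \<gamma>[OF y(1)] k0[OF y(1)] unfolding exponent_le_def
        by (intro bexI[of _ "\<gamma> y"] exI[of _ "\<kappa> y"] conjI exI[of _ "snd (snd y)"] exI[of _ "fst (snd y)"]) auto
    qed
  qed
  then show "\<exists>A\<subseteq>carrier D. finite A \<and> J = Idl\<^bsub>D\<^esub> A"
    using G D.ideal_subset_carrier[OF J] by blast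
qed

end

section \<open>Localisations of Noetherian rings\<close>

text \<open>The hypotheses cover quotients, with \<open>u = 1\<close>, as well as rings of fractions. In both cases an ideal
  of \<open>B\<close> is generated by the image of its preimage.\<close>

lemma noetherian_localisation:
  assumes A: "noetherian_ring A" and B: "cring B" and h: "h \<in> ring_hom A B"
    and frac: "\<And>b. b \<in> carrier B \<Longrightarrow> \<exists>u\<in>Units B. \<exists>a\<in>carrier A. u \<otimes>\<^bsub>B\<^esub> b = h a"
  shows "noetherian_ring B"
proof -
  interpret A: noetherian_ring A by fact
  interpret B: cring B by fact
  interpret h: ring_hom_ring A B h using A.ring_axioms B.ring_axioms h by (rule ring_hom_ringI2)
  show ?thesis
  proof (rule B.noetherian_ringI)
    fix J assume J: "ideal J B"
    obtain G where G: "G \<subseteq> carrier A" "finite G" "{r \<in> carrier A. h r \<in> J} = Idl\<^bsub>A\<^esub> G"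
      using A.finetely_gen[OF h.ideal_vimage[OF J]] by blast
    have hG: "h ` G \<subseteq> carrier B" using G(1) by auto
    have I: "ideal (Idl\<^bsub>B\<^esub> (h ` G)) B" using B.genideal_ideal[OF hG] .
    have "J = Idl\<^bsub>B\<^esub> (h ` G)"
    proof
      show "Idl\<^bsub>B\<^esub> (h ` G) \<subseteq> J"
        using A.genideal_self[OF G(1)] G(3) by (intro B.genideal_minimal[OF J]) auto
      show "J \<subseteq> Idl\<^bsub>B\<^esub> (h ` G)"
      proof
        fix b assume b: "b \<in> J"
        have bc: "b \<in> carrier B" using ideal.Icarr[OF J b] .
        obtain u a where ua: "u \<in> Units B" "a \<in> carrier A" "u \<otimes>\<^bsub>B\<^esub> b = h a" using frac[OF bc] by blast
        have "h a \<in> J" using ua ideal.I_l_closed[OF J b] by (metis B.Units_closed)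
        then have "a \<in> Idl\<^bsub>A\<^esub> G" using ua(2) G(3) by blast
        moreover have "Idl\<^bsub>A\<^esub> G \<subseteq> {r \<in> carrier A. h r \<in> Idl\<^bsub>B\<^esub> (h ` G)}"
          using B.genideal_self[OF hG] G(1) by (intro A.genideal_minimal[OF h.ideal_vimage[OF I]]) auto
        ultimately have "h a \<in> Idl\<^bsub>B\<^esub> (h ` G)" by blast
        then have "inv\<^bsub>B\<^esub> u \<otimes>\<^bsub>B\<^esub> h a \<in> Idl\<^bsub>B\<^esub> (h ` G)"
          using ideal.I_l_closed[OF I] ua(1) by blast
        moreover have "inv\<^bsub>B\<^esub> u \<otimes>\<^bsub>B\<^esub> h a = b"
          using ua(1) bc unfolding ua(3)[symmetric] by (simp add: B.m_assoc[symmetric] B.Units_closed)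
        ultimately show "b \<in> Idl\<^bsub>B\<^esub> (h ` G)" by simp
      qed
    qed
    then show "\<exists>S\<subseteq>carrier B. finite S \<and> J = Idl\<^bsub>B\<^esub> S"
      using G(2) hG by blast
  qed
qed

text \<open>Here \<open>B\<close> is a quotient of \<open>A[1/\<pi>]\<close>. To separate \<open>f\<close> from \<open>P\<close>, write \<open>f = a / \<pi>\<^sup>n\<close> and let \<open>q\<close> be
  maximal among the primes above the preimage \<open>p\<close> of \<open>P\<close> that do not contain \<open>\<pi> a\<close>. The ideal \<open>N\<close>
  generated by \<open>q\<close> in \<open>B\<close> is proper, because \<open>p\<close>, and so \<open>q\<close>, contains the kernel of \<open>\<phi>\<close>. The
  preimage of a maximal ideal above \<open>N\<close> is a prime above \<open>q\<close> without \<open>\<pi>\<close>, hence \<open>q\<close> itself.\<close>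

theorem jacobson_localisation:
  fixes A (structure) and B (structure)
  assumes A: "noetherian_cring A" and B: "cring B" and \<phi>: "\<phi> \<in> ring_hom A B"
    and \<pi>: "\<pi> \<in> carrier A" and radical: "\<And>M. maximalideal M A \<Longrightarrow> \<pi> \<in> M"
    and unit: "\<phi> \<pi> \<in> Units B"
    and frac: "\<And>b. b \<in> carrier B \<Longrightarrow> \<exists>n::nat. \<exists>a\<in>carrier A. \<phi> \<pi> [^]\<^bsub>B\<^esub> n \<otimes>\<^bsub>B\<^esub> b = \<phi> a"
  shows "jacobson_ring B"
  unfolding jacobson_ring_def
proof (intro conjI allI impI)
  show "cring B" by fact
  fix P assume P: "primeideal P B"
  interpret A: noetherian_cring A by fact
  interpret B: cring B by fact
  interpret \<phi>: ring_hom_cring A B \<phi>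
    by (intro ring_hom_cring.intro ring_hom_cring_axioms.intro \<phi> A.is_cring B.is_cring)
  have unit_pow: "\<phi> \<pi> [^]\<^bsub>B\<^esub> (n::nat) \<in> Units B" for n using unit by (rule B.Units_pow_closed)
  have "noetherian_ring B"
    using frac unit_pow by (intro noetherian_localisation[OF A.noetherian_ring_axioms B \<phi>]) blast
  then interpret B: noetherian_cring B by (simp add: noetherian_cring_def B)
  have unit_cancel: "b \<in> I" if "ideal I B" "u \<in> Units B" "b \<in> carrier B" "u \<otimes>\<^bsub>B\<^esub> b \<in> I" for I u b
  proof -
    have "inv\<^bsub>B\<^esub> u \<otimes>\<^bsub>B\<^esub> (u \<otimes>\<^bsub>B\<^esub> b) \<in> I" using that ideal.I_l_closed by (metis B.Units_inv_closed)
    then show ?thesis using that(2,3) by (simp add: B.m_assoc[symmetric] B.Units_closed)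
  qed
  have vimage: "primeideal {a \<in> carrier A. \<phi> a \<in> Q} A" if "primeideal Q B" for Q
    using \<phi>.ring.primeideal_vimage[OF A.is_cring that] .
  have \<pi>_notin: "\<phi> \<pi> \<notin> Q" if Q: "primeideal Q B" for Q
    using unit_cancel[OF primeideal.axioms(1)[OF Q] unit B.one_closed] primeideal_one_notin[OF Q] \<pi>
    by auto
  have PI: "ideal P B" using P by (rule primeideal.axioms)
  define p where "p = {a \<in> carrier A. \<phi> a \<in> P}"
  have p: "primeideal p A" unfolding p_def by (rule vimage[OF P])
  have "\<exists>M. maximalideal M B \<and> P \<subseteq> M \<and> f \<notin> M" if f: "f \<in> carrier B" "f \<notin> P" for f
  proof -
    obtain n :: nat and a where a: "a \<in> carrier A" "\<phi> \<pi> [^]\<^bsub>B\<^esub> n \<otimes>\<^bsub>B\<^esub> f = \<phi> a" using frac[OF f(1)] by blast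
    have "a \<notin> p"
      using unit_cancel[OF PI unit_pow f(1), of n] f(2) unfolding p_def a(2) by blast
    define g where "g = \<pi> \<otimes> a"
    have g: "g \<in> carrier A" using \<pi> a(1) by (simp add: g_def)
    have "\<pi> \<notin> p" using \<pi>_notin[OF P] by (auto simp: p_def)
    then have "g \<notin> p" using \<open>a \<notin> p\<close> primeideal.I_prime[OF p \<pi> a(1)] by (auto simp: g_def)
    then obtain q where q: "ideal q A" "primeideal q A \<and> g \<notin> q" "p \<subseteq> q"
      and q_max: "\<And>J. ideal J A \<Longrightarrow> primeideal J A \<and> g \<notin> J \<Longrightarrow> q \<subseteq> J \<Longrightarrow> J = q"
      using A.maximal_ideal_with[of p "\<lambda>q. primeideal q A \<and> g \<notin> q"] p primeideal.axioms(1)[OF p] by blast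
    have \<pi>q: "\<pi> \<notin> q" and aq: "a \<notin> q"
      using q(2) ideal.I_l_closed[OF q(1)] ideal.I_r_closed[OF q(1)] \<pi> a(1) by (auto simp: g_def)
    have above: "\<pi> \<in> q'" if q': "primeideal q' A" "q \<subset> q'" for q'
    proof (rule A.artin_tate[OF _ \<pi> \<pi>q radical g])
      show "g \<in> r" if "primeideal r A" "q \<subset> r" for r
        using q_max[OF primeideal.axioms(1)[OF that(1)]] that by blast
    qed (use q(2) q' in auto)
    define N where "N = {b \<in> carrier B. \<exists>n::nat. \<exists>x\<in>q. \<phi> \<pi> [^]\<^bsub>B\<^esub> n \<otimes>\<^bsub>B\<^esub> b = \<phi> x}"
    have up: "\<phi> \<pi> \<in> carrier B" using unit by blast
    have N: "ideal N B"
    proof (rule B.ideal_by_closure)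
      have "\<phi> \<pi> [^]\<^bsub>B\<^esub> (0::nat) \<otimes>\<^bsub>B\<^esub> \<zero>\<^bsub>B\<^esub> = \<phi> \<zero>" by simp
      then show "\<zero>\<^bsub>B\<^esub> \<in> N" unfolding N_def using A.ideal_zero_mem[OF q(1)] by blast
      show "b \<oplus>\<^bsub>B\<^esub> c \<in> N" if bc: "b \<in> N" "c \<in> N" for b c
      proof -
        obtain i :: nat and x where x: "b \<in> carrier B" "x \<in> q" "\<phi> \<pi> [^]\<^bsub>B\<^esub> i \<otimes>\<^bsub>B\<^esub> b = \<phi> x"
          using bc(1) unfolding N_def by blast
        obtain j :: nat and y where y: "c \<in> carrier B" "y \<in> q" "\<phi> \<pi> [^]\<^bsub>B\<^esub> j \<otimes>\<^bsub>B\<^esub> c = \<phi> y"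
          using bc(2) unfolding N_def by blast
        have xy: "x \<in> carrier A" "y \<in> carrier A" using ideal.Icarr[OF q(1)] x y by auto
        have "(u \<otimes>\<^bsub>B\<^esub> v) \<otimes>\<^bsub>B\<^esub> (b \<oplus>\<^bsub>B\<^esub> c) = v \<otimes>\<^bsub>B\<^esub> (u \<otimes>\<^bsub>B\<^esub> b) \<oplus>\<^bsub>B\<^esub> u \<otimes>\<^bsub>B\<^esub> (v \<otimes>\<^bsub>B\<^esub> c)"
          if "u \<in> carrier B" "v \<in> carrier B" for u v
          using that x(1) y(1) by (simp add: B.r_distr B.m_ac)
        then have "\<phi> \<pi> [^]\<^bsub>B\<^esub> (i + j) \<otimes>\<^bsub>B\<^esub> (b \<oplus>\<^bsub>B\<^esub> c) = \<phi> \<pi> [^]\<^bsub>B\<^esub> j \<otimes>\<^bsub>B\<^esub> \<phi> x \<oplus>\<^bsub>B\<^esub> \<phi> \<pi> [^]\<^bsub>B\<^esub> i \<otimes>\<^bsub>B\<^esub> \<phi> y"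
          using up x y by (simp flip: B.nat_pow_mult)
        also have "\<dots> = \<phi> (\<pi> [^] j \<otimes> x \<oplus> \<pi> [^] i \<otimes> y)"
          using \<pi> xy by (simp add: \<phi>.ring.hom_nat_pow)
        finally have "\<phi> \<pi> [^]\<^bsub>B\<^esub> (i + j) \<otimes>\<^bsub>B\<^esub> (b \<oplus>\<^bsub>B\<^esub> c) = \<phi> (\<pi> [^] j \<otimes> x \<oplus> \<pi> [^] i \<otimes> y)" .
        moreover have "\<pi> [^] j \<otimes> x \<oplus> \<pi> [^] i \<otimes> y \<in> q"
          using x(2) y(2) \<pi> ideal.I_l_closed[OF q(1)] A.ideal_add_mem[OF q(1)] by auto
        ultimately show ?thesis unfolding N_def using x(1) y(1) by blast
      qed
      show "c \<otimes>\<^bsub>B\<^esub> b \<in> N" if c: "c \<in> carrier B" and b: "b \<in> N" for c b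
      proof -
        obtain i :: nat and x where x: "b \<in> carrier B" "x \<in> q" "\<phi> \<pi> [^]\<^bsub>B\<^esub> i \<otimes>\<^bsub>B\<^esub> b = \<phi> x"
          using b unfolding N_def by blast
        obtain j :: nat and y where y: "y \<in> carrier A" "\<phi> \<pi> [^]\<^bsub>B\<^esub> j \<otimes>\<^bsub>B\<^esub> c = \<phi> y"
          using frac[OF c] by blast
        have xc: "x \<in> carrier A" using ideal.Icarr[OF q(1) x(2)] .
        have "(v \<otimes>\<^bsub>B\<^esub> u) \<otimes>\<^bsub>B\<^esub> (c \<otimes>\<^bsub>B\<^esub> b) = (v \<otimes>\<^bsub>B\<^esub> c) \<otimes>\<^bsub>B\<^esub> (u \<otimes>\<^bsub>B\<^esub> b)"
          if "u \<in> carrier B" "v \<in> carrier B" for u v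
          using that x(1) c by (simp add: B.m_ac)
        then have "\<phi> \<pi> [^]\<^bsub>B\<^esub> (j + i) \<otimes>\<^bsub>B\<^esub> (c \<otimes>\<^bsub>B\<^esub> b) = \<phi> y \<otimes>\<^bsub>B\<^esub> \<phi> x"
          using up x y by (simp flip: B.nat_pow_mult)
        also have "\<dots> = \<phi> (y \<otimes> x)" using y(1) xc by simp
        finally have "\<phi> \<pi> [^]\<^bsub>B\<^esub> (j + i) \<otimes>\<^bsub>B\<^esub> (c \<otimes>\<^bsub>B\<^esub> b) = \<phi> (y \<otimes> x)" .
        moreover have "y \<otimes> x \<in> q" using ideal.I_l_closed[OF q(1) x(2) y(1)] .
        ultimately show ?thesis unfolding N_def using x(1) c by blast
      qed
    qed (auto simp: N_def)
    have "\<one>\<^bsub>B\<^esub> \<notin> N"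
    proof
      assume "\<one>\<^bsub>B\<^esub> \<in> N"
      then obtain i :: nat and x where x: "x \<in> q" "\<phi> \<pi> [^]\<^bsub>B\<^esub> i \<otimes>\<^bsub>B\<^esub> \<one>\<^bsub>B\<^esub> = \<phi> x"
        unfolding N_def by blast
      have xc: "x \<in> carrier A" using ideal.Icarr[OF q(1) x(1)] .
      have "\<phi> (\<pi> [^] i \<ominus> x) = \<zero>\<^bsub>B\<^esub>"
        using x(2) \<pi> xc up by (simp add: a_minus_def \<phi>.ring.hom_nat_pow B.r_neg)
      then have "\<phi> (\<pi> [^] i \<ominus> x) \<in> P" using B.ideal_zero_mem[OF PI] by metis
      then have "\<pi> [^] i \<ominus> x \<in> p" using \<pi> xc unfolding p_def by blast
      then have "\<pi> [^] i \<ominus> x \<in> q" using q(3) by blast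
      then have "\<pi> [^] i \<in> q" using A.ideal_diff_mem_iff[OF q(1) x(1)] \<pi> by simp
      then show False using A.primeideal_pow_mem[OF _ \<pi>] q(2) \<pi>q by blast
    qed
    then obtain M where M: "maximalideal M B" "N \<subseteq> M"
      by (rule B.exists_maximalideal[OF N])
    have Mp: "primeideal M B" using B.maximalideal_prime[OF M(1)] .
    define q' where "q' = {a \<in> carrier A. \<phi> a \<in> M}"
    have q': "primeideal q' A" unfolding q'_def by (rule vimage[OF Mp])
    have "q \<subseteq> q'"
    proof
      fix x assume x: "x \<in> q"
      have xc: "x \<in> carrier A" using ideal.Icarr[OF q(1) x] .
      have "\<phi> \<pi> [^]\<^bsub>B\<^esub> (0::nat) \<otimes>\<^bsub>B\<^esub> \<phi> x = \<phi> x" using xc by simp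
      then have "\<phi> x \<in> N" unfolding N_def using x xc by blast
      then show "x \<in> q'" using M(2) xc by (auto simp: q'_def)
    qed
    moreover have "\<pi> \<notin> q'" using \<pi>_notin[OF Mp] by (simp add: q'_def)
    ultimately have "q' = q" using above[OF q'] by blast
    have "f \<notin> M"
    proof
      assume "f \<in> M"
      then have "\<phi> a \<in> M"
        using ideal.I_l_closed[OF primeideal.axioms(1)[OF Mp]] a(2) up by (metis B.nat_pow_closed)
      then show False using a(1) aq \<open>q' = q\<close> by (auto simp: q'_def)
    qed
    moreover have "P \<subseteq> M"
    proof
      fix b assume b: "b \<in> P"
      have bc: "b \<in> carrier B" using ideal.Icarr[OF PI b] .
      obtain j :: nat and y where y: "y \<in> carrier A" "\<phi> \<pi> [^]\<^bsub>B\<^esub> j \<otimes>\<^bsub>B\<^esub> b = \<phi> y"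
        using frac[OF bc] by blast
      have "\<phi> y \<in> P" using ideal.I_l_closed[OF PI b, of "\<phi> \<pi> [^]\<^bsub>B\<^esub> j"] y(2) up by simp
      then have "y \<in> q" using y(1) q(3) by (auto simp: p_def)
      then have "b \<in> N" unfolding N_def using bc y(2) by blast
      then show "b \<in> M" using M(2) by blast
    qed
    ultimately show ?thesis using M(1) by blast
  qed
  note separate = this
  define \<M> where "\<M> = {M. maximalideal M B \<and> P \<subseteq> M}"
  obtain M\<^sub>0 where M0: "M\<^sub>0 \<in> \<M>" "M\<^sub>0 \<subseteq> carrier B"
  proof -
    obtain M where "maximalideal M B" "P \<subseteq> M"
      using separate[OF B.one_closed primeideal_one_notin[OF P]] by blast
    then show thesis
      using that[of M] B.ideal_subset_carrier[OF maximalideal.axioms(1)] unfolding \<M>_def by blast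
  qed
  have "\<Inter>\<M> \<subseteq> P"
  proof (rule subsetI, rule ccontr)
    fix f assume f: "f \<in> \<Inter>\<M>" "f \<notin> P"
    then have "f \<in> carrier B" using M0 by blast
    then show False using separate[of f] f unfolding \<M>_def by blast
  qed
  moreover have "P \<subseteq> \<Inter>\<M>" "\<forall>M\<in>\<M>. maximalideal M B" by (auto simp: \<M>_def)
  ultimately show "\<exists>\<M>. (\<forall>M\<in>\<M>. maximalideal M B) \<and> P = \<Inter>\<M>"
    by (intro exI[of _ \<M>] conjI subset_antisym)
qed

section \<open>Tensor products of algebras\<close>

lemma frag_extend_plus:
  "frag_extend (\<lambda>i. f i + g i) x = frag_extend f x + frag_extend g x"
  by (simp add: frag_extend_def frag_cmul_distrib2 sum.distrib)

lemma frag_extend_minus_fun: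
  "frag_extend (\<lambda>i. f i - g i) x = frag_extend f x - frag_extend g x"
  using frag_extend_plus[of "\<lambda>i. f i - g i" g x] by simp

text \<open>The free abelian group on \<open>A \<times> C\<close> is a ring, since its product is bilinear and the ring laws hold
  for the generators.\<close>

locale algebra_pair = A?: cring A + C?: cring C
  for A :: "('r, 'a) module" (structure) and C :: "('r, 'c) module" (structure)
begin

abbreviation FP :: "('a \<times> 'c \<Rightarrow>\<^sub>0 int) ring" where
  "FP \<equiv> free_pair_ring A C"

lemma FP_carrier: "x \<in> carrier FP \<longleftrightarrow> Poly_Mapping.keys x \<subseteq> carrier A \<times> carrier C"
  and FP_add: "x \<oplus>\<^bsub>FP\<^esub> y = x + y"
  and FP_zero: "\<zero>\<^bsub>FP\<^esub> = 0"
  and FP_one: "\<one>\<^bsub>FP\<^esub> = frag_of (\<one>\<^bsub>A\<^esub>, \<one>\<^bsub>C\<^esub>)"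
  by (simp_all add: free_pair_ring_def)

definition left_mult :: "'a \<times> 'c \<Rightarrow> ('a \<times> 'c \<Rightarrow>\<^sub>0 int) \<Rightarrow> 'a \<times> 'c \<Rightarrow>\<^sub>0 int" where
  "left_mult p = frag_extend (\<lambda>p'. frag_of (fst p \<otimes>\<^bsub>A\<^esub> fst p', snd p \<otimes>\<^bsub>C\<^esub> snd p'))"

lemma FP_mult: "x \<otimes>\<^bsub>FP\<^esub> y = frag_extend (\<lambda>p. left_mult p y) x"
  by (simp add: free_pair_ring_def left_mult_def case_prod_beta')

lemma left_mult_of: "left_mult p (frag_of p') = frag_of (fst p \<otimes>\<^bsub>A\<^esub> fst p', snd p \<otimes>\<^bsub>C\<^esub> snd p')"
  by (simp add: left_mult_def)

lemma left_mult_linear: "left_mult p (x + y) = left_mult p x + left_mult p y"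
    "left_mult p (x - y) = left_mult p x - left_mult p y" "left_mult p 0 = 0"
  by (simp_all add: left_mult_def frag_extend_add frag_extend_diff)

lemma FP_mult_linear:
    "(x + y) \<otimes>\<^bsub>FP\<^esub> z = x \<otimes>\<^bsub>FP\<^esub> z + y \<otimes>\<^bsub>FP\<^esub> z" "z \<otimes>\<^bsub>FP\<^esub> (x + y) = z \<otimes>\<^bsub>FP\<^esub> x + z \<otimes>\<^bsub>FP\<^esub> y"
    "(x - y) \<otimes>\<^bsub>FP\<^esub> z = x \<otimes>\<^bsub>FP\<^esub> z - y \<otimes>\<^bsub>FP\<^esub> z" "z \<otimes>\<^bsub>FP\<^esub> (x - y) = z \<otimes>\<^bsub>FP\<^esub> x - z \<otimes>\<^bsub>FP\<^esub> y"
    "0 \<otimes>\<^bsub>FP\<^esub> z = 0" "z \<otimes>\<^bsub>FP\<^esub> 0 = 0"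
  by (simp_all add: FP_mult frag_extend_add frag_extend_diff frag_extend_plus frag_extend_minus_fun
      left_mult_linear frag_extend_eq_0)

lemma FP_mult_of: "frag_of p \<otimes>\<^bsub>FP\<^esub> frag_of p' = frag_of (fst p \<otimes>\<^bsub>A\<^esub> fst p', snd p \<otimes>\<^bsub>C\<^esub> snd p')"
  by (simp add: FP_mult left_mult_of)

lemma FP_induct [consumes 1, case_names zero single diff]:
  assumes "x \<in> carrier FP" and "P 0" and "\<And>a c. a \<in> carrier A \<Longrightarrow> c \<in> carrier C \<Longrightarrow> P (frag_of (a, c))"
    and "\<And>x y. P x \<Longrightarrow> P y \<Longrightarrow> P (x - y)"
  shows "P x"
  using assms(1)[unfolded FP_carrier]
  by (induction rule: frag_induction) (use assms(2-) in auto)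

lemma FP_of_closed: "a \<in> carrier A \<Longrightarrow> c \<in> carrier C \<Longrightarrow> frag_of (a, c) \<in> carrier FP"
  by (simp add: FP_carrier)

lemma FP_closed_plus: "x \<in> carrier FP \<Longrightarrow> y \<in> carrier FP \<Longrightarrow> x + y \<in> carrier FP"
  unfolding FP_carrier by (meson Un_least keys_add order_trans)

lemma FP_closed_diff: "x \<in> carrier FP \<Longrightarrow> y \<in> carrier FP \<Longrightarrow> x - y \<in> carrier FP"
  unfolding FP_carrier by (meson Un_least keys_diff order_trans)

lemma FP_zero_closed: "0 \<in> carrier FP"
  by (simp add: FP_carrier)

lemma FP_mult_closed:
  assumes "x \<in> carrier FP" and y: "y \<in> carrier FP"
  shows "x \<otimes>\<^bsub>FP\<^esub> y \<in> carrier FP"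
  using assms(1)
proof (induction x rule: FP_induct)
  case (single a c)
  show ?case
    using y
  proof (induction y rule: FP_induct)
    case (single a' c')
    then show ?case using \<open>a \<in> carrier A\<close> \<open>c \<in> carrier C\<close> by (simp add: FP_mult_of FP_of_closed)
  qed (simp_all add: FP_mult_linear FP_zero_closed FP_closed_diff)
qed (simp_all add: FP_mult_linear FP_zero_closed FP_closed_diff)

lemma FP_mult_assoc:
  assumes "x \<in> carrier FP" and y: "y \<in> carrier FP" and z: "z \<in> carrier FP"
  shows "(x \<otimes>\<^bsub>FP\<^esub> y) \<otimes>\<^bsub>FP\<^esub> z = x \<otimes>\<^bsub>FP\<^esub> (y \<otimes>\<^bsub>FP\<^esub> z)"
  using assms(1)
proof (induction x rule: FP_induct)
  case (single a c)
  show ?case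
    using y
  proof (induction y rule: FP_induct)
    case (single a' c')
    show ?case
      using z
    proof (induction z rule: FP_induct)
      case (single a'' c'')
      then show ?case
        using \<open>a \<in> carrier A\<close> \<open>c \<in> carrier C\<close> \<open>a' \<in> carrier A\<close> \<open>c' \<in> carrier C\<close>
        by (simp add: FP_mult_of A.m_assoc C.m_assoc)
    qed (simp_all add: FP_mult_linear)
  qed (simp_all add: FP_mult_linear)
qed (simp_all add: FP_mult_linear)

lemma FP_mult_one:
  assumes "x \<in> carrier FP"
  shows "\<one>\<^bsub>FP\<^esub> \<otimes>\<^bsub>FP\<^esub> x = x" and "x \<otimes>\<^bsub>FP\<^esub> \<one>\<^bsub>FP\<^esub> = x"
  using assms
  by (induction x rule: FP_induct) (simp_all add: FP_one FP_mult_linear FP_mult_of)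

lemma FP_ring: "ring FP"
proof (rule ringI)
  show "abelian_group FP"
  proof (rule abelian_groupI)
    show "\<exists>y\<in>carrier FP. y \<oplus>\<^bsub>FP\<^esub> x = \<zero>\<^bsub>FP\<^esub>" if "x \<in> carrier FP" for x
      using that FP_closed_diff[OF FP_zero_closed that]
      by (intro bexI[of _ "0 - x"]) (simp_all add: FP_add FP_zero)
  qed (simp_all add: FP_add FP_zero FP_zero_closed FP_closed_plus add_ac)
  show "Group.monoid FP"
    by (rule monoidI)
      (simp_all add: FP_mult_closed FP_mult_assoc FP_mult_one, simp add: FP_one FP_of_closed)
qed (simp_all add: FP_add FP_mult_linear)

lemma FP_minus:
  assumes "x \<in> carrier FP" and "y \<in> carrier FP"
  shows "x \<ominus>\<^bsub>FP\<^esub> y = x - y"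
proof -
  interpret FP: ring FP by (rule FP_ring)
  have "\<ominus>\<^bsub>FP\<^esub> y = - y"
    using assms(2) FP_closed_diff[OF FP_zero_closed assms(2)]
    by (intro FP.minus_equality) (simp_all add: FP_add FP_zero)
  then show ?thesis by (simp add: a_minus_def FP_add)
qed

end

text \<open>The pairing is \<open>\<tau> a k = a \<otimes> k\<close>, carried over to \<open>B\<close>. The induction rule expresses that these
  elements generate \<open>B\<close> as an abelian group; later arguments use no more of the construction.\<close>

lemma base_change_pairing:
  fixes R :: "'r ring" and A :: "('r, 'a) module" and K :: "('r, 'k) module" and B :: "('k, 'b) module"
  assumes A: "algebra R A" and K: "algebra R K" and B: "ring B"
    and iso: "algebra_isomorphic K (base_change R A K) B"
  obtains \<tau> where
    "\<And>a k. a \<in> carrier A \<Longrightarrow> k \<in> carrier K \<Longrightarrow> \<tau> a k \<in> carrier B"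
    "\<And>a a' k. a \<in> carrier A \<Longrightarrow> a' \<in> carrier A \<Longrightarrow> k \<in> carrier K \<Longrightarrow> \<tau> (a \<oplus>\<^bsub>A\<^esub> a') k = \<tau> a k \<oplus>\<^bsub>B\<^esub> \<tau> a' k"
    "\<And>r a k. r \<in> carrier R \<Longrightarrow> a \<in> carrier A \<Longrightarrow> k \<in> carrier K \<Longrightarrow> \<tau> (r \<odot>\<^bsub>A\<^esub> a) k = \<tau> a (r \<odot>\<^bsub>K\<^esub> k)"
    "\<And>a a' k k'. a \<in> carrier A \<Longrightarrow> a' \<in> carrier A \<Longrightarrow> k \<in> carrier K \<Longrightarrow> k' \<in> carrier K \<Longrightarrow>
      \<tau> (a \<otimes>\<^bsub>A\<^esub> a') (k \<otimes>\<^bsub>K\<^esub> k') = \<tau> a k \<otimes>\<^bsub>B\<^esub> \<tau> a' k'"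
    "\<tau> \<one>\<^bsub>A\<^esub> \<one>\<^bsub>K\<^esub> = \<one>\<^bsub>B\<^esub>"
    "\<And>P b. b \<in> carrier B \<Longrightarrow> P \<zero>\<^bsub>B\<^esub> \<Longrightarrow> (\<And>a k. a \<in> carrier A \<Longrightarrow> k \<in> carrier K \<Longrightarrow> P (\<tau> a k)) \<Longrightarrow>
      (\<And>x y. x \<in> carrier B \<Longrightarrow> y \<in> carrier B \<Longrightarrow> P x \<Longrightarrow> P y \<Longrightarrow> P (x \<ominus>\<^bsub>B\<^esub> y)) \<Longrightarrow> P b"
proof -
  interpret A: algebra R A by fact
  interpret K: algebra R K by fact
  interpret B: ring B by fact
  interpret pair: algebra_pair A K by unfold_locales
  interpret FP: ring "free_pair_ring A K" by (rule pair.FP_ring)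
  note closed = A.smult_closed K.smult_closed A.a_closed K.a_closed
  define I where "I = tensor_ideal R A K"
  have rel: "tensor_relations R A K \<subseteq> carrier pair.FP"
    unfolding tensor_relations_def
    by (auto intro!: pair.FP_closed_diff pair.FP_of_closed)
  have I: "ideal I pair.FP" unfolding I_def tensor_ideal_def by (rule FP.genideal_ideal[OF rel])
  have rel_I: "tensor_relations R A K \<subseteq> I" unfolding I_def tensor_ideal_def by (rule FP.genideal_self[OF rel])
  obtain h where h: "h \<in> algebra_hom K (base_change R A K) B" and bij: "bij_betw h (carrier (base_change R A K)) (carrier B)"
    using iso unfolding algebra_isomorphic_def by blast
  have Q: "tensor_ring R A K = pair.FP Quot I" by (simp add: tensor_ring_def I_def)
  have hQ: "h \<in> ring_hom (pair.FP Quot I) B"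
    using h unfolding algebra_hom_def Q[symmetric]
    by (simp add: ring_hom_def base_change_def ring.defs)
  have h_onto: "h ` carrier (pair.FP Quot I) = carrier B"
    using bij by (simp add: bij_betw_def base_change_def ring.defs Q)
  define \<theta> where "\<theta> = h \<circ> ((+>\<^bsub>pair.FP\<^esub>) I)"
  have \<theta>: "\<theta> \<in> ring_hom pair.FP B"
    unfolding \<theta>_def by (rule ring_hom_trans[OF ideal.rcos_ring_hom[OF I] hQ])
  interpret \<theta>: ring_hom_ring "free_pair_ring A K" B \<theta>
    using FP.ring_axioms B.ring_axioms \<theta> by (rule ring_hom_ringI2)
  have \<theta>_onto: "\<exists>x\<in>carrier pair.FP. b = \<theta> x" if b: "b \<in> carrier B" for b
  proof -
    obtain c where "c \<in> carrier (pair.FP Quot I)" "b = h c" using b unfolding h_onto[symmetric] by blast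
    then show ?thesis unfolding \<theta>_def FactRing_def A_RCOSETS_def' by auto
  qed
  have \<theta>_diff: "\<theta> (x - y) = \<theta> x \<ominus>\<^bsub>B\<^esub> \<theta> y" if "x \<in> carrier pair.FP" "y \<in> carrier pair.FP" for x y
    using that by (simp add: pair.FP_minus[symmetric] a_minus_def)
  have \<theta>_rel: "\<theta> x = \<theta> y" if "x \<in> carrier pair.FP" "y \<in> carrier pair.FP" "x - y \<in> tensor_relations R A K" for x y
  proof -
    have "x \<ominus>\<^bsub>pair.FP\<^esub> y \<in> I" using that rel_I by (auto simp: pair.FP_minus)
    then show ?thesis
      using FP.quotient_eq_iff_same_a_r_cos[OF I that(1,2)] by (simp add: \<theta>_def)
  qed
  define \<tau> where "\<tau> a k = \<theta> (frag_of (a, k))" for a k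
  note FPc = pair.FP_of_closed pair.FP_closed_plus
  show thesis
  proof (rule that[of \<tau>])
    show "\<tau> a k \<in> carrier B" if "a \<in> carrier A" "k \<in> carrier K" for a k
      using that by (simp add: \<tau>_def FPc)
    show "\<tau> (a \<oplus>\<^bsub>A\<^esub> a') k = \<tau> a k \<oplus>\<^bsub>B\<^esub> \<tau> a' k" if "a \<in> carrier A" "a' \<in> carrier A" "k \<in> carrier K" for a a' k
    proof -
      have "\<theta> (frag_of (a \<oplus>\<^bsub>A\<^esub> a', k)) = \<theta> (frag_of (a, k) + frag_of (a', k))"
        using that by (intro \<theta>_rel) (auto simp: FPc tensor_relations_def diff_diff_eq[symmetric])
      then show ?thesis using that by (simp add: \<tau>_def FPc flip: pair.FP_add)
    qed
    show "\<tau> (r \<odot>\<^bsub>A\<^esub> a) k = \<tau> a (r \<odot>\<^bsub>K\<^esub> k)" if "r \<in> carrier R" "a \<in> carrier A" "k \<in> carrier K" for r a k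
      unfolding \<tau>_def using that by (intro \<theta>_rel) (auto simp: FPc tensor_relations_def)
    show "\<tau> (a \<otimes>\<^bsub>A\<^esub> a') (k \<otimes>\<^bsub>K\<^esub> k') = \<tau> a k \<otimes>\<^bsub>B\<^esub> \<tau> a' k'"
      if "a \<in> carrier A" "a' \<in> carrier A" "k \<in> carrier K" "k' \<in> carrier K" for a a' k k'
      using that pair.FP_mult_of[of "(a, k)" "(a', k')"] by (simp add: \<tau>_def FPc flip: \<theta>.hom_mult)
    show "\<tau> \<one>\<^bsub>A\<^esub> \<one>\<^bsub>K\<^esub> = \<one>\<^bsub>B\<^esub>" by (simp add: \<tau>_def flip: pair.FP_one)
    show "P b" if b: "b \<in> carrier B" and P: "P \<zero>\<^bsub>B\<^esub>" "\<And>a k. a \<in> carrier A \<Longrightarrow> k \<in> carrier K \<Longrightarrow> P (\<tau> a k)"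
      "\<And>x y. x \<in> carrier B \<Longrightarrow> y \<in> carrier B \<Longrightarrow> P x \<Longrightarrow> P y \<Longrightarrow> P (x \<ominus>\<^bsub>B\<^esub> y)" for P b
    proof -
      have "x \<in> carrier pair.FP \<and> P (\<theta> x)" if "x \<in> carrier pair.FP" for x
        using that
      proof (induction x rule: pair.FP_induct)
        case zero
        then show ?case using P(1) \<theta>.hom_zero by (simp add: pair.FP_zero pair.FP_zero_closed)
      next
        case (single a c)
        then show ?case using P(2) by (simp add: \<tau>_def FPc)
      next
        case (diff x y)
        then show ?case using P(3) \<theta>_diff pair.FP_closed_diff by simp
      qed
      then show ?thesis using \<theta>_onto[OF b] by blast
    qed
  qed
qed

section \<open>Semi-affinoid algebras\<close>

locale dvr_with_fraction_field = complete_dvr_with_uniformizer R \<pi>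
  for R :: "'r ring" (structure) and \<pi> +
  fixes K :: "('r, 'k) module"
  assumes fraction_field: "fraction_field R K"

sublocale dvr_with_fraction_field \<subseteq> K: algebra R K
  using fraction_field by (simp add: fraction_field_def)

sublocale dvr_with_fraction_field \<subseteq> Kf: field K
  using fraction_field by (simp add: fraction_field_def)

context dvr_with_fraction_field
begin

definition \<iota> :: "'r \<Rightarrow> 'k" where
  "\<iota> r = r \<odot>\<^bsub>K\<^esub> \<one>\<^bsub>K\<^esub>"

lemma \<iota>_closed [simp]: "r \<in> carrier R \<Longrightarrow> \<iota> r \<in> carrier K"
  by (simp add: \<iota>_def)

lemma \<iota>_mult: "r \<in> carrier R \<Longrightarrow> s \<in> carrier R \<Longrightarrow> \<iota> (r \<otimes> s) = \<iota> r \<otimes>\<^bsub>K\<^esub> \<iota> s"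
  by (simp add: \<iota>_def K.smult_assoc1 K.smult_assoc2)

lemma \<iota>_one: "\<iota> \<one> = \<one>\<^bsub>K\<^esub>"
  by (simp add: \<iota>_def)

lemma \<iota>_pow: "r \<in> carrier R \<Longrightarrow> \<iota> (r [^] (n::nat)) = \<iota> r [^]\<^bsub>K\<^esub> n"
  by (induction n) (simp_all add: \<iota>_one \<iota>_mult)

lemma \<iota>_nonzero:
  assumes "r \<in> carrier R" and "r \<noteq> \<zero>"
  shows "\<iota> r \<noteq> \<zero>\<^bsub>K\<^esub>"
proof
  assume "\<iota> r = \<zero>\<^bsub>K\<^esub>"
  moreover have "\<iota> \<zero> = \<zero>\<^bsub>K\<^esub>" by (simp add: \<iota>_def K.smult_l_null)
  ultimately have "\<iota> r = \<iota> \<zero>" by simp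
  moreover have "inj_on \<iota> (carrier R)"
    using fraction_field unfolding fraction_field_def \<iota>_def by blast
  ultimately show False using assms by (simp add: inj_on_eq_iff)
qed

lemma \<pi>_nonzero: "\<pi> \<noteq> \<zero>"
proof
  assume "\<pi> = \<zero>"
  moreover have "PIdl \<zero> = {\<zero>}"
    by (auto simp: cgenideal_def intro!: exI[of _ \<zero>])
  ultimately have "maximalideal {\<zero>} R" using \<pi>_maximal by simp
  then have "field R" by (rule zeromaximalideal_fieldI)
  then show False using complete_dvr by (simp add: complete_dvr_def discrete_valuation_ring_def)
qed

text \<open>A nonzero denominator is a unit of \<open>R\<close> times a power of \<open>\<pi>\<close>.\<close>

lemma denominator:
  assumes k: "k \<in> carrier K"
  shows "\<exists>n::nat. \<exists>r\<in>carrier R. \<iota> \<pi> [^]\<^bsub>K\<^esub> n \<otimes>\<^bsub>K\<^esub> k = \<iota> r"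
proof -
  obtain a b where ab: "a \<in> carrier R" "b \<in> carrier R" "b \<noteq> \<zero>" "k = \<iota> a \<otimes>\<^bsub>K\<^esub> inv\<^bsub>K\<^esub> \<iota> b"
    using fraction_field k unfolding fraction_field_def \<iota>_def by blast
  have "\<exists>n. b \<notin> V n" using V_separated ab(3) by blast
  then obtain n where n: "b \<notin> V n" "\<And>i. i < n \<Longrightarrow> b \<in> V i"
    using exists_least_iff[of "\<lambda>n. b \<notin> V n"] by blast
  then obtain j where j: "n = Suc j" using V_0 ab(2) by (cases n) auto
  obtain u where u: "u \<in> Units R" "b = \<pi> [^] j \<otimes> u"
    using unit_if_exact_order[of b j] n j by blast
  have uc: "u \<in> carrier R" "inv u \<in> carrier R" using u(1) by auto
  have \<iota>b: "\<iota> b = \<iota> \<pi> [^]\<^bsub>K\<^esub> j \<otimes>\<^bsub>K\<^esub> \<iota> u"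
    using u uc by (simp add: \<iota>_mult \<iota>_pow)
  have inv_b: "\<iota> b \<otimes>\<^bsub>K\<^esub> inv\<^bsub>K\<^esub> \<iota> b = \<one>\<^bsub>K\<^esub>" "inv\<^bsub>K\<^esub> \<iota> b \<in> carrier K"
    using \<iota>_nonzero[OF ab(2,3)] ab(2) Kf.field_Units by auto
  have "\<iota> (inv u) \<otimes>\<^bsub>K\<^esub> \<iota> u = \<one>\<^bsub>K\<^esub>"
    using u(1) uc by (simp add: \<iota>_one flip: \<iota>_mult)
  then have "\<iota> (inv u) \<otimes>\<^bsub>K\<^esub> \<iota> b = \<iota> \<pi> [^]\<^bsub>K\<^esub> j"
    unfolding \<iota>b using uc K.m_lcomm[of "\<iota> (inv u)" "\<iota> \<pi> [^]\<^bsub>K\<^esub> j" "\<iota> u"] by simp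
  then have "\<iota> \<pi> [^]\<^bsub>K\<^esub> j \<otimes>\<^bsub>K\<^esub> k = (\<iota> (inv u) \<otimes>\<^bsub>K\<^esub> \<iota> b) \<otimes>\<^bsub>K\<^esub> (\<iota> a \<otimes>\<^bsub>K\<^esub> inv\<^bsub>K\<^esub> \<iota> b)"
    by (simp add: ab(4))
  also have "\<dots> = (\<iota> (inv u) \<otimes>\<^bsub>K\<^esub> \<iota> a) \<otimes>\<^bsub>K\<^esub> (\<iota> b \<otimes>\<^bsub>K\<^esub> inv\<^bsub>K\<^esub> \<iota> b)"
    using uc ab(1,2) inv_b(2) by (simp add: K.m_ac)
  also have "\<dots> = \<iota> (inv u \<otimes> a)"
    using uc ab(1) by (simp add: inv_b \<iota>_mult)
  finally show ?thesis using uc ab(1) by blast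
qed

text \<open>The base change is generated by the \<open>a \<otimes> k\<close>, and if \<open>\<pi>\<^sup>n k\<close> comes from \<open>r \<in> R\<close>, then
  \<open>\<pi>\<^sup>n (a \<otimes> k) = r a \<otimes> 1\<close>. So \<open>\<pi>\<close> is the only denominator that is required.\<close>

lemma generic_fibre:
  fixes A :: "('r, 'a) module" and B :: "('k, 'b) module"
  assumes A: "algebra R A" and B: "cring B" and iso: "algebra_isomorphic K (base_change R A K) B"
  obtains \<phi> where "\<phi> \<in> ring_hom A B" and "\<phi> (\<pi> \<odot>\<^bsub>A\<^esub> \<one>\<^bsub>A\<^esub>) \<in> Units B"
    and "\<And>b. b \<in> carrier B \<Longrightarrow> \<exists>n::nat. \<exists>a\<in>carrier A. \<phi> (\<pi> \<odot>\<^bsub>A\<^esub> \<one>\<^bsub>A\<^esub>) [^]\<^bsub>B\<^esub> n \<otimes>\<^bsub>B\<^esub> b = \<phi> a"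
proof -
  interpret A: algebra R A by fact
  interpret B: cring B by fact
  obtain \<tau> where \<tau>_closed: "\<And>a k. a \<in> carrier A \<Longrightarrow> k \<in> carrier K \<Longrightarrow> \<tau> a k \<in> carrier B"
    and \<tau>_add: "\<And>a a' k. a \<in> carrier A \<Longrightarrow> a' \<in> carrier A \<Longrightarrow> k \<in> carrier K \<Longrightarrow>
      \<tau> (a \<oplus>\<^bsub>A\<^esub> a') k = \<tau> a k \<oplus>\<^bsub>B\<^esub> \<tau> a' k"
    and \<tau>_smult: "\<And>r a k. r \<in> carrier R \<Longrightarrow> a \<in> carrier A \<Longrightarrow> k \<in> carrier K \<Longrightarrow>
      \<tau> (r \<odot>\<^bsub>A\<^esub> a) k = \<tau> a (r \<odot>\<^bsub>K\<^esub> k)"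
    and \<tau>_mult: "\<And>a a' k k'. a \<in> carrier A \<Longrightarrow> a' \<in> carrier A \<Longrightarrow> k \<in> carrier K \<Longrightarrow> k' \<in> carrier K \<Longrightarrow>
      \<tau> (a \<otimes>\<^bsub>A\<^esub> a') (k \<otimes>\<^bsub>K\<^esub> k') = \<tau> a k \<otimes>\<^bsub>B\<^esub> \<tau> a' k'"
    and \<tau>_one: "\<tau> \<one>\<^bsub>A\<^esub> \<one>\<^bsub>K\<^esub> = \<one>\<^bsub>B\<^esub>"
    and \<tau>_induct: "\<And>P b. b \<in> carrier B \<Longrightarrow> P \<zero>\<^bsub>B\<^esub> \<Longrightarrow>
      (\<And>a k. a \<in> carrier A \<Longrightarrow> k \<in> carrier K \<Longrightarrow> P (\<tau> a k)) \<Longrightarrow>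
      (\<And>x y. x \<in> carrier B \<Longrightarrow> y \<in> carrier B \<Longrightarrow> P x \<Longrightarrow> P y \<Longrightarrow> P (x \<ominus>\<^bsub>B\<^esub> y)) \<Longrightarrow> P b"
    by (rule base_change_pairing[OF A K.algebra_axioms B.ring_axioms iso]) blast
  define \<phi> where "\<phi> a = \<tau> a \<one>\<^bsub>K\<^esub>" for a
  have \<phi>: "\<phi> \<in> ring_hom A B"
  proof (rule ring_hom_memI)
    show "\<phi> (a \<otimes>\<^bsub>A\<^esub> a') = \<phi> a \<otimes>\<^bsub>B\<^esub> \<phi> a'" if "a \<in> carrier A" "a' \<in> carrier A" for a a'
      using \<tau>_mult[OF that K.one_closed K.one_closed] by (simp add: \<phi>_def)
  qed (simp_all add: \<phi>_def \<tau>_closed \<tau>_add \<tau>_one)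
  interpret \<phi>: ring_hom_cring A B \<phi>
    by (intro ring_hom_cring.intro ring_hom_cring_axioms.intro \<phi> A.is_cring B)
  define \<omega> where "\<omega> = \<phi> (\<pi> \<odot>\<^bsub>A\<^esub> \<one>\<^bsub>A\<^esub>)"
  have \<omega>: "\<omega> = \<tau> \<one>\<^bsub>A\<^esub> (\<iota> \<pi>)"
    unfolding \<omega>_def \<phi>_def by (simp add: \<tau>_smult \<iota>_def)
  have \<omega>c: "\<omega> \<in> carrier B" by (simp add: \<omega> \<tau>_closed)
  have \<omega>_unit: "\<omega> \<in> Units B"
  proof -
    have "\<iota> \<pi> \<in> Units K" using \<iota>_nonzero[OF \<pi>_closed \<pi>_nonzero] Kf.field_Units by auto
    then have "inv\<^bsub>K\<^esub> \<iota> \<pi> \<in> carrier K" "\<iota> \<pi> \<otimes>\<^bsub>K\<^esub> inv\<^bsub>K\<^esub> \<iota> \<pi> = \<one>\<^bsub>K\<^esub>" by auto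
    then have "\<omega> \<otimes>\<^bsub>B\<^esub> \<tau> \<one>\<^bsub>A\<^esub> (inv\<^bsub>K\<^esub> \<iota> \<pi>) = \<one>\<^bsub>B\<^esub>" "\<tau> \<one>\<^bsub>A\<^esub> (inv\<^bsub>K\<^esub> \<iota> \<pi>) \<in> carrier B"
      using \<tau>_mult[of "\<one>\<^bsub>A\<^esub>" "\<one>\<^bsub>A\<^esub>" "\<iota> \<pi>" "inv\<^bsub>K\<^esub> \<iota> \<pi>"] by (simp_all add: \<omega> \<tau>_one \<tau>_closed)
    then show ?thesis using \<omega>c B.m_comm unfolding Units_def by (metis (mono_tags, lifting) mem_Collect_eq)
  qed
  have \<omega>_pow: "\<omega> [^]\<^bsub>B\<^esub> n = \<tau> \<one>\<^bsub>A\<^esub> (\<iota> \<pi> [^]\<^bsub>K\<^esub> n)" for n :: nat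
  proof (induction n)
    case 0
    then show ?case by (simp add: \<tau>_one)
  next
    case (Suc n)
    then show ?case
      using \<tau>_mult[of "\<one>\<^bsub>A\<^esub>" "\<one>\<^bsub>A\<^esub>" "\<iota> \<pi> [^]\<^bsub>K\<^esub> n" "\<iota> \<pi>"] by (simp add: \<omega>)
  qed
  have \<omega>_\<phi>: "\<exists>c\<in>carrier A. \<omega> [^]\<^bsub>B\<^esub> n \<otimes>\<^bsub>B\<^esub> \<phi> a = \<phi> c" if a: "a \<in> carrier A" for a and n :: nat
  proof -
    have \<pi>A: "\<pi> \<odot>\<^bsub>A\<^esub> \<one>\<^bsub>A\<^esub> \<in> carrier A" by simp
    then have "\<omega> [^]\<^bsub>B\<^esub> n \<otimes>\<^bsub>B\<^esub> \<phi> a = \<phi> ((\<pi> \<odot>\<^bsub>A\<^esub> \<one>\<^bsub>A\<^esub>) [^]\<^bsub>A\<^esub> n \<otimes>\<^bsub>A\<^esub> a)"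
      using a by (simp add: \<omega>_def \<phi>.ring.hom_nat_pow)
    then show ?thesis using a \<pi>A by blast
  qed
  show thesis
  proof (rule that[of \<phi>, folded \<omega>_def])
    show "\<phi> \<in> ring_hom A B" "\<omega> \<in> Units B" by fact+
    fix b assume "b \<in> carrier B"
    then show "\<exists>n::nat. \<exists>a\<in>carrier A. \<omega> [^]\<^bsub>B\<^esub> n \<otimes>\<^bsub>B\<^esub> b = \<phi> a"
    proof (rule \<tau>_induct)
      have "\<omega> [^]\<^bsub>B\<^esub> (0::nat) \<otimes>\<^bsub>B\<^esub> \<zero>\<^bsub>B\<^esub> = \<phi> \<zero>\<^bsub>A\<^esub>" by simp
      then show "\<exists>n::nat. \<exists>a\<in>carrier A. \<omega> [^]\<^bsub>B\<^esub> n \<otimes>\<^bsub>B\<^esub> \<zero>\<^bsub>B\<^esub> = \<phi> a" by blast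
    next
      fix a k assume a: "a \<in> carrier A" and k: "k \<in> carrier K"
      obtain n :: nat and r where r: "r \<in> carrier R" "\<iota> \<pi> [^]\<^bsub>K\<^esub> n \<otimes>\<^bsub>K\<^esub> k = \<iota> r" using denominator[OF k] by blast
      have "\<omega> [^]\<^bsub>B\<^esub> n \<otimes>\<^bsub>B\<^esub> \<tau> a k = \<tau> a (\<iota> \<pi> [^]\<^bsub>K\<^esub> n \<otimes>\<^bsub>K\<^esub> k)"
        using \<tau>_mult[of "\<one>\<^bsub>A\<^esub>" a "\<iota> \<pi> [^]\<^bsub>K\<^esub> n" k] a k by (simp add: \<omega>_pow)
      also have "\<dots> = \<phi> (r \<odot>\<^bsub>A\<^esub> a)"
        using r a by (simp add: \<phi>_def \<tau>_smult \<iota>_def)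
      finally show "\<exists>n::nat. \<exists>c\<in>carrier A. \<omega> [^]\<^bsub>B\<^esub> n \<otimes>\<^bsub>B\<^esub> \<tau> a k = \<phi> c"
        using r(1) a by (meson A.smult_closed)
    next
      fix x y assume xy: "x \<in> carrier B" "y \<in> carrier B"
        and "\<exists>n::nat. \<exists>a\<in>carrier A. \<omega> [^]\<^bsub>B\<^esub> n \<otimes>\<^bsub>B\<^esub> x = \<phi> a"
        and "\<exists>n::nat. \<exists>a\<in>carrier A. \<omega> [^]\<^bsub>B\<^esub> n \<otimes>\<^bsub>B\<^esub> y = \<phi> a"
      then obtain i j :: nat and a c where ac: "a \<in> carrier A" "\<omega> [^]\<^bsub>B\<^esub> i \<otimes>\<^bsub>B\<^esub> x = \<phi> a"
        "c \<in> carrier A" "\<omega> [^]\<^bsub>B\<^esub> j \<otimes>\<^bsub>B\<^esub> y = \<phi> c" by blast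
      obtain a' where a': "a' \<in> carrier A" "\<omega> [^]\<^bsub>B\<^esub> j \<otimes>\<^bsub>B\<^esub> \<phi> a = \<phi> a'" using \<omega>_\<phi>[OF ac(1)] by blast
      obtain c' where c': "c' \<in> carrier A" "\<omega> [^]\<^bsub>B\<^esub> i \<otimes>\<^bsub>B\<^esub> \<phi> c = \<phi> c'" using \<omega>_\<phi>[OF ac(3)] by blast
      have "(u \<otimes>\<^bsub>B\<^esub> v) \<otimes>\<^bsub>B\<^esub> (x \<ominus>\<^bsub>B\<^esub> y) = v \<otimes>\<^bsub>B\<^esub> (u \<otimes>\<^bsub>B\<^esub> x) \<ominus>\<^bsub>B\<^esub> u \<otimes>\<^bsub>B\<^esub> (v \<otimes>\<^bsub>B\<^esub> y)"
        if "u \<in> carrier B" "v \<in> carrier B" for u v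
        using that xy by (simp add: a_minus_def B.r_distr B.r_minus B.m_ac)
      then have "\<omega> [^]\<^bsub>B\<^esub> (i + j) \<otimes>\<^bsub>B\<^esub> (x \<ominus>\<^bsub>B\<^esub> y) = \<phi> a' \<ominus>\<^bsub>B\<^esub> \<phi> c'"
        using \<omega>c ac a' c' by (simp flip: B.nat_pow_mult)
      also have "\<dots> = \<phi> (a' \<ominus>\<^bsub>A\<^esub> c')" using a' c' by (simp add: a_minus_def)
      finally show "\<exists>n::nat. \<exists>a\<in>carrier A. \<omega> [^]\<^bsub>B\<^esub> n \<otimes>\<^bsub>B\<^esub> (x \<ominus>\<^bsub>B\<^esub> y) = \<phi> a"
        using a' c' by (meson A.minus_closed)
    qed
  qed
qed

end

context ff_model_over
begin

text \<open>The multiple \<open>\<pi> \<cdot> 1\<close>, in the form that the scalar multiplication of \<open>ff_model\<close> gives it.\<close>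

definition \<pi>\<^sub>D :: "nat multiset \<Rightarrow> nat multiset \<Rightarrow> 'a" where
  "\<pi>\<^sub>D = (\<lambda>e d. \<pi> \<otimes> \<one>\<^bsub>D\<^esub> e d)"

lemma \<pi>\<^sub>D_eq: "\<pi>\<^sub>D = series_term \<pi> {#} {#}"
  by (intro ext) (simp add: \<pi>\<^sub>D_def D_ops T.PS_one S.PS_one S.PS_zero series_term_def monomial_series_def)

lemma \<pi>\<^sub>D_F_1: "\<pi>\<^sub>D \<in> F 1"
proof (rule F_memI)
  show "\<pi>\<^sub>D \<in> carrier D" unfolding \<pi>\<^sub>D_eq by (rule series_term_closed) auto
  have "\<pi> \<in> V 1" using VI[of \<one> 1] by simp
  then show "\<pi>\<^sub>D e d \<in> V (1 - size d)" for e d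
    by (auto simp: \<pi>\<^sub>D_eq series_term_def monomial_series_def V_zero S.PS_zero)
qed

lemma ff_model_ops:
  "carrier (ff_model R \<pi> m n) = carrier D" "monoid.mult (ff_model R \<pi> m n) = monoid.mult D"
  "ring.add (ff_model R \<pi> m n) = ring.add D" "one (ff_model R \<pi> m n) = one D"
  "\<pi> \<odot>\<^bsub>ff_model R \<pi> m n\<^esub> f = (\<lambda>e d. \<pi> \<otimes> f e d)"
  by (simp_all add: ff_model_def ring.defs module.defs)

text \<open>If \<open>\<pi>\<close> were outside \<open>M\<close>, then \<open>1 - r \<pi> \<in> M\<close> for some \<open>r\<close>; but this is the image of an element
  \<open>1 - d \<pi>\<close> of \<open>R[[S]]\<langle>T\<rangle>\<close>, which is a unit.\<close>

lemma quotient_of_ff_model: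
  fixes A :: "('a, 'c) module"
  assumes A: "algebra R A" and h: "h \<in> algebra_hom R (ff_model R \<pi> m n) A"
    and onto: "h ` carrier (ff_model R \<pi> m n) = carrier A"
  shows "noetherian_cring A" and "\<And>M. maximalideal M A \<Longrightarrow> \<pi> \<odot>\<^bsub>A\<^esub> \<one>\<^bsub>A\<^esub> \<in> M"
proof -
  interpret A: algebra R A by fact
  have hD: "h \<in> ring_hom D A"
    using h unfolding algebra_hom_def by (simp add: ring_hom_def ff_model_ops)
  have onto_D: "h ` carrier D = carrier A" using onto by (simp add: ff_model_ops)
  interpret h: ring_hom_cring D A h
    by (intro ring_hom_cring.intro ring_hom_cring_axioms.intro hD D.is_cring A.is_cring)
  have "\<exists>u\<in>Units A. \<exists>x\<in>carrier D. u \<otimes>\<^bsub>A\<^esub> b = h x" if b: "b \<in> carrier A" for b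
  proof -
    obtain x where "x \<in> carrier D" "b = h x" using b unfolding onto_D[symmetric] by blast
    then show ?thesis using b A.Units_one_closed A.l_one by (intro bexI[of _ "\<one>\<^bsub>A\<^esub>"] bexI[of _ x]) auto
  qed
  then have "noetherian_ring A"
    by (rule noetherian_localisation[OF D_noetherian A.is_cring hD])
  then show "noetherian_cring A" by (simp add: noetherian_cring_def A.is_cring)
  then interpret A: noetherian_cring A .
  have h\<pi>: "h \<pi>\<^sub>D = \<pi> \<odot>\<^bsub>A\<^esub> \<one>\<^bsub>A\<^esub>"
  proof -
    have "h (\<pi> \<odot>\<^bsub>ff_model R \<pi> m n\<^esub> \<one>\<^bsub>D\<^esub>) = \<pi> \<odot>\<^bsub>A\<^esub> h \<one>\<^bsub>D\<^esub>"
      using h D.one_closed \<pi>_closed unfolding algebra_hom_def ff_model_ops(1) by blast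
    then show ?thesis by (simp add: ff_model_ops(5) \<pi>\<^sub>D_def)
  qed
  fix M assume M: "maximalideal M A"
  show "\<pi> \<odot>\<^bsub>A\<^esub> \<one>\<^bsub>A\<^esub> \<in> M"
  proof (rule ccontr)
    assume notin: "\<pi> \<odot>\<^bsub>A\<^esub> \<one>\<^bsub>A\<^esub> \<notin> M"
    have MI: "ideal M A" using M by (rule maximalideal.axioms)
    define x where "x = \<pi> \<odot>\<^bsub>A\<^esub> \<one>\<^bsub>A\<^esub>"
    have xc: "x \<in> carrier A" by (simp add: x_def)
    have "adjoin_ideal A M x = carrier A"
      using maximalideal.I_maximal[OF M A.adjoin_ideal_ideal[OF MI xc]] A.subset_adjoin_ideal[OF MI xc]
        notin A.ideal_subset_carrier[OF A.adjoin_ideal_ideal[OF MI xc]] unfolding x_def by blast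
    then have "\<one>\<^bsub>A\<^esub> \<in> adjoin_ideal A M x" by simp
    then obtain i r where ir: "i \<in> M" "r \<in> carrier A" "\<one>\<^bsub>A\<^esub> = i \<oplus>\<^bsub>A\<^esub> r \<otimes>\<^bsub>A\<^esub> x"
      unfolding adjoin_ideal_def by blast
    obtain d where d: "d \<in> carrier D" "r = h d" using ir(2) onto_D by blast
    have \<pi>D: "\<pi>\<^sub>D \<in> carrier D" using F_D[OF \<pi>\<^sub>D_F_1] .
    have unit: "\<one>\<^bsub>D\<^esub> \<ominus>\<^bsub>D\<^esub> d \<otimes>\<^bsub>D\<^esub> \<pi>\<^sub>D \<in> Units D"
      using D.one_minus_unit[OF ideal.I_l_closed[OF F_ideal \<pi>\<^sub>D_F_1 d(1)]] .
    have ic: "i \<in> carrier A" using ideal.Icarr[OF MI ir(1)] .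
    have rx: "r \<otimes>\<^bsub>A\<^esub> x \<in> carrier A" using ir(2) xc by simp
    have "(i \<oplus>\<^bsub>A\<^esub> w) \<ominus>\<^bsub>A\<^esub> w = i" if "w \<in> carrier A" for w
      using that ic by (simp add: a_minus_def A.a_assoc A.r_neg)
    then have "i = \<one>\<^bsub>A\<^esub> \<ominus>\<^bsub>A\<^esub> r \<otimes>\<^bsub>A\<^esub> x" using rx ir(3) by simp
    also have "\<dots> = h (\<one>\<^bsub>D\<^esub> \<ominus>\<^bsub>D\<^esub> d \<otimes>\<^bsub>D\<^esub> \<pi>\<^sub>D)"
      using d \<pi>D by (simp add: a_minus_def h\<pi> x_def)
    finally have i: "i = h (\<one>\<^bsub>D\<^esub> \<ominus>\<^bsub>D\<^esub> d \<otimes>\<^bsub>D\<^esub> \<pi>\<^sub>D)" .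
    obtain v where v: "v \<in> carrier D" "v \<otimes>\<^bsub>D\<^esub> (\<one>\<^bsub>D\<^esub> \<ominus>\<^bsub>D\<^esub> d \<otimes>\<^bsub>D\<^esub> \<pi>\<^sub>D) = \<one>\<^bsub>D\<^esub>"
      using unit unfolding Units_def by blast
    have "h v \<otimes>\<^bsub>A\<^esub> i = \<one>\<^bsub>A\<^esub>"
      unfolding i using v D.Units_closed[OF unit] by (simp flip: h.hom_mult)
    then have "\<one>\<^bsub>A\<^esub> \<in> M" using ideal.I_l_closed[OF MI ir(1), of "h v"] v(1) by simp
    then show False
      using ideal.one_imp_carrier[OF MI] maximalideal.I_notcarr[OF M] by blast
  qed
qed

end

theorem proposition1p2p3p1:
  fixes R :: "'r ring" and \<pi> :: 'r and K :: "('r, 'k) module" and B :: "('k, 'b) module"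
  assumes "complete_dvr R" and "uniformizer R \<pi>" and "fraction_field R K"
    and "semi_affinoid R \<pi> K B"
  shows "jacobson_ring B"
proof -
  interpret dvr_with_fraction_field R \<pi> K
    using assms(1-3)
    by (simp add: dvr_with_fraction_field_def dvr_with_fraction_field_axioms_def
        complete_dvr_with_uniformizer_def)
  have "cring B"
    using assms(4) by (simp add: semi_affinoid_def algebra_def)
  obtain A :: "('r, (nat multiset \<Rightarrow> nat multiset \<Rightarrow> 'r) set) module"
    where A: "ff_type R \<pi> A" "algebra_isomorphic K (base_change R A K) B"
    using assms(4) unfolding semi_affinoid_def by blast
  then obtain m n h where h: "algebra R A" "h \<in> algebra_hom R (ff_model R \<pi> m n) A"
    "h ` carrier (ff_model R \<pi> m n) = carrier A"
    unfolding ff_type_def by blast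
  interpret ff_model_over R \<pi> m n
    by (simp add: ff_model_over_def complete_dvr_with_uniformizer_axioms)
  obtain \<phi> where \<phi>: "\<phi> \<in> ring_hom A B" "\<phi> (\<pi> \<odot>\<^bsub>A\<^esub> \<one>\<^bsub>A\<^esub>) \<in> Units B"
    "\<And>b. b \<in> carrier B \<Longrightarrow> \<exists>n::nat. \<exists>a\<in>carrier A. \<phi> (\<pi> \<odot>\<^bsub>A\<^esub> \<one>\<^bsub>A\<^esub>) [^]\<^bsub>B\<^esub> n \<otimes>\<^bsub>B\<^esub> b = \<phi> a"
    using generic_fibre[OF h(1) \<open>cring B\<close> A(2)] by blast
  interpret A: algebra R A by (rule h(1))
  show ?thesis
    using jacobson_localisation[OF quotient_of_ff_model(1)[OF h] \<open>cring B\<close> \<phi>(1) _ quotient_of_ff_model(2)[OF h] \<phi>(2,3)]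
    by simp
qed

end
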